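(* Let $n\ge 2$, and let $m>0$, $\mu>0$, $c\ge 1$ and $p\in\left(2,\frac{2n}{n-1}\right)$ be fixed. Then there exists a ground state solution of $$\sqrt{-c^2\Delta+m^2c^4}\,u-mc^2u+\mu u=|u|^{p-2}u\quad\text{in }\mathbb{R}^n .$$
   Context: Functions are real-valued. $\hat u(\xi)=(2\pi)^{-n/2}\int_{\mathbb{R}^n}e^{-ix\cdot\xi}u(x)\,dx$ denotes the Fourier transform, and $\sqrt{-c^2\Delta+m^2c^4}$ is the Fourier multiplier operator with symbol $\sqrt{c^2|\xi|^2+m^2c^4}$. The functional associated with the equation is defined on $H^{1/2}(\mathbb{R}^n)$ by $$I(u)=\frac12\int_{\mathbb{R}^n}\left(\sqrt{c^2|\xi|^2+m^2c^4}-mc^2+\mu\right)|\hat u(\xi)|^2\,d\xi-\frac1p\int_{\mathbb{R}^n}|u|^p\,dx .$$ Solutions of the equation in $H^{1/2}(\mathbb{R}^n)$ are exactly the critical points of $I$. A critical point $u\in H^{1/2}(\mathbb{R}^n)$ of $I$ is called a ground state solution if $$I(u)=\min\{I(v)\;:\;v\in H^{1/2}(\mathbb{R}^n)\setminus\{0\},\ I'(v)=0\}.$$ *)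

theory Defs
  imports "HOL-Analysis.Analysis"
begin

definition square_integrable :: "('a::euclidean_space \<Rightarrow> 'b::{banach, second_countable_topology}) \<Rightarrow> bool"
  where "square_integrable f \<longleftrightarrow>
    f \<in> borel_measurable lborel \<and> integrable lborel (\<lambda>x. (norm (f x))\<^sup>2)"

definition fourier_integral :: "('a::euclidean_space \<Rightarrow> real) \<Rightarrow> 'a \<Rightarrow> complex"
  where "fourier_integral u \<xi> =
    complex_of_real ((2 * pi) powr (- real DIM('a) / 2)) *
    (LINT x|lborel. exp (- \<i> * complex_of_real (x \<bullet> \<xi>)) * complex_of_real (u x))"

text \<open>
  The integral above need not converge for a square integrable u. On that space the Fourier
  transform is its continuous extension, which is the limit in mean square of the transforms
  of the truncations of u to the balls of radius R about 0. The distance is a nonnegative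
  integral with values in [0, \<infinity>], so that a non-integrable difference does not count as 0.
\<close>

definition is_fourier_transform :: "('a::euclidean_space \<Rightarrow> real) \<Rightarrow> ('a \<Rightarrow> complex) \<Rightarrow> bool"
  where "is_fourier_transform u g \<longleftrightarrow>
    square_integrable g \<and>
    ((\<lambda>R::real. \<integral>\<^sup>+ \<xi>. ennreal ((cmod (fourier_integral (\<lambda>x. indicator (ball 0 R) x * u x) \<xi> - g \<xi>))\<^sup>2) \<partial>lborel)
      \<longlongrightarrow> 0) at_top"

text \<open>
  By Plancherel's theorem such a g exists for every square integrable u, and it is unique up
  to a null set. The transform is only used under integrals, so the choice of a
  representative does not matter.
\<close>

definition fourier :: "('a::euclidean_space \<Rightarrow> real) \<Rightarrow> 'a \<Rightarrow> complex"
  where "fourier u = (SOME g. is_fourier_transform u g)"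

text \<open>
  Elements of a Sobolev space are represented by functions, and equality in the space is
  equality almost everywhere.
\<close>

definition sobolev :: "real \<Rightarrow> ('a::euclidean_space \<Rightarrow> real) set"
  where "sobolev s = {u. square_integrable u \<and>
    integrable lborel (\<lambda>\<xi>. (1 + (norm \<xi>)\<^sup>2) powr s * (cmod (fourier u \<xi>))\<^sup>2)}"

definition sobolev_norm :: "real \<Rightarrow> ('a::euclidean_space \<Rightarrow> real) \<Rightarrow> real"
  where "sobolev_norm s u =
    sqrt (LINT \<xi>|lborel. (1 + (norm \<xi>)\<^sup>2) powr s * (cmod (fourier u \<xi>))\<^sup>2)"

definition has_frechet_derivative ::
    "real \<Rightarrow> (('a::euclidean_space \<Rightarrow> real) \<Rightarrow> real) \<Rightarrow> (('a \<Rightarrow> real) \<Rightarrow> real) \<Rightarrow> ('a \<Rightarrow> real) \<Rightarrow> bool"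
  where "has_frechet_derivative s J L u \<longleftrightarrow>
    (\<forall>h\<in>sobolev s. \<forall>k\<in>sobolev s. L (\<lambda>x. h x + k x) = L h + L k) \<and>
    (\<forall>a. \<forall>h\<in>sobolev s. L (\<lambda>x. a * h x) = a * L h) \<and>
    (\<exists>B. \<forall>h\<in>sobolev s. \<bar>L h\<bar> \<le> B * sobolev_norm s h) \<and>
    (\<forall>\<epsilon>>0. \<exists>\<delta>>0. \<forall>h\<in>sobolev s. sobolev_norm s h < \<delta> \<longrightarrow>
      \<bar>J (\<lambda>x. u x + h x) - J u - L h\<bar> \<le> \<epsilon> * sobolev_norm s h)"

definition critical_point ::
    "real \<Rightarrow> (('a::euclidean_space \<Rightarrow> real) \<Rightarrow> real) \<Rightarrow> ('a \<Rightarrow> real) \<Rightarrow> bool"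
  where "critical_point s J u \<longleftrightarrow>
    u \<in> sobolev s \<and> has_frechet_derivative s J (\<lambda>h. 0) u"

definition relativistic_symbol :: "real \<Rightarrow> real \<Rightarrow> 'a::euclidean_space \<Rightarrow> real"
  where "relativistic_symbol m c \<xi> = sqrt (c\<^sup>2 * (norm \<xi>)\<^sup>2 + m\<^sup>2 * c ^ 4)"

definition energy ::
    "real \<Rightarrow> real \<Rightarrow> real \<Rightarrow> real \<Rightarrow> ('a::euclidean_space \<Rightarrow> real) \<Rightarrow> real"
  where "energy m \<mu> c p u =
    1 / 2 * (LINT \<xi>|lborel. (relativistic_symbol m c \<xi> - m * c\<^sup>2 + \<mu>) * (cmod (fourier u \<xi>))\<^sup>2)
    - 1 / p * (LINT x|lborel. \<bar>u x\<bar> powr p)"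

text \<open>
  The multiplier operator of order one maps the Sobolev space of order 1/2 into its dual. This
  is the value of the functional it assigns to u at the test function v. The integral is
  real for real-valued u and v, and Re only adapts the type.
\<close>

definition relativistic_operator ::
    "real \<Rightarrow> real \<Rightarrow> ('a::euclidean_space \<Rightarrow> real) \<Rightarrow> ('a \<Rightarrow> real) \<Rightarrow> real"
  where "relativistic_operator m c u v =
    Re (LINT \<xi>|lborel. complex_of_real (relativistic_symbol m c \<xi>) * fourier u \<xi> * cnj (fourier v \<xi>))"

definition is_solution ::
    "real \<Rightarrow> real \<Rightarrow> real \<Rightarrow> real \<Rightarrow> ('a::euclidean_space \<Rightarrow> real) \<Rightarrow> bool"
  where "is_solution m \<mu> c p u \<longleftrightarrow>
    u \<in> sobolev (1 / 2) \<and>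
    (\<forall>v\<in>sobolev (1 / 2).
      relativistic_operator m c u v - m * c\<^sup>2 * (LINT x|lborel. u x * v x) + \<mu> * (LINT x|lborel. u x * v x)
      = (LINT x|lborel. \<bar>u x\<bar> powr (p - 2) * u x * v x))"

definition nonzero_critical_values ::
    "real \<Rightarrow> real \<Rightarrow> real \<Rightarrow> real \<Rightarrow> 'a::euclidean_space itself \<Rightarrow> real set"
  where "nonzero_critical_values m \<mu> c p _ =
    {energy m \<mu> c p v | v :: 'a \<Rightarrow> real.
      v \<in> sobolev (1 / 2) \<and> \<not> (AE x in lborel. v x = 0) \<and> critical_point (1 / 2) (energy m \<mu> c p) v}"

definition ground_state ::
    "real \<Rightarrow> real \<Rightarrow> real \<Rightarrow> real \<Rightarrow> ('a::euclidean_space \<Rightarrow> real) \<Rightarrow> bool"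
  where "ground_state m \<mu> c p u \<longleftrightarrow>
    critical_point (1 / 2) (energy m \<mu> c p) u \<and>
    energy m \<mu> c p u \<in> nonzero_critical_values m \<mu> c p TYPE('a) \<and>
    (\<forall>e\<in>nonzero_critical_values m \<mu> c p TYPE('a). energy m \<mu> c p u \<le> e)"

end

theory Submission
  imports Defs "HOL-Probability.Characteristic_Functions" "HOL-Complex_Analysis.Great_Picard"
begin

text \<open>
  Write \<open>A \<xi> = sqrt (c^2 * (norm \<xi>)^2 + m^2 * c^4) - m * c^2 + \<mu>\<close> for the symbol of the equation,
  \<open>Q u v\<close> for the bilinear form with this symbol on the Sobolev space \<open>H\<close> of order \<open>1/2\<close>, and
  \<open>N u\<close> for the integral of \<open>\<bar>u\<bar> powr p\<close>. The energy is \<open>Q u u / 2 - N u / p\<close>.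

  Let \<open>S\<close> be the infimum of \<open>Q u u\<close> over \<open>N u = 1\<close>. By homogeneity \<open>S * N u powr (2 / p) \<le> Q u u\<close>.
  A critical point \<open>v\<close> satisfies \<open>Q v v = N v\<close>, so if it is nonzero, then
  \<open>Q v v \<ge> S powr (p / (p - 2))\<close>, and its energy is \<open>(1/2 - 1/p) * Q v v\<close>. A ground state is therefore a
  nonzero solution \<open>g\<close> with \<open>Q g g \<le> S powr (p / (p - 2))\<close>; such a \<open>g\<close> is a multiple of a function \<open>w\<close>
  with \<open>w \<noteq> 0\<close>, \<open>Q w w \<le> S\<close> and \<open>Q w v = S * (LINT x. \<bar>w x\<bar> powr (p - 2) * w x * v x)\<close> for all \<open>v\<close>
  (\<open>minimiser_equation\<close>, \<open>least_form_solution\<close>).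

  This \<open>w\<close> is a weak limit of a minimising sequence \<open>u k\<close>. Expanding
  \<open>S * N (u k + t * v) powr (2 / p) \<le> Q (u k + t * v) (u k + t * v)\<close> in \<open>t\<close> and taking the discriminant shows
  that \<open>u k\<close> satisfies the Euler-Lagrange equation up to a term that tends to 0
  (\<open>almost_minimiser_almost_critical\<close>), and the equation passes to the limit. The limit could be 0, because
  the problem is invariant under translations and mass may escape to infinity. But a sequence with
  \<open>N (u k) = 1\<close> that is bounded in \<open>H\<close> has averages over balls of a fixed radius that stay
  away from 0 (\<open>half_modulus_nonvanishing\<close>); translating the centres of these balls to the origin makes the
  limit nonzero.

  The estimates in real space rest on one property of \<open>H\<close>: a translation by \<open>y\<close> moves a
  function by at most a multiple of \<open>norm y\<close> in the square of the \<open>L2\<close> distance. It bounds the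
  difference between a function and its averages over balls of radius \<open>r\<close> by a multiple of \<open>r\<close>. Choosing \<open>r\<close>
  according to the level gives weak-type bounds of the level sets and, for subcritical \<open>p\<close>, the
  embedding (\<open>half_modulus_embedding\<close>). Choosing a fixed small \<open>r\<close> gives non-vanishing, and letting \<open>r\<close>
  tend to 0 gives compactness with respect to convergence almost everywhere (\<open>half_modulus_compact\<close>).

  On the Fourier side, Plancherel's theorem for integrable functions is obtained by Gaussian
  regularisation; it yields existence, linearity and isometry of the transform on \<open>L2\<close>. The exchange
  formula \<open>fourier_exchange\<close> carries weak convergence over to the transforms, which makes \<open>H\<close> and \<open>Q\<close>
  closed under weak limits (\<open>form_weak_limit\<close>).
\<close>

section \<open>Square integrable functions\<close>

definition mean_square :: "('a::euclidean_space \<Rightarrow> 'b::{banach, second_countable_topology}) \<Rightarrow> real"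
  where "mean_square f = (LINT x|lborel. (norm (f x))\<^sup>2)"

lemma norm_add_square_le:
  fixes a b :: "'b::real_normed_vector"
  shows "(norm (a + b))\<^sup>2 \<le> 2 * (norm a)\<^sup>2 + 2 * (norm b)\<^sup>2"
proof -
  have "(norm (a + b))\<^sup>2 \<le> (norm a + norm b)\<^sup>2"
    by (intro power_mono norm_triangle_ineq) auto
  also have "\<dots> \<le> 2 * (norm a)\<^sup>2 + 2 * (norm b)\<^sup>2"
    using sum_squares_bound[of "norm a" "norm b"] by (simp add: power2_sum)
  finally show ?thesis .
qed

lemma norm_mult_le_squares:
  fixes a b :: "'b::real_normed_algebra"
  shows "norm (a * b) \<le> (norm a)\<^sup>2 + (norm b)\<^sup>2"
proof -
  have "norm (a * b) \<le> norm a * norm b" by (rule norm_mult_ineq)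
  also have "\<dots> \<le> (norm a)\<^sup>2 + (norm b)\<^sup>2"
    using sum_squares_bound[of "norm a" "norm b"] mult_nonneg_nonneg[OF norm_ge_zero[of a] norm_ge_zero[of b]]
    by linarith
  finally show ?thesis .
qed

lemma square_integrable_borel [measurable_dest]:
  "square_integrable f \<Longrightarrow> f \<in> borel_measurable borel"
  by (simp add: square_integrable_def)

lemma square_integrable_integrable:
  "square_integrable f \<Longrightarrow> integrable lborel (\<lambda>x. (norm (f x))\<^sup>2)"
  by (simp add: square_integrable_def)

lemma square_integrable_bound:
  fixes f :: "'a::euclidean_space \<Rightarrow> 'b::{banach, second_countable_topology}" and g :: "'a \<Rightarrow> real"
  assumes [measurable]: "f \<in> borel_measurable borel" and g: "integrable lborel g"
    and le: "AE x in lborel. (norm (f x))\<^sup>2 \<le> g x"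
  shows "square_integrable f"
  unfolding square_integrable_def
proof
  show "integrable lborel (\<lambda>x. (norm (f x))\<^sup>2)"
    by (rule Bochner_Integration.integrable_bound[OF g]) (use le in auto)
qed auto

lemma square_integrable_add:
  assumes f: "square_integrable f" and g: "square_integrable g"
  shows "square_integrable (\<lambda>x. f x + g x)"
proof (rule square_integrable_bound)
  show "(\<lambda>x. f x + g x) \<in> borel_measurable borel" using f g by measurable
  show "integrable lborel (\<lambda>x. 2 * (norm (f x))\<^sup>2 + 2 * (norm (g x))\<^sup>2)"
    using f g by (simp add: square_integrable_def)
qed (simp add: norm_add_square_le)

lemma square_integrable_mult_bounded:
  fixes f g :: "'a::euclidean_space \<Rightarrow> 'b::{real_normed_field, banach, second_countable_topology}"
  assumes f: "square_integrable f" and [measurable]: "g \<in> borel_measurable borel"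
    and B: "\<And>x. norm (g x) \<le> B"
  shows "square_integrable (\<lambda>x. g x * f x)"
proof (rule square_integrable_bound)
  show "(\<lambda>x. g x * f x) \<in> borel_measurable borel" using f by measurable
  show "integrable lborel (\<lambda>x. B\<^sup>2 * (norm (f x))\<^sup>2)"
    using f by (simp add: square_integrable_def)
  have "(norm (g x))\<^sup>2 \<le> B\<^sup>2" for x
    by (intro power_mono B) auto
  then show "AE x in lborel. (norm (g x * f x))\<^sup>2 \<le> B\<^sup>2 * (norm (f x))\<^sup>2"
    by (auto simp: norm_mult power_mult_distrib intro!: mult_right_mono)
qed

lemma square_integrable_cmult:
  fixes f :: "'a::euclidean_space \<Rightarrow> 'b::{real_normed_field, banach, second_countable_topology}"
  shows "square_integrable f \<Longrightarrow> square_integrable (\<lambda>x. c * f x)"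
  by (rule square_integrable_mult_bounded[where B="norm c"]) auto

lemma square_integrable_uminus:
  "square_integrable f \<Longrightarrow> square_integrable (\<lambda>x. - f x)"
  by (auto simp: square_integrable_def)

lemma square_integrable_diff:
  "square_integrable f \<Longrightarrow> square_integrable g \<Longrightarrow> square_integrable (\<lambda>x. f x - g x)"
  using square_integrable_add[of f "\<lambda>x. - g x"] square_integrable_uminus[of g] by simp

lemma square_integrable_times:
  fixes f g :: "'a::euclidean_space \<Rightarrow> 'b::{real_normed_field, banach, second_countable_topology}"
  assumes f: "square_integrable f" and g: "square_integrable g"
  shows "integrable lborel (\<lambda>x. f x * g x)"
proof (rule Bochner_Integration.integrable_bound)
  show "integrable lborel (\<lambda>x. (norm (f x))\<^sup>2 + (norm (g x))\<^sup>2)"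
    using f g by (simp add: square_integrable_def)
  show "(\<lambda>x. f x * g x) \<in> borel_measurable lborel" using f g by measurable
  show "AE x in lborel. norm (f x * g x) \<le> norm ((norm (f x))\<^sup>2 + (norm (g x))\<^sup>2)"
    using norm_mult_le_squares[of "f _" "g _"] by (auto simp: abs_of_nonneg)
qed

lemma square_integrable_of_real:
  "square_integrable u \<Longrightarrow> square_integrable (\<lambda>x. complex_of_real (u x))"
  by (auto simp: square_integrable_def)

lemma square_integrable_cnj:
  "square_integrable h \<Longrightarrow> square_integrable (\<lambda>x. cnj (h x))"
  unfolding square_integrable_def
  by (auto intro!: borel_measurable_continuous_on[of cnj] continuous_intros)

lemma square_integrable_indicator_ball:
  fixes f :: "'a::euclidean_space \<Rightarrow> real"
  shows "square_integrable f \<Longrightarrow> square_integrable (\<lambda>x. indicator (ball 0 R) x * f x)"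
  by (rule square_integrable_mult_bounded[where B=1]) (auto simp: indicator_def)

lemma mean_square_nonneg [simp]: "0 \<le> mean_square f"
  by (simp add: mean_square_def)

lemma mean_square_uminus [simp]: "mean_square (\<lambda>x. - f x) = mean_square f"
  by (simp add: mean_square_def)

lemma mean_square_minus_commute: "mean_square (\<lambda>x. f x - g x) = mean_square (\<lambda>x. g x - f x)"
  by (simp add: mean_square_def norm_minus_commute)

lemma mean_square_cmult:
  fixes f :: "'a::euclidean_space \<Rightarrow> 'b::{real_normed_field, banach, second_countable_topology}"
  shows "mean_square (\<lambda>x. c * f x) = (norm c)\<^sup>2 * mean_square f"
  by (simp add: mean_square_def norm_mult power_mult_distrib)

lemma mean_square_of_real [simp]: "mean_square (\<lambda>x. complex_of_real (u x)) = mean_square u"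
  by (simp add: mean_square_def)

lemma nn_integral_mean_square:
  "square_integrable f \<Longrightarrow> (\<integral>\<^sup>+x. ennreal ((norm (f x))\<^sup>2) \<partial>lborel) = ennreal (mean_square f)"
  unfolding mean_square_def by (rule nn_integral_eq_integral) (auto simp: square_integrable_def)

lemma mean_square_add_le:
  assumes f: "square_integrable f" and g: "square_integrable g"
  shows "mean_square (\<lambda>x. f x + g x) \<le> 2 * mean_square f + 2 * mean_square g"
proof -
  have "mean_square (\<lambda>x. f x + g x) \<le> (LINT x|lborel. 2 * (norm (f x))\<^sup>2 + 2 * (norm (g x))\<^sup>2)"
    unfolding mean_square_def
    by (rule integral_mono)
      (use f g square_integrable_add[OF f g] in \<open>auto simp: square_integrable_def norm_add_square_le\<close>)
  also have "\<dots> = 2 * mean_square f + 2 * mean_square g"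
    using f g by (simp add: square_integrable_def mean_square_def)
  finally show ?thesis .
qed

lemma mean_square_diff_triangle:
  assumes f: "square_integrable f" and g: "square_integrable g" and h: "square_integrable h"
  shows "mean_square (\<lambda>x. f x - h x)
    \<le> 2 * mean_square (\<lambda>x. f x - g x) + 2 * mean_square (\<lambda>x. g x - h x)"
  using mean_square_add_le[OF square_integrable_diff[OF f g] square_integrable_diff[OF g h]] by simp

lemma mean_square_cong_AE:
  assumes "AE x in lborel. f x = g x" "f \<in> borel_measurable borel" "g \<in> borel_measurable borel"
  shows "mean_square f = mean_square g"
  unfolding mean_square_def using assms by (intro integral_cong_AE) auto

lemma mean_square_eq_0_AE:
  assumes f: "square_integrable f" and 0: "mean_square f = 0"
  shows "AE x in lborel. f x = 0"
proof -
  have "AE x in lborel. (norm (f x))\<^sup>2 = 0"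
    using integral_nonneg_eq_0_iff_AE[of lborel "\<lambda>x. (norm (f x))\<^sup>2"] f 0
    by (auto simp: square_integrable_def mean_square_def)
  then show ?thesis by auto
qed

lemma Cauchy_Schwarz_mean_square:
  fixes f g :: "'a::euclidean_space \<Rightarrow> 'b::{real_normed_field, banach, second_countable_topology}"
  assumes f: "square_integrable f" and g: "square_integrable g"
  shows "norm (LINT x|lborel. f x * g x) \<le> sqrt (mean_square f) * sqrt (mean_square g)"
proof -
  let ?I = "\<integral>\<^sup>+x. ennreal (norm (f x)) * ennreal (norm (g x)) \<partial>lborel"
  have [measurable]: "f \<in> borel_measurable borel" "g \<in> borel_measurable borel"
    using f g by (auto simp: square_integrable_borel)
  have I: "?I = ennreal (LINT x|lborel. norm (f x * g x))"
    using integrable_norm[OF square_integrable_times[OF f g]]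
    by (subst nn_integral_eq_integral[symmetric]) (auto simp: ennreal_mult norm_mult)
  have "?I\<^sup>2 \<le> (\<integral>\<^sup>+x. (ennreal (norm (f x)))\<^sup>2 \<partial>lborel) * (\<integral>\<^sup>+x. (ennreal (norm (g x)))\<^sup>2 \<partial>lborel)"
    by (rule Cauchy_Schwarz_nn_integral) auto
  also have "\<dots> = ennreal (mean_square f * mean_square g)"
    using nn_integral_mean_square[OF f] nn_integral_mean_square[OF g]
    by (simp add: ennreal_power ennreal_mult)
  finally have "(LINT x|lborel. norm (f x * g x))\<^sup>2 \<le> mean_square f * mean_square g"
    unfolding I by (simp add: ennreal_power)
  then have "(LINT x|lborel. norm (f x * g x)) \<le> sqrt (mean_square f * mean_square g)"
    by (rule real_le_rsqrt)
  then show ?thesis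
    unfolding real_sqrt_mult by (rule order_trans[OF integral_norm_bound])
qed

lemma nn_integral_Fatou_bound:
  fixes u :: "nat \<Rightarrow> 'a \<Rightarrow> real"
  assumes [measurable]: "\<And>k. u k \<in> borel_measurable M" "v \<in> borel_measurable M"
    and lim: "AE x in M. (\<lambda>k. u k x) \<longlonglongrightarrow> v x"
    and bd: "eventually (\<lambda>k. (\<integral>\<^sup>+x. ennreal (u k x) \<partial>M) \<le> C) sequentially"
  shows "(\<integral>\<^sup>+x. ennreal (v x) \<partial>M) \<le> C"
proof -
  have "(\<integral>\<^sup>+x. ennreal (v x) \<partial>M) = (\<integral>\<^sup>+x. liminf (\<lambda>k. ennreal (u k x)) \<partial>M)"
  proof (rule nn_integral_cong_AE)
    show "AE x in M. ennreal (v x) = liminf (\<lambda>k. ennreal (u k x))"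
      using lim
    proof eventually_elim
      case (elim x)
      then have "(\<lambda>k. ennreal (u k x)) \<longlonglongrightarrow> ennreal (v x)" by (rule tendsto_ennrealI)
      then show ?case by (rule lim_imp_Liminf[OF trivial_limit_sequentially, symmetric])
    qed
  qed
  also have "\<dots> \<le> liminf (\<lambda>k. \<integral>\<^sup>+x. ennreal (u k x) \<partial>M)"
    by (rule nn_integral_liminf) auto
  also have "\<dots> \<le> liminf (\<lambda>k. C)"
    using bd by (rule Liminf_mono)
  also have "\<dots> = C" by (simp add: Liminf_const)
  finally show ?thesis .
qed

lemma Fatou_bound:
  fixes u :: "nat \<Rightarrow> 'a \<Rightarrow> real"
  assumes u: "\<And>k. integrable M (u k)" and v[measurable]: "v \<in> borel_measurable M"
    and nn: "\<And>k x. 0 \<le> u k x" "\<And>x. 0 \<le> v x"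
    and lim: "AE x in M. (\<lambda>k. u k x) \<longlonglongrightarrow> v x"
    and bd: "eventually (\<lambda>k. (LINT x|M. u k x) \<le> C) sequentially" and C: "0 \<le> C"
  shows "integrable M v" "(LINT x|M. v x) \<le> C"
proof -
  have *: "(\<integral>\<^sup>+x. ennreal (v x) \<partial>M) \<le> ennreal C"
  proof (rule nn_integral_Fatou_bound[OF _ v lim])
    show "eventually (\<lambda>k. (\<integral>\<^sup>+x. ennreal (u k x) \<partial>M) \<le> ennreal C) sequentially"
      using bd by eventually_elim (use u nn in \<open>simp add: nn_integral_eq_integral ennreal_leI\<close>)
  qed (use u in auto)
  show "integrable M v"
    by (rule integrableI_nonneg) (use nn * in \<open>auto intro: le_less_trans\<close>)
  then show "(LINT x|M. v x) \<le> C"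
    using * nn C by (simp add: nn_integral_eq_integral)
qed

text \<open>
  A Cauchy sequence in mean square has a subsequence along which the increments \<open>h j\<close> satisfy
  \<open>\<Sum>j. 2^j * mean_square (h j) < \<infinity>\<close>; it converges almost everywhere because
  \<open>2 * norm (h j) \<le> 2^j * (norm (h j))^2 + 2^(-j)\<close>.
\<close>

lemma mean_square_complete:
  fixes f :: "nat \<Rightarrow> 'a::euclidean_space \<Rightarrow> 'b::{banach, second_countable_topology}"
  assumes f: "\<And>k. square_integrable (f k)"
    and cauchy: "\<And>e. e > 0 \<Longrightarrow> \<exists>N. \<forall>k\<ge>N. \<forall>l\<ge>N. mean_square (\<lambda>x. f k x - f l x) < e"
  obtains g r where "square_integrable g" "strict_mono (r :: nat \<Rightarrow> nat)"
    "(\<lambda>k. mean_square (\<lambda>x. f k x - g x)) \<longlonglongrightarrow> 0" "AE x in lborel. (\<lambda>k. f (r k) x) \<longlonglongrightarrow> g x"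
proof -
  have [measurable]: "f k \<in> borel_measurable borel" for k using f by (rule square_integrable_borel)
  have "\<exists>N. \<forall>k\<ge>N. \<forall>l\<ge>N. mean_square (\<lambda>x. f k x - f l x) < (1/8)^j" for j
    by (rule cauchy) auto
  then obtain N where N: "\<And>j k l. N j \<le> k \<Longrightarrow> N j \<le> l \<Longrightarrow> mean_square (\<lambda>x. f k x - f l x) < (1/8)^j"
    by metis
  define r where "r j = (\<Sum>i\<le>j. N i) + j" for j
  have r: "strict_mono r" by (auto simp: strict_mono_Suc_iff r_def)
  have rN: "N j \<le> r j" for j
    unfolding r_def by (intro trans_le_add1 member_le_sum) auto
  define h where "h j x = f (r (Suc j)) x - f (r j) x" for j x
  have h: "square_integrable (h j)" for j
    unfolding h_def by (intro square_integrable_diff f)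
  have [measurable]: "h k \<in> borel_measurable borel" for k using h by (rule square_integrable_borel)
  have hms: "mean_square (h j) \<le> (1/8)^j" for j
    \<comment> \<open>Both indices exceed \<open>N j\<close>, so the increment inherits the rate of the Cauchy condition.\<close>
    unfolding h_def using N[of j "r (Suc j)" "r j"] rN[of j] strict_monoD[OF r, of j "Suc j"] by simp
  have "(\<integral>\<^sup>+x. (\<Sum>j. ennreal (2^j * (norm (h j x))\<^sup>2)) \<partial>lborel)
      = (\<Sum>j. \<integral>\<^sup>+x. ennreal (2^j * (norm (h j x))\<^sup>2) \<partial>lborel)"
    by (rule nn_integral_suminf) auto
  also have "\<dots> \<le> (\<Sum>j. ennreal ((1/4)^j))"
  proof (rule suminf_le)
    fix j
    have "(\<integral>\<^sup>+x. ennreal (2^j * (norm (h j x))\<^sup>2) \<partial>lborel) = ennreal (2^j * mean_square (h j))"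
      by (simp add: ennreal_mult nn_integral_cmult nn_integral_mean_square[OF h])
    also have "\<dots> \<le> ennreal (2^j * (1/8)^j)"
      by (intro ennreal_leI mult_left_mono hms) auto
    also have "2^j * (1/8)^j = (1/4::real)^j" by (simp flip: power_mult_distrib)
    finally show "(\<integral>\<^sup>+x. ennreal (2^j * (norm (h j x))\<^sup>2) \<partial>lborel) \<le> ennreal ((1/4)^j)" .
  qed auto
  also have "\<dots> = ennreal (\<Sum>j. (1/4)^j)"
    by (rule suminf_ennreal2) (auto intro: summable_geometric)
  also have "\<dots> < \<infinity>" by simp
  finally have "AE x in lborel. (\<Sum>j. ennreal (2^j * (norm (h j x))\<^sup>2)) \<noteq> \<infinity>"
    by (intro nn_integral_PInf_AE) auto
  then have conv: "AE x in lborel. convergent (\<lambda>j. f (r j) x)"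
  proof eventually_elim
    case (elim x)
    have "summable (\<lambda>j. 2^j * (norm (h j x))\<^sup>2)"
      by (rule summable_suminf_not_top) (use elim in auto)
    moreover have "summable (\<lambda>j. (1/2::real)^j)" by (simp add: summable_geometric)
    ultimately have "summable (\<lambda>j. 2^j * (norm (h j x))\<^sup>2 + (1/2)^j)" by (rule summable_add)
    moreover have "norm (h j x) \<le> 2^j * (norm (h j x))\<^sup>2 + (1/2)^j" for j
    proof -
      have "0 \<le> (2^j * norm (h j x) - 1)\<^sup>2 / 2^j" by simp
      also have "\<dots> = 2^j * (norm (h j x))\<^sup>2 - 2 * norm (h j x) + (1/2)^j"
        by (simp add: power2_eq_square field_simps power_one_over)
      finally show ?thesis using norm_ge_zero[of "h j x"] by linarith
    qed
    ultimately have "summable (\<lambda>j. norm (h j x))"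
      by (rule_tac summable_comparison_test'[of _ 0]) auto
    then have "summable (\<lambda>j. h j x)" by (rule summable_norm_cancel)
    then have "convergent (\<lambda>n. \<Sum>j<n. h j x)" by (simp add: summable_iff_convergent)
    then have "convergent (\<lambda>n. (\<Sum>j<n. h j x) + f (r 0) x)" 
      by (simp add: convergent_add_const_right_iff)
    moreover have "(\<Sum>j<n. h j x) + f (r 0) x = f (r n) x" for n
      unfolding h_def by (subst sum_lessThan_telescope) simp
    ultimately show ?case by simp
  qed
  define g where "g x = lim (\<lambda>j. f (r j) x)" for x
  have [measurable]: "g \<in> borel_measurable borel"
    unfolding g_def by (rule borel_measurable_lim_metric) auto
  have lim: "AE x in lborel. (\<lambda>j. f (r j) x) \<longlonglongrightarrow> g x"
    using conv unfolding g_def by eventually_elim (simp add: convergent_LIMSEQ_iff)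
  have bound: "\<exists>N. \<forall>k\<ge>N. square_integrable (\<lambda>x. f k x - g x) \<and> mean_square (\<lambda>x. f k x - g x) \<le> e"
    if e: "e > 0" for e
  proof -
    obtain N where N: "\<forall>k\<ge>N. \<forall>l\<ge>N. mean_square (\<lambda>x. f k x - f l x) < e"
      using cauchy[OF e] by auto
    have "integrable lborel (\<lambda>x. (norm (f k x - g x))\<^sup>2) \<and> (LINT x|lborel. (norm (f k x - g x))\<^sup>2) \<le> e"
      if k: "k \<ge> N" for k
    proof (intro conjI)
      have 1: "integrable lborel (\<lambda>x. (norm (f k x - f (r j) x))\<^sup>2)" for j
        using square_integrable_diff[OF f f] by (rule square_integrable_integrable)
      have 2: "AE x in lborel. (\<lambda>j. (norm (f k x - f (r j) x))\<^sup>2) \<longlonglongrightarrow> (norm (f k x - g x))\<^sup>2"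
        using lim by eventually_elim (intro tendsto_intros)
      have 3: "eventually (\<lambda>j. (LINT x|lborel. (norm (f k x - f (r j) x))\<^sup>2) \<le> e) sequentially"
        using eventually_ge_at_top[of N]
      proof eventually_elim
        case (elim j)
        then have "N \<le> r j" using seq_suble[OF r, of j] by simp
        then show ?case using N k unfolding mean_square_def by (simp add: less_imp_le)
      qed
      show "integrable lborel (\<lambda>x. (norm (f k x - g x))\<^sup>2)"
        by (rule Fatou_bound(1)[OF 1 _ _ _ 2 3]) (use e in auto)
      show "(LINT x|lborel. (norm (f k x - g x))\<^sup>2) \<le> e"
        by (rule Fatou_bound(2)[OF 1 _ _ _ 2 3]) (use e in auto)
    qed
    then show ?thesis unfolding square_integrable_def mean_square_def by (intro exI[of _ N]) auto
  qed
  obtain K where "square_integrable (\<lambda>x. f K x - g x)" using bound[of 1] by auto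
  from square_integrable_diff[OF f this, of K] have g: "square_integrable g" by simp
  have "(\<lambda>k. mean_square (\<lambda>x. f k x - g x)) \<longlonglongrightarrow> 0"
  proof (rule LIMSEQ_I)
    fix e :: real assume "e > 0"
    then obtain N where "\<forall>k\<ge>N. mean_square (\<lambda>x. f k x - g x) \<le> e/2" using bound[of "e/2"] by auto
    then show "\<exists>no. \<forall>n\<ge>no. norm (mean_square (\<lambda>x. f n x - g x) - 0) < e"
      using \<open>e > 0\<close> by (intro exI[of _ N]) fastforce
  qed
  with g r lim show ?thesis by (intro that) auto
qed

lemma inner_product_tendsto:
  fixes f g :: "nat \<Rightarrow> 'a::euclidean_space \<Rightarrow> 'b::{real_normed_field, banach, second_countable_topology}"
  assumes f: "\<And>k. square_integrable (f k)" "square_integrable f'"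
    and g: "\<And>k. square_integrable (g k)" "square_integrable g'"
    and lim: "(\<lambda>k. mean_square (\<lambda>x. f k x - f' x)) \<longlonglongrightarrow> 0" "(\<lambda>k. mean_square (\<lambda>x. g k x - g' x)) \<longlonglongrightarrow> 0"
  shows "(\<lambda>k. LINT x|lborel. f k x * g k x) \<longlonglongrightarrow> (LINT x|lborel. f' x * g' x)"
proof -
  let ?d = "\<lambda>k. sqrt (mean_square (\<lambda>x. f k x - f' x)) * sqrt (mean_square (\<lambda>x. g k x - g' x))
     + sqrt (mean_square (\<lambda>x. f k x - f' x)) * sqrt (mean_square g')
     + sqrt (mean_square f') * sqrt (mean_square (\<lambda>x. g k x - g' x))"
  have "?d \<longlonglongrightarrow> sqrt 0 * sqrt 0 + sqrt 0 * sqrt (mean_square g') + sqrt (mean_square f') * sqrt 0"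
    by (intro tendsto_intros lim)
  then have d: "?d \<longlonglongrightarrow> 0" by simp
  have df: "square_integrable (\<lambda>x. f k x - f' x)" and dg: "square_integrable (\<lambda>x. g k x - g' x)" for k
    by (intro square_integrable_diff f g)+
  have "norm ((LINT x|lborel. f k x * g k x) - (LINT x|lborel. f' x * g' x)) \<le> ?d k" for k
  proof -
    have "(LINT x|lborel. f k x * g k x) =
      (LINT x|lborel. ((f k x - f' x) * (g k x - g' x) + (f k x - f' x) * g' x) + (f' x * (g k x - g' x) + f' x * g' x))"
      by (simp add: algebra_simps)
    also have "\<dots> = (LINT x|lborel. (f k x - f' x) * (g k x - g' x)) + (LINT x|lborel. (f k x - f' x) * g' x)
       + ((LINT x|lborel. f' x * (g k x - g' x)) + (LINT x|lborel. f' x * g' x))"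
      by (subst Bochner_Integration.integral_add; (intro Bochner_Integration.integrable_add square_integrable_times df dg f g)?)+
        simp
    finally have eq: "(LINT x|lborel. f k x * g k x) - (LINT x|lborel. f' x * g' x) =
      (LINT x|lborel. (f k x - f' x) * (g k x - g' x)) + (LINT x|lborel. (f k x - f' x) * g' x)
       + (LINT x|lborel. f' x * (g k x - g' x))" by simp
    show ?thesis
      unfolding eq
      by (intro order_trans[OF norm_triangle_ineq] add_mono Cauchy_Schwarz_mean_square df dg f g)
  qed
  then have "(\<lambda>k. (LINT x|lborel. f k x * g k x) - (LINT x|lborel. f' x * g' x)) \<longlonglongrightarrow> 0"
    by (intro Lim_null_comparison[OF _ d]) auto
  then show ?thesis by (rule LIM_zero_cancel)
qed

lemma mean_square_tendsto:
  fixes f :: "nat \<Rightarrow> 'a::euclidean_space \<Rightarrow> complex"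
  assumes f: "\<And>k. square_integrable (f k)" "square_integrable f'"
    and lim: "(\<lambda>k. mean_square (\<lambda>x. f k x - f' x)) \<longlonglongrightarrow> 0"
  shows "(\<lambda>k. mean_square (f k)) \<longlonglongrightarrow> mean_square f'"
proof -
  have eq: "(LINT x|lborel. h x * cnj (h x)) = complex_of_real (mean_square h)" for h :: "'a \<Rightarrow> complex"
    unfolding mean_square_def integral_complex_of_real[symmetric]
    by (intro Bochner_Integration.integral_cong refl) (simp only: complex_norm_square)
  have "(\<lambda>k. LINT x|lborel. f k x * cnj (f k x)) \<longlonglongrightarrow> (LINT x|lborel. f' x * cnj (f' x))"
    by (intro inner_product_tendsto f square_integrable_cnj lim) (use lim in \<open>simp add: mean_square_def flip: complex_cnj_diff\<close>)
  then have "(\<lambda>k. complex_of_real (mean_square (f k))) \<longlonglongrightarrow> complex_of_real (mean_square f')"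
    by (simp only: eq)
  then show ?thesis by (simp only: tendsto_of_real_iff)
qed

section \<open>Translations\<close>

lemma lborel_translate:
  "distr lborel borel (\<lambda>x. x + c) = (lborel :: 'a::euclidean_space measure)"
proof -
  have "(\<lambda>x. x + c) = (+) c" by (simp add: fun_eq_iff add.commute)
  then show ?thesis using lborel_distr_plus[of c] by simp
qed

lemma
  fixes f :: "'a::euclidean_space \<Rightarrow> 'b::{banach, second_countable_topology}"
  assumes f[measurable]: "f \<in> borel_measurable borel"
  shows integral_translate: "(LINT x|lborel. f (x + c)) = (LINT x|lborel. f x)"
    and integrable_translate_iff: "integrable lborel (\<lambda>x. f (x + c)) \<longleftrightarrow> integrable lborel f"
proof -
  have "(LINT x|lborel. f x) = (LINT x|distr lborel borel (\<lambda>x. x + c). f x)"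
    by (simp add: lborel_translate)
  also have "\<dots> = (LINT x|lborel. f (x + c))"
    by (rule integral_distr) auto
  finally show "(LINT x|lborel. f (x + c)) = (LINT x|lborel. f x)" ..
  have "integrable lborel f \<longleftrightarrow> integrable (distr lborel borel (\<lambda>x. x + c)) f"
    by (simp add: lborel_translate)
  also have "\<dots> \<longleftrightarrow> integrable lborel (\<lambda>x. f (x + c))"
    by (rule integrable_distr_eq) auto
  finally show "integrable lborel (\<lambda>x. f (x + c)) \<longleftrightarrow> integrable lborel f" ..
qed

lemma square_integrable_translate:
  "square_integrable f \<Longrightarrow> square_integrable (\<lambda>x. f (x + c))"
  unfolding square_integrable_def
  using integrable_translate_iff[of "\<lambda>x. (norm (f x))\<^sup>2" c] by auto

lemma mean_square_translate:
  "f \<in> borel_measurable borel \<Longrightarrow> mean_square (\<lambda>x. f (x + c)) = mean_square f"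
  unfolding mean_square_def using integral_translate[of "\<lambda>x. (norm (f x))\<^sup>2" c] by auto

text \<open>
  Pointwise \<open>indicator U (x + h)\<close> tends to 1 on an open set \<open>U\<close>; the difference between \<open>A\<close> and
  an open neighbourhood of almost the same measure is translated to a set of the same measure.
\<close>

lemma translation_continuous_indicator:
  fixes A :: "'a::euclidean_space set" and h :: "nat \<Rightarrow> 'a"
  assumes A: "A \<in> sets borel" "emeasure lborel A < \<infinity>" and h: "h \<longlonglongrightarrow> 0"
  shows "(\<lambda>k. LINT x|lborel. \<bar>indicator A (x + h k) - indicator A x :: real\<bar>) \<longlonglongrightarrow> 0"
proof -
  note [measurable] = A(1)
  have iA: "integrable lborel (indicator A :: 'a \<Rightarrow> real)" using A by auto
  have iAt: "integrable lborel (\<lambda>x. indicator A (x + c) :: real)" for c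
    using integrable_translate_iff[of "indicator A :: 'a \<Rightarrow> real" c] iA by simp
  let ?a = "LINT x|lborel. (indicator A x :: real)"
  have "(\<lambda>k. LINT x|lborel. indicator A (x + h k) * indicator A x :: real) \<longlonglongrightarrow> ?a"
  proof (rule LIMSEQ_I)
    fix e :: real assume e: "e > 0"
    obtain U where U: "open U" "A \<subseteq> U" "emeasure lborel (U - A) < ennreal (e/2)"
      using outer_regular_lborel[OF A(1), of "e/2"] e by auto
    have [measurable]: "U \<in> sets borel" using U by auto
    have iD: "integrable lborel (indicator (U - A) :: 'a \<Rightarrow> real)"
      using U(3) by (intro integrable_real_indicator) (auto intro: less_trans)
    have iDt: "integrable lborel (\<lambda>x. indicator (U - A) (x + c) :: real)" for c
      using integrable_translate_iff[of "indicator (U - A) :: 'a \<Rightarrow> real" c] iD by simp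
    have D: "(LINT x|lborel. (indicator (U - A) x :: real)) < e/2"
    proof -
      have "emeasure lborel (U - A) = ennreal (measure lborel (U - A))"
        using U(3) by (intro emeasure_eq_ennreal_measure) auto
      then have "measure lborel (U - A) < e/2" using U(3) by (simp add: ennreal_less_iff)
      then show ?thesis by simp
    qed
    \<comment> \<open>On the open set \<open>U\<close> the translated indicator converges at every point of \<open>A\<close>.\<close>
    have "(\<lambda>k. LINT x|lborel. indicator U (x + h k) * indicator A x :: real) \<longlonglongrightarrow> ?a"
    proof (rule integral_dominated_convergence[where w="indicator A"])
      show "AE x in lborel. (\<lambda>k. indicator U (x + h k) * indicator A x :: real) \<longlonglongrightarrow> indicator A x"
      proof (rule AE_I2)
        fix x :: 'a
        show "(\<lambda>k. indicator U (x + h k) * indicator A x :: real) \<longlonglongrightarrow> indicator A x"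
        proof (cases "x \<in> A")
          case True
          have "(\<lambda>k. x + h k) \<longlonglongrightarrow> x + 0" by (intro tendsto_intros h)
          then have "eventually (\<lambda>k. x + h k \<in> U) sequentially"
            using U True by (intro topological_tendstoD) auto
          then have "eventually (\<lambda>k. indicator U (x + h k) * indicator A x = (indicator A x :: real)) sequentially"
            by eventually_elim auto
          then show ?thesis by (rule tendsto_eventually)
        qed simp
      qed
    qed (use iA in \<open>auto simp: indicator_def\<close>)
    from LIMSEQ_D[OF this, of "e/2"] e obtain N where
      N: "\<And>k. k \<ge> N \<Longrightarrow> norm ((LINT x|lborel. indicator U (x + h k) * indicator A x :: real) - ?a) < e/2"
      by auto
    have "norm ((LINT x|lborel. indicator A (x + h k) * indicator A x :: real) - ?a) < e" if k: "k \<ge> N" for k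
    proof -
      have m1: "integrable lborel (\<lambda>x. indicator A (x + h k) * indicator A x :: real)"
        by (rule Bochner_Integration.integrable_bound[OF iA]) (auto simp: indicator_def)
      have m2: "integrable lborel (\<lambda>x. indicator U (x + h k) * indicator A x :: real)"
        by (rule Bochner_Integration.integrable_bound[OF iA]) (auto simp: indicator_def)
      have le: "(LINT x|lborel. indicator A (x + h k) * indicator A x :: real) \<le> ?a"
        by (rule integral_mono[OF m1 iA]) (auto simp: indicator_def)
      have "(LINT x|lborel. indicator U (x + h k) * indicator A x :: real)
         \<le> (LINT x|lborel. indicator A (x + h k) * indicator A x + indicator (U - A) (x + h k) :: real)"
        using U(2) by (intro integral_mono m2 Bochner_Integration.integrable_add m1 iDt) (auto simp: indicator_def)
      also have "\<dots> = (LINT x|lborel. indicator A (x + h k) * indicator A x) + (LINT x|lborel. indicator (U - A) (x + h k) :: real)"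
        by (intro Bochner_Integration.integral_add m1 iDt)
      also have "(LINT x|lborel. indicator (U - A) (x + h k) :: real) = (LINT x|lborel. indicator (U - A) x)"
        by (rule integral_translate) auto
      finally show ?thesis using N[OF k] D le by (simp add: abs_real_def split: if_splits)
    qed
    then show "\<exists>no. \<forall>n\<ge>no. norm ((LINT x|lborel. indicator A (x + h n) * indicator A x :: real) - ?a) < e"
      by blast
  qed
  then have "(\<lambda>k. ?a + ?a - 2 * (LINT x|lborel. indicator A (x + h k) * indicator A x :: real)) \<longlonglongrightarrow> ?a + ?a - 2 * ?a"
    by (intro tendsto_intros)
  moreover have "(LINT x|lborel. \<bar>indicator A (x + h k) - indicator A x :: real\<bar>)
    = ?a + ?a - 2 * (LINT x|lborel. indicator A (x + h k) * indicator A x :: real)" for k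
  proof -
    have m1: "integrable lborel (\<lambda>x. indicator A (x + h k) * indicator A x :: real)"
      by (rule Bochner_Integration.integrable_bound[OF iA]) (auto simp: indicator_def)
    have "(LINT x|lborel. \<bar>indicator A (x + h k) - indicator A x :: real\<bar>)
      = (LINT x|lborel. indicator A (x + h k) + indicator A x - 2 * (indicator A (x + h k) * indicator A x) :: real)"
      by (intro Bochner_Integration.integral_cong) (auto simp: indicator_def)
    also have "\<dots> = (LINT x|lborel. indicator A (x + h k)) + ?a - 2 * (LINT x|lborel. indicator A (x + h k) * indicator A x :: real)"
      using m1 iA iAt by simp
    also have "(LINT x|lborel. indicator A (x + h k)) = ?a" by (rule integral_translate) auto
    finally show ?thesis .
  qed
  ultimately show ?thesis by simp
qed

lemma translation_continuous_L1:
  fixes f :: "'a::euclidean_space \<Rightarrow> 'b::{banach, second_countable_topology}" and h :: "nat \<Rightarrow> 'a"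
  assumes f: "integrable lborel f" and h: "h \<longlonglongrightarrow> 0"
  shows "(\<lambda>k. LINT x|lborel. norm (f (x + h k) - f x)) \<longlonglongrightarrow> 0"
  using f
proof (induction rule: integrable_induct)
  case (base A c)
  have "(\<lambda>k. (LINT x|lborel. \<bar>indicator A (x + h k) - indicator A x :: real\<bar>) * norm c) \<longlonglongrightarrow> 0 * norm c"
    using base by (intro tendsto_intros translation_continuous_indicator h) auto
  moreover have "norm (indicator A (x + h k) *\<^sub>R c - indicator A x *\<^sub>R c)
    = \<bar>indicator A (x + h k) - indicator A x\<bar> * norm c" for k x
    by (simp flip: scaleR_left_diff_distrib)
  ultimately show ?case by simp
next
  case (add f g)
  have t: "integrable lborel (\<lambda>x. f (x + c) - f x)" if "integrable lborel f" for f :: "'a \<Rightarrow> 'b" and c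
    using integrable_translate_iff[of f c] that by auto
  have "(\<lambda>k. (LINT x|lborel. norm (f (x + h k) - f x)) + (LINT x|lborel. norm (g (x + h k) - g x))) \<longlonglongrightarrow> 0 + 0"
    by (intro tendsto_add add)
  then have lim: "(\<lambda>k. (LINT x|lborel. norm (f (x + h k) - f x)) + (LINT x|lborel. norm (g (x + h k) - g x))) \<longlonglongrightarrow> 0"
    by simp
  show ?case
  proof (rule Lim_null_comparison[OF always_eventually lim], intro allI)
    fix k
    have "norm (LINT x|lborel. norm (f (x + h k) + g (x + h k) - (f x + g x)))
      = (LINT x|lborel. norm ((f (x + h k) - f x) + (g (x + h k) - g x)))"
      by (simp add: algebra_simps)
    also have "\<dots> \<le> (LINT x|lborel. norm (f (x + h k) - f x) + norm (g (x + h k) - g x))"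
      by (intro integral_mono norm_triangle_ineq integrable_norm Bochner_Integration.integrable_add t add)
    also have "\<dots> = (LINT x|lborel. norm (f (x + h k) - f x)) + (LINT x|lborel. norm (g (x + h k) - g x))"
      by (intro Bochner_Integration.integral_add integrable_norm t add)
    finally show "norm (LINT x|lborel. norm (f (x + h k) + g (x + h k) - (f x + g x)))
       \<le> (LINT x|lborel. norm (f (x + h k) - f x)) + (LINT x|lborel. norm (g (x + h k) - g x))" .
  qed
next
  case (lim f s)
  have [measurable]: "f \<in> borel_measurable borel" "s i \<in> borel_measurable borel" for i
    using lim.hyps(1,4) borel_measurable_integrable by force+
  have t: "integrable lborel (\<lambda>x. f (x + c))" if "integrable lborel f" for f :: "'a \<Rightarrow> 'b" and c
    using integrable_translate_iff[of f c] that by auto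
  have "(\<lambda>i. LINT x|lborel. norm (s i x - f x)) \<longlonglongrightarrow> (LINT x|lborel. norm (f x - f x))"
  proof (rule integral_dominated_convergence[where w="\<lambda>x. 3 * norm (f x)"])
    show "AE x in lborel. (\<lambda>i. norm (s i x - f x)) \<longlonglongrightarrow> norm (f x - f x)"
      using lim.hyps(2) by (intro AE_I2 tendsto_intros) auto
    show "AE x in lborel. norm (norm (s i x - f x)) \<le> 3 * norm (f x)" for i
    proof (rule AE_I2)
      fix x show "norm (norm (s i x - f x)) \<le> 3 * norm (f x)"
        using lim.hyps(3)[of x i] norm_triangle_ineq4[of "s i x" "f x"] by simp
    qed
  qed (use lim.hyps in auto)
  then have s: "(\<lambda>i. LINT x|lborel. norm (s i x - f x)) \<longlonglongrightarrow> 0" by simp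
  show ?case
  proof (rule LIMSEQ_I)
    fix e :: real assume e: "e > 0"
    from LIMSEQ_D[OF s, of "e/3"] e obtain i where i: "(LINT x|lborel. norm (s i x - f x)) < e/3"
      by (force simp: abs_of_nonneg)
    from LIMSEQ_D[OF lim.IH[of i], of "e/3"] e obtain N where
      N: "\<And>k. k \<ge> N \<Longrightarrow> (LINT x|lborel. norm (s i (x + h k) - s i x)) < e/3"
      by (force simp: abs_of_nonneg)
    have "(LINT x|lborel. norm (f (x + h k) - f x)) < e" if k: "k \<ge> N" for k
    proof -
      have "(LINT x|lborel. norm (f (x + h k) - f x))
        \<le> (LINT x|lborel. norm (s i (x + h k) - f (x + h k)) + (norm (s i (x + h k) - s i x) + norm (s i x - f x)))"
      proof (rule integral_mono)
        fix x show "norm (f (x + h k) - f x) \<le> norm (s i (x + h k) - f (x + h k)) + (norm (s i (x + h k) - s i x) + norm (s i x - f x))"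
          by (metis add.commute diff_add_cancel norm_diff_triangle_le norm_minus_commute order_refl)
      qed (use lim.hyps t in auto)
      also have "\<dots> = (LINT x|lborel. norm (s i (x + h k) - f (x + h k)))
          + ((LINT x|lborel. norm (s i (x + h k) - s i x)) + (LINT x|lborel. norm (s i x - f x)))"
        using lim.hyps t by simp
      also have "(LINT x|lborel. norm (s i (x + h k) - f (x + h k))) = (LINT x|lborel. norm (s i x - f x))"
        by (rule integral_translate[of "\<lambda>x. norm (s i x - f x)"]) auto
      finally show ?thesis using i N[OF k] by simp
    qed
    then show "\<exists>no. \<forall>n\<ge>no. norm ((LINT x|lborel. norm (f (x + h n) - f x)) - 0) < e"
      by (intro exI[of _ N]) (simp add: abs_of_nonneg)
  qed
qed

lemma square_diff_le_signed_squares: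
  fixes a b :: real
  shows "(a - b)\<^sup>2 \<le> 2 * \<bar>a * \<bar>a\<bar> - b * \<bar>b\<bar>\<bar>"
proof (cases "a * b \<ge> 0")
  case True
  have "(a - b)\<^sup>2 \<le> \<bar>a - b\<bar> * (\<bar>a\<bar> + \<bar>b\<bar>)"
    unfolding power2_eq_square abs_mult_self_eq[symmetric, of "a - b"] by (intro mult_left_mono) auto
  also have "\<dots> = \<bar>a * \<bar>a\<bar> - b * \<bar>b\<bar>\<bar>"
  proof -
    have "\<bar>a - b\<bar> * (\<bar>a\<bar> + \<bar>b\<bar>) = \<bar>a - b\<bar> * \<bar>a + b\<bar>"
      using True by (auto simp: zero_le_mult_iff)
    also have "\<dots> = \<bar>a * a - b * b\<bar>" by (simp add: abs_mult[symmetric] algebra_simps)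
    also have "\<dots> = \<bar>a * \<bar>a\<bar> - b * \<bar>b\<bar>\<bar>"
      using True by (auto simp: zero_le_mult_iff zero_less_mult_iff abs_if)
    finally show ?thesis .
  qed
  finally have "(a - b)\<^sup>2 \<le> \<bar>a * \<bar>a\<bar> - b * \<bar>b\<bar>\<bar>" .
  moreover have "\<bar>y\<bar> \<le> 2 * \<bar>y\<bar>" for y :: real by simp
  ultimately show ?thesis by (rule order_trans)
next
  case False
  then have "a > 0 \<and> b < 0 \<or> a < 0 \<and> b > 0" by (auto simp: mult_less_0_iff not_le)
  then have "a * \<bar>a\<bar> - b * \<bar>b\<bar> = a\<^sup>2 + b\<^sup>2 \<or> a * \<bar>a\<bar> - b * \<bar>b\<bar> = - (a\<^sup>2 + b\<^sup>2)"
    by (auto simp: power2_eq_square)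
  then have *: "\<bar>a * \<bar>a\<bar> - b * \<bar>b\<bar>\<bar> = a\<^sup>2 + b\<^sup>2"
    using sum_power2_ge_zero[of a b] by linarith
  show ?thesis unfolding * using sum_squares_bound[of a "-b"] by (simp add: power2_diff)
qed

text \<open>Continuity in mean square reduces to continuity in the mean of \<open>u * \<bar>u\<bar>\<close>.\<close>

lemma translation_continuous_mean_square:
  fixes u :: "'a::euclidean_space \<Rightarrow> real" and h :: "nat \<Rightarrow> 'a"
  assumes u: "square_integrable u" and h: "h \<longlonglongrightarrow> 0"
  shows "(\<lambda>k. mean_square (\<lambda>x. u (x + h k) - u x)) \<longlonglongrightarrow> 0"
proof -
  have [measurable]: "u \<in> borel_measurable borel" using u by (rule square_integrable_borel)
  define v where "v x = u x * \<bar>u x\<bar>" for x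
  have [measurable]: "v \<in> borel_measurable borel" unfolding v_def by measurable
  have v: "integrable lborel v"
    by (rule Bochner_Integration.integrable_bound[OF square_integrable_integrable[OF u]])
      (auto simp: v_def abs_mult power2_eq_square)
  have vt: "integrable lborel (\<lambda>x. v (x + c))" for c
    using integrable_translate_iff[of v c] v by auto
  have ut: "square_integrable (\<lambda>x. u (x + c) - u x)" for c
    by (intro square_integrable_diff square_integrable_translate u)
  have "(\<lambda>k. 2 * (LINT x|lborel. norm (v (x + h k) - v x))) \<longlonglongrightarrow> 2 * 0"
    by (intro tendsto_intros translation_continuous_L1 v h)
  then have lim: "(\<lambda>k. 2 * (LINT x|lborel. norm (v (x + h k) - v x))) \<longlonglongrightarrow> 0" by simp
  show ?thesis
  proof (rule Lim_null_comparison[OF always_eventually lim], intro allI)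
    fix k
    have "mean_square (\<lambda>x. u (x + h k) - u x) \<le> (LINT x|lborel. 2 * norm (v (x + h k) - v x))"
      unfolding mean_square_def
    proof (rule integral_mono)
      show "integrable lborel (\<lambda>x. (norm (u (x + h k) - u x))\<^sup>2)"
        by (rule square_integrable_integrable[OF ut])
      show "(norm (u (x + h k) - u x))\<^sup>2 \<le> 2 * norm (v (x + h k) - v x)" for x
        using square_diff_le_signed_squares[of "u (x + h k)" "u x"] by (simp add: v_def)
    qed (use v vt in auto)
    then show "norm (mean_square (\<lambda>x. u (x + h k) - u x)) \<le> 2 * (LINT x|lborel. norm (v (x + h k) - v x))"
      by simp
  qed
qed


section \<open>The Gaussian and its transform\<close>

definition gauss :: "'a::euclidean_space \<Rightarrow> real"
  where "gauss x = exp (- (norm x)\<^sup>2 / 2)"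

text \<open>
  The unnormalised Fourier integral, on complex functions: the regularised Plancherel identity
  applies it to products of transforms.
\<close>

definition char_transform :: "('a::euclidean_space \<Rightarrow> complex) \<Rightarrow> 'a \<Rightarrow> complex"
  where "char_transform f \<xi> = (LINT x|lborel. exp (- \<i> * complex_of_real (x \<bullet> \<xi>)) * f x)"

lemma norm_exp_character [simp]: "cmod (exp (- \<i> * complex_of_real t)) = 1"
  by (simp add: norm_exp_eq_Re)

lemma norm_exp_character' [simp]: "cmod (exp (- (\<i> * complex_of_real t))) = 1"
  by (simp add: norm_exp_eq_Re)

lemma gauss_measurable [measurable]: "gauss \<in> borel_measurable borel"
  unfolding gauss_def by measurable

lemma gauss_pos [simp]: "0 < gauss x" "0 \<le> gauss x" "gauss x \<noteq> 0"
  by (auto simp: gauss_def)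

lemma gauss_le_1 [simp]: "gauss x \<le> 1"
  by (simp add: gauss_def)

lemma gauss_eq_prod: "gauss (x::'a::euclidean_space) = (\<Prod>b\<in>Basis. exp (- (x \<bullet> b)\<^sup>2 / 2))"
proof -
  have "(norm x)\<^sup>2 = (\<Sum>b\<in>Basis. (x \<bullet> b)\<^sup>2)"
    unfolding norm_eq_sqrt_inner by (simp add: euclidean_inner[of x x] power2_eq_square sum_nonneg)
  then show ?thesis
    by (simp add: gauss_def exp_sum[symmetric] sum_divide_distrib sum_negf)
qed

lemma integral_lborel_prod:
  fixes f :: "'a::euclidean_space \<Rightarrow> real \<Rightarrow> 'b::{real_normed_field, banach, second_countable_topology}"
  assumes f: "\<And>b. b \<in> Basis \<Longrightarrow> integrable lborel (f b)"
  shows "integrable lborel (\<lambda>x. \<Prod>b\<in>Basis. f b (x \<bullet> b))"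
    and "(LINT x|lborel. (\<Prod>b\<in>Basis. f b (x \<bullet> b))) = (\<Prod>b\<in>Basis. (LINT t|lborel. f b t))"
proof -
  interpret product_sigma_finite "\<lambda>_::'a. lborel :: real measure" ..
  let ?M = "\<Pi>\<^sub>M b\<in>(Basis::'a set). (lborel :: real measure)"
  let ?T = "\<lambda>g. \<Sum>b\<in>(Basis::'a set). g b *\<^sub>R b"
  have [measurable]: "f b \<in> borel_measurable borel" if "b \<in> Basis" for b
    using f[OF that] borel_measurable_integrable by force
  have T[measurable]: "?T \<in> measurable ?M borel" by measurable
  have eq: "(\<Prod>b\<in>Basis. f b (?T g \<bullet> b)) = (\<Prod>b\<in>Basis. f b (g b))" for g
    by (intro prod.cong refl) (simp add: inner_sum_left_Basis)
  have m: "(\<lambda>x::'a. \<Prod>b\<in>Basis. f b (x \<bullet> b)) \<in> borel_measurable borel"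
    by (intro borel_measurable_prod) measurable
  show "integrable lborel (\<lambda>x. \<Prod>b\<in>Basis. f b (x \<bullet> b))"
    unfolding lborel_eq[where 'a='a]
    by (subst integrable_distr_eq[OF T m]) (simp only: eq, intro product_integrable_prod f, auto)
  show "(LINT x|lborel. (\<Prod>b\<in>Basis. f b (x \<bullet> b))) = (\<Prod>b\<in>Basis. (LINT t|lborel. f b t))"
    unfolding lborel_eq[where 'a='a]
    by (subst integral_distr[OF T m]) (simp only: eq, intro product_integral_prod f, auto)
qed

lemma gauss_transform_real:
  fixes t :: real
  shows "integrable lborel (\<lambda>x. exp (- \<i> * complex_of_real (x * t)) * complex_of_real (exp (- x\<^sup>2 / 2)))"
    and "(LINT x|lborel. exp (- \<i> * complex_of_real (x * t)) * complex_of_real (exp (- x\<^sup>2 / 2)))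
      = complex_of_real (sqrt (2 * pi) * exp (- t\<^sup>2 / 2))"
proof -
  have d: "exp (- x\<^sup>2 / 2) = sqrt (2 * pi) * std_normal_density x" for x
    by (simp add: std_normal_density_def)
  have i: "integrable lborel std_normal_density" by simp
  have "integrable lborel (\<lambda>x::real. exp (- x\<^sup>2 / 2))"
    unfolding d using i by (rule integrable_mult_right)
  then show "integrable lborel (\<lambda>x. exp (- \<i> * complex_of_real (x * t)) * complex_of_real (exp (- x\<^sup>2 / 2)))"
    by (rule Bochner_Integration.integrable_bound) (auto simp: norm_mult)
  have "complex_of_real (exp (- t\<^sup>2 / 2)) = char std_normal_distribution (- t)"
    by (simp add: char_std_normal_distribution)
  also have "\<dots> = (LINT x|lborel. std_normal_density x *\<^sub>R iexp (- t * x))"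
    unfolding char_def by (subst integral_density) (auto simp: normal_density_nonneg)
  finally have *: "(LINT x|lborel. std_normal_density x *\<^sub>R iexp (- t * x)) = complex_of_real (exp (- t\<^sup>2 / 2))" ..
  have "(LINT x|lborel. exp (- \<i> * complex_of_real (x * t)) * complex_of_real (exp (- x\<^sup>2 / 2)))
    = (LINT x|lborel. complex_of_real (sqrt (2 * pi)) * (std_normal_density x *\<^sub>R iexp (- t * x)))"
    unfolding d by (intro Bochner_Integration.integral_cong refl) (simp add: scaleR_conv_of_real mult.commute[of t])
  also have "\<dots> = complex_of_real (sqrt (2 * pi)) * complex_of_real (exp (- t\<^sup>2 / 2))"
    unfolding * [symmetric] by (rule integral_mult_right_zero)
  finally show "(LINT x|lborel. exp (- \<i> * complex_of_real (x * t)) * complex_of_real (exp (- x\<^sup>2 / 2)))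
      = complex_of_real (sqrt (2 * pi) * exp (- t\<^sup>2 / 2))" by simp
qed

text \<open>
  Character and Gaussian are products over the coordinates, so the one-dimensional case, which is the
  characteristic function of the normal distribution, suffices.
\<close>

lemma gauss_transform:
  fixes \<xi> :: "'a::euclidean_space"
  shows "integrable lborel (\<lambda>x::'a. exp (- \<i> * complex_of_real (x \<bullet> \<xi>)) * complex_of_real (gauss x))"
    and "char_transform (\<lambda>x. complex_of_real (gauss x)) \<xi>
      = complex_of_real (sqrt (2 * pi) ^ DIM('a) * gauss \<xi>)"
proof -
  let ?f = "\<lambda>b t. exp (- \<i> * complex_of_real (t * (\<xi> \<bullet> b))) * complex_of_real (exp (- t\<^sup>2 / 2))"
  have eq: "exp (- \<i> * complex_of_real (x \<bullet> \<xi>)) * complex_of_real (gauss x) = (\<Prod>b\<in>Basis. ?f b (x \<bullet> b))" for x :: 'a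
  proof -
    have "exp (- \<i> * complex_of_real (x \<bullet> \<xi>)) = (\<Prod>b\<in>Basis. exp (- \<i> * complex_of_real ((x \<bullet> b) * (\<xi> \<bullet> b))))"
      by (subst euclidean_inner) (simp add: exp_sum[symmetric] sum_negf sum_distrib_left)
    then show ?thesis by (simp add: gauss_eq_prod prod.distrib)
  qed
  show "integrable lborel (\<lambda>x::'a. exp (- \<i> * complex_of_real (x \<bullet> \<xi>)) * complex_of_real (gauss x))"
    unfolding eq by (intro integral_lborel_prod gauss_transform_real)
  have "char_transform (\<lambda>x. complex_of_real (gauss x)) \<xi> = (\<Prod>b\<in>Basis. (LINT t|lborel. ?f b t))"
    unfolding char_transform_def eq by (intro integral_lborel_prod gauss_transform_real)
  also have "\<dots> = (\<Prod>b\<in>Basis. complex_of_real (sqrt (2 * pi) * exp (- (\<xi> \<bullet> b)\<^sup>2 / 2)))"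
    by (intro prod.cong refl gauss_transform_real)
  also have "\<dots> = complex_of_real (sqrt (2 * pi) ^ DIM('a) * gauss \<xi>)"
    by (simp add: gauss_eq_prod prod.distrib)
  finally show "char_transform (\<lambda>x. complex_of_real (gauss x)) \<xi>
      = complex_of_real (sqrt (2 * pi) ^ DIM('a) * gauss \<xi>)" .
qed

lemma integrable_gauss: "integrable lborel (gauss :: 'a::euclidean_space \<Rightarrow> real)"
  using gauss_transform(1)[of "0::'a"] by (simp add: complex_of_real_integrable_eq)

lemma integral_gauss: "(LINT x|lborel. gauss (x::'a::euclidean_space)) = sqrt (2 * pi) ^ DIM('a)"
proof -
  have "complex_of_real (LINT x|lborel. gauss (x::'a)) = complex_of_real (sqrt (2 * pi) ^ DIM('a))"
    using gauss_transform(2)[of "0::'a"] by (simp add: char_transform_def gauss_def)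
  then show ?thesis by (simp only: of_real_eq_iff)
qed

lemma
  fixes f :: "'a::euclidean_space \<Rightarrow> 'b::{banach, second_countable_topology}"
  assumes [measurable]: "f \<in> borel_measurable borel" and c: "c > 0"
  shows integral_scale: "(LINT x|lborel. f x) = c ^ DIM('a) *\<^sub>R (LINT x|lborel. f (c *\<^sub>R x))"
    and integrable_scale_iff: "integrable lborel (\<lambda>x. f (c *\<^sub>R x)) \<longleftrightarrow> integrable lborel f"
proof -
  have eq: "lborel = density (distr lborel borel (\<lambda>x::'a. c *\<^sub>R x)) (\<lambda>_. ennreal (c ^ DIM('a)))"
    using lborel_affine[of c "0::'a"] c by simp
  have "(LINT x|lborel. f x) = (LINT x|density (distr lborel borel (\<lambda>x::'a. c *\<^sub>R x)) (\<lambda>_. ennreal (c ^ DIM('a))). f x)"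
    by (simp flip: eq)
  also have "\<dots> = c ^ DIM('a) *\<^sub>R (LINT x|lborel. f (c *\<^sub>R x))"
    using c by (subst integral_density) (auto simp: integral_distr)
  finally show "(LINT x|lborel. f x) = c ^ DIM('a) *\<^sub>R (LINT x|lborel. f (c *\<^sub>R x))" .
  have "integrable lborel f \<longleftrightarrow> integrable (density (distr lborel borel (\<lambda>x::'a. c *\<^sub>R x)) (\<lambda>_. ennreal (c ^ DIM('a)))) f"
    by (simp flip: eq)
  also have "\<dots> \<longleftrightarrow> integrable lborel (\<lambda>x. f (c *\<^sub>R x))"
  proof -
    have "integrable lborel (\<lambda>x. f (c *\<^sub>R x))" if "integrable lborel (\<lambda>x. c ^ DIM('a) *\<^sub>R f (c *\<^sub>R x))"
      using integrable_scaleR_right[of "1 / c ^ DIM('a)", OF that] c by simp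
    then show ?thesis
      using c by (subst integrable_density) (auto simp: integrable_distr_eq)
  qed
  finally show "integrable lborel (\<lambda>x. f (c *\<^sub>R x)) \<longleftrightarrow> integrable lborel f" ..
qed

lemma gauss_transform_scaled:
  fixes \<xi> :: "'a::euclidean_space"
  assumes c: "c > 0"
  shows "c ^ DIM('a) *\<^sub>R char_transform (\<lambda>x. complex_of_real (gauss (c *\<^sub>R x))) (c *\<^sub>R \<xi>)
      = complex_of_real (sqrt (2 * pi) ^ DIM('a) * gauss \<xi>)"
proof -
  have "complex_of_real (sqrt (2 * pi) ^ DIM('a) * gauss \<xi>)
     = (LINT x|lborel. exp (- \<i> * complex_of_real (x \<bullet> \<xi>)) * complex_of_real (gauss x))"
    unfolding gauss_transform(2)[symmetric] char_transform_def ..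
  also have "\<dots> = c ^ DIM('a) *\<^sub>R char_transform (\<lambda>x. complex_of_real (gauss (c *\<^sub>R x))) (c *\<^sub>R \<xi>)"
    unfolding char_transform_def by (subst integral_scale[OF _ c]) (auto simp: inner_commute)
  finally show ?thesis ..
qed

lemma integrable_character_mult:
  assumes f: "integrable lborel f"
  shows "integrable lborel (\<lambda>x. exp (- \<i> * complex_of_real (x \<bullet> \<xi>)) * f x)"
proof (rule Bochner_Integration.integrable_bound[OF f])
  have [measurable]: "f \<in> borel_measurable borel" using f borel_measurable_integrable by force
  show "(\<lambda>x. exp (- \<i> * complex_of_real (x \<bullet> \<xi>)) * f x) \<in> borel_measurable lborel" by measurable
qed (simp add: norm_mult)

lemma char_transform_measurable [measurable]:
  assumes [measurable]: "f \<in> borel_measurable borel"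
  shows "char_transform f \<in> borel_measurable borel"
  unfolding char_transform_def by measurable

lemma norm_char_transform_le:
  "integrable lborel f \<Longrightarrow> cmod (char_transform f \<xi>) \<le> (LINT x|lborel. cmod (f x))"
  unfolding char_transform_def
  by (rule order_trans[OF integral_norm_bound]) (simp add: norm_mult)

text \<open>
  Both sides are the double integral of \<open>exp (- \<i> * (x \<bullet> \<xi>)) * f x * h \<xi>\<close>.
\<close>

lemma char_transform_exchange:
  fixes f h :: "'a::euclidean_space \<Rightarrow> complex"
  assumes f: "integrable lborel f" and h: "integrable lborel h"
  shows "(LINT \<xi>|lborel. char_transform f \<xi> * h \<xi>) = (LINT x|lborel. f x * char_transform h x)"
proof -
  have [measurable]: "f \<in> borel_measurable borel" "h \<in> borel_measurable borel"
    using f h borel_measurable_integrable by force+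
  let ?F = "\<lambda>x \<xi>. exp (- \<i> * complex_of_real (x \<bullet> \<xi>)) * f x * h \<xi>"
  have "integrable (lborel \<Otimes>\<^sub>M lborel) (case_prod ?F)"
  proof (rule lborel_pair.Fubini_integrable)
    show "case_prod ?F \<in> borel_measurable (lborel \<Otimes>\<^sub>M lborel)" by measurable
    show "integrable lborel (\<lambda>x. LINT y|lborel. norm (case_prod ?F (x, y)))"
      using f by (simp add: norm_mult)
    show "AE x in lborel. integrable lborel (\<lambda>y. case_prod ?F (x, y))"
    proof (rule AE_I2)
      fix x
      have "integrable lborel (\<lambda>y. f x * h y)" using h by simp
      then show "integrable lborel (\<lambda>y. case_prod ?F (x, y))"
        by (rule Bochner_Integration.integrable_bound) (auto simp: norm_mult)
    qed
  qed
  from lborel_pair.Fubini_integral[OF this]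
  have "(LINT \<xi>|lborel. LINT x|lborel. ?F x \<xi>) = (LINT x|lborel. LINT \<xi>|lborel. ?F x \<xi>)" .
  moreover have "(LINT x|lborel. ?F x \<xi>) = char_transform f \<xi> * h \<xi>" for \<xi>
    unfolding char_transform_def by (rule integral_mult_left_zero)
  moreover have "(LINT \<xi>|lborel. ?F x \<xi>) = f x * char_transform h x" for x
  proof -
    have "(LINT \<xi>|lborel. ?F x \<xi>) = (LINT \<xi>|lborel. f x * (exp (- \<i> * complex_of_real (\<xi> \<bullet> x)) * h \<xi>))"
      by (intro Bochner_Integration.integral_cong refl) (simp add: inner_commute)
    then show ?thesis unfolding char_transform_def by simp
  qed
  ultimately show ?thesis by (simp only:)
qed


section \<open>Plancherel's theorem for integrable functions\<close>

definition autocorrelation :: "('a::euclidean_space \<Rightarrow> real) \<Rightarrow> 'a \<Rightarrow> real"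
  where "autocorrelation u h = (LINT x|lborel. u x * u (x + h))"

lemma autocorrelation_eq:
  assumes u: "square_integrable u"
  shows "2 * autocorrelation u h = 2 * mean_square u - mean_square (\<lambda>x. u (x + h) - u x)"
proof -
  have ut: "square_integrable (\<lambda>x. u (x + h))" by (rule square_integrable_translate[OF u])
  have "mean_square (\<lambda>x. u (x + h) - u x)
    = (LINT x|lborel. (norm (u (x + h)))\<^sup>2 + (norm (u x))\<^sup>2 - 2 * (u x * u (x + h)))"
    unfolding mean_square_def by (intro Bochner_Integration.integral_cong refl) (simp add: power2_diff)
  also have "\<dots> = mean_square (\<lambda>x. u (x + h)) + mean_square u - 2 * autocorrelation u h"
    using square_integrable_integrable[OF u] square_integrable_integrable[OF ut] square_integrable_times[OF u ut]
    by (simp add: mean_square_def autocorrelation_def)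
  finally show ?thesis using mean_square_translate[of u h] u by (simp add: square_integrable_borel)
qed

lemma autocorrelation_tendsto:
  assumes u: "square_integrable u" and h: "h \<longlonglongrightarrow> 0"
  shows "(\<lambda>k. autocorrelation u (h k)) \<longlonglongrightarrow> mean_square u"
proof -
  have "(\<lambda>k. mean_square u - mean_square (\<lambda>x. u (x + h k) - u x) / 2) \<longlonglongrightarrow> mean_square u - 0 / 2"
    by (intro tendsto_intros translation_continuous_mean_square u h) simp
  moreover have "autocorrelation u (h k) = mean_square u - mean_square (\<lambda>x. u (x + h k) - u x) / 2" for k
    using autocorrelation_eq[OF u, of "h k"] by simp
  ultimately show ?thesis by simp
qed

lemma autocorrelation_abs_le:
  assumes u: "square_integrable u"
  shows "(LINT x|lborel. \<bar>u x * u (x + h)\<bar>) \<le> mean_square u"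
    and "\<bar>autocorrelation u h\<bar> \<le> mean_square u"
proof -
  have ut: "square_integrable (\<lambda>x. u (x + h))" by (rule square_integrable_translate[OF u])
  have "(LINT x|lborel. \<bar>u x * u (x + h)\<bar>) \<le> (LINT x|lborel. ((norm (u x))\<^sup>2 + (norm (u (x + h)))\<^sup>2) / 2)"
  proof (rule integral_mono)
    show "integrable lborel (\<lambda>x. \<bar>u x * u (x + h)\<bar>)"
      using square_integrable_times[OF u ut] by (rule integrable_abs)
    show "integrable lborel (\<lambda>x. ((norm (u x))\<^sup>2 + (norm (u (x + h)))\<^sup>2) / 2)"
      using square_integrable_integrable[OF u] square_integrable_integrable[OF ut] by simp
    show "\<bar>u x * u (x + h)\<bar> \<le> ((norm (u x))\<^sup>2 + (norm (u (x + h)))\<^sup>2) / 2" for x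
      using sum_squares_bound[of "\<bar>u x\<bar>" "\<bar>u (x + h)\<bar>"] by (simp add: abs_mult)
  qed
  also have "\<dots> = (mean_square u + mean_square (\<lambda>x. u (x + h))) / 2"
    using square_integrable_integrable[OF u] square_integrable_integrable[OF ut] by (simp add: mean_square_def)
  finally show le: "(LINT x|lborel. \<bar>u x * u (x + h)\<bar>) \<le> mean_square u"
    using mean_square_translate[of u h] u by (simp add: square_integrable_borel)
  show "\<bar>autocorrelation u h\<bar> \<le> mean_square u"
    unfolding autocorrelation_def by (rule order_trans[OF integral_abs_bound le])
qed

text \<open>
  The Gaussian factor makes all integrals absolutely convergent. Expanding the square of the modulus and
  integrating over \<open>\<xi>\<close> first leaves the transform of the scaled Gaussian, which is a Gaussian
  kernel of width \<open>c\<close> in the difference of the two space variables.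
\<close>

lemma Plancherel_regularised:
  fixes u :: "'a::euclidean_space \<Rightarrow> real"
  assumes u1: "integrable lborel u" and u2: "square_integrable u" and c: "c > 0"
  defines "F \<equiv> char_transform (\<lambda>x. complex_of_real (u x))"
  shows "integrable lborel (\<lambda>\<xi>. (cmod (F \<xi>))\<^sup>2 * gauss (c *\<^sub>R \<xi>))"
    and "(LINT \<xi>|lborel. (cmod (F \<xi>))\<^sup>2 * gauss (c *\<^sub>R \<xi>))
      = (LINT w|lborel. sqrt (2 * pi) ^ DIM('a) * gauss w * autocorrelation u (c *\<^sub>R w))"
proof -
  have um[measurable]: "u \<in> borel_measurable borel" using u2 by (rule square_integrable_borel)
  let ?u = "\<lambda>x. complex_of_real (u x)"
  let ?n = "DIM('a)"
  have fu: "integrable lborel ?u" using u1 by simp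
  have Fm[measurable]: "F \<in> borel_measurable borel" unfolding F_def by measurable
  define B where "B = (LINT x|lborel. cmod (?u x))"
  have FB: "cmod (F \<xi>) \<le> B" for \<xi> unfolding F_def B_def by (rule norm_char_transform_le[OF fu])
  define G where "G \<xi> = complex_of_real (gauss (c *\<^sub>R \<xi>))" for \<xi> :: 'a
  have gi: "integrable lborel (\<lambda>\<xi>::'a. gauss (c *\<^sub>R \<xi>))"
    using integrable_scale_iff[of gauss c] integrable_gauss c by auto
  have Gi: "integrable lborel G" unfolding G_def using gi by simp
  have [measurable]: "G \<in> borel_measurable borel" unfolding G_def by measurable
  define k where "k z = sqrt (2 * pi) ^ ?n * gauss (z /\<^sub>R c) / c ^ ?n" for z :: 'a
  have [measurable]: "k \<in> borel_measurable borel" unfolding k_def by measurable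
  have Gk: "char_transform G z = complex_of_real (k z)" for z
  proof -
    have "c ^ ?n *\<^sub>R char_transform G z = complex_of_real (sqrt (2 * pi) ^ ?n * gauss (z /\<^sub>R c))"
      using gauss_transform_scaled[OF c, of "z /\<^sub>R c"] c by (simp add: G_def[abs_def])
    also have "\<dots> = c ^ ?n *\<^sub>R complex_of_real (k z)"
      using c by (simp add: k_def scaleR_conv_of_real)
    finally show ?thesis using c by (simp only: scaleR_cancel_left) simp
  qed
  show int: "integrable lborel (\<lambda>\<xi>. (cmod (F \<xi>))\<^sup>2 * gauss (c *\<^sub>R \<xi>))"
  proof (rule Bochner_Integration.integrable_bound)
    show "integrable lborel (\<lambda>\<xi>::'a. B\<^sup>2 * gauss (c *\<^sub>R \<xi>) :: real)" using gi by simp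
    show "AE \<xi> in lborel. norm ((cmod (F \<xi>))\<^sup>2 * gauss (c *\<^sub>R \<xi>)) \<le> norm (B\<^sup>2 * gauss (c *\<^sub>R \<xi>))"
      using FB by (intro AE_I2) (auto intro!: mult_right_mono power_mono)
  qed measurable
  have h: "integrable lborel (\<lambda>\<xi>. cnj (F \<xi>) * G \<xi>)"
  proof (rule Bochner_Integration.integrable_bound)
    show "integrable lborel (\<lambda>\<xi>. B *\<^sub>R G \<xi>)" using Gi by simp
    have "(\<lambda>\<xi>. cnj (F \<xi>)) \<in> borel_measurable borel"
      by (rule borel_measurable_continuous_on[of cnj]) (auto intro!: continuous_intros)
    then show "(\<lambda>\<xi>. cnj (F \<xi>) * G \<xi>) \<in> borel_measurable lborel" by measurable
    show "AE \<xi> in lborel. norm (cnj (F \<xi>) * G \<xi>) \<le> norm (B *\<^sub>R G \<xi>)"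
    proof (rule AE_I2)
      fix \<xi> 
      have "cmod (F \<xi>) * norm (G \<xi>) \<le> \<bar>B\<bar> * norm (G \<xi>)"
        using FB[of \<xi>] by (intro mult_right_mono) auto
      then show "norm (cnj (F \<xi>) * G \<xi>) \<le> norm (B *\<^sub>R G \<xi>)" by (simp add: norm_mult)
    qed
  qed
  have inner: "char_transform (\<lambda>\<xi>. cnj (F \<xi>) * G \<xi>) x = complex_of_real (LINT y|lborel. u y * k (y - x))" for x
  proof -
    let ?E = "\<lambda>\<xi>. cnj (exp (- \<i> * complex_of_real (\<xi> \<bullet> x)))"
    have m: "?E \<in> borel_measurable borel"
      by (rule borel_measurable_continuous_on[of cnj]) (auto intro!: continuous_intros)
    have E: "integrable lborel (\<lambda>\<xi>. ?E \<xi> * G \<xi>)"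
      using m by (intro Bochner_Integration.integrable_bound[OF Gi]) (auto simp: norm_mult)
    have *: "char_transform (\<lambda>\<xi>. ?E \<xi> * G \<xi>) y = complex_of_real (k (y - x))" for y
    proof -
      have "char_transform (\<lambda>\<xi>. ?E \<xi> * G \<xi>) y = char_transform G (y - x)"
        unfolding char_transform_def
        by (intro Bochner_Integration.integral_cong refl)
          (simp add: exp_cnj inner_diff_right algebra_simps exp_add[symmetric] exp_diff[symmetric] mult.assoc[symmetric])
      then show ?thesis by (simp add: Gk)
    qed
    \<comment> \<open>After conjugation the transform \<open>F\<close> appears itself, so the exchange formula applies a second time.\<close>
    have "cnj (char_transform (\<lambda>\<xi>. cnj (F \<xi>) * G \<xi>) x) = (LINT \<xi>|lborel. F \<xi> * (?E \<xi> * G \<xi>))"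
      unfolding char_transform_def Bochner_Integration.integral_cnj[symmetric]
      by (intro Bochner_Integration.integral_cong refl) (simp add: G_def ac_simps)
    also have "\<dots> = (LINT y|lborel. ?u y * complex_of_real (k (y - x)))"
      unfolding F_def by (subst char_transform_exchange[OF fu E]) (simp only: *)
    also have "\<dots> = complex_of_real (LINT y|lborel. u y * k (y - x))"
      by (simp flip: of_real_mult)
    finally have "cnj (cnj (char_transform (\<lambda>\<xi>. cnj (F \<xi>) * G \<xi>) x)) = cnj (complex_of_real (LINT y|lborel. u y * k (y - x)))"
      by (simp only:)
    then show ?thesis by simp
  qed
  have shift: "(LINT y|lborel. u y * k (y - x)) = (LINT w|lborel. u (x + c *\<^sub>R w) * (sqrt (2 * pi) ^ ?n * gauss w))" for x
  proof -
    have "(LINT y|lborel. u y * k (y - x)) = (LINT z|lborel. u (z + x) * k (z + x - x))"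
      by (rule integral_translate[symmetric]) measurable
    also have "\<dots> = c ^ ?n *\<^sub>R (LINT w|lborel. u (c *\<^sub>R w + x) * k (c *\<^sub>R w))"
      by (subst integral_scale[OF _ c]) auto
    also have "\<dots> = (LINT w|lborel. u (x + c *\<^sub>R w) * (sqrt (2 * pi) ^ ?n * gauss w))"
      unfolding integral_scaleR_right[symmetric]
      using c by (intro Bochner_Integration.integral_cong refl) (simp add: k_def add.commute)
    finally show ?thesis .
  qed
  let ?H = "\<lambda>w x. (sqrt (2 * pi) ^ ?n * gauss w) * (u x * u (x + c *\<^sub>R w))"
  have Hi: "integrable (lborel \<Otimes>\<^sub>M lborel) (case_prod ?H)"
  proof (rule lborel_pair.Fubini_integrable)
    show "case_prod ?H \<in> borel_measurable (lborel \<Otimes>\<^sub>M lborel)" by measurable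
    show "integrable lborel (\<lambda>w. LINT x|lborel. norm (case_prod ?H (w, x)))"
    proof (rule Bochner_Integration.integrable_bound)
      show "integrable lborel (\<lambda>w::'a. (sqrt (2 * pi) ^ ?n * mean_square u) * gauss w)"
        by (intro integrable_mult_right integrable_gauss)
      show "AE w in lborel. norm (LINT x|lborel. norm (case_prod ?H (w, x)))
         \<le> norm ((sqrt (2 * pi) ^ ?n * mean_square u) * gauss w)"
      proof (rule AE_I2)
        fix w :: 'a
        have "norm (LINT x|lborel. norm (case_prod ?H (w, x)))
           = sqrt (2 * pi) ^ ?n * gauss w * (LINT x|lborel. \<bar>u x * u (x + c *\<^sub>R w)\<bar>)"
          by (simp add: abs_mult)
        also have "\<dots> \<le> sqrt (2 * pi) ^ ?n * gauss w * mean_square u"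
          by (intro mult_left_mono autocorrelation_abs_le u2) auto
        finally show "norm (LINT x|lborel. norm (case_prod ?H (w, x)))
         \<le> norm ((sqrt (2 * pi) ^ ?n * mean_square u) * gauss w)"
          by (simp add: ac_simps abs_mult)
      qed
    qed measurable
    show "AE w in lborel. integrable lborel (\<lambda>x. case_prod ?H (w, x))"
      using square_integrable_times[OF u2 square_integrable_translate[OF u2]] by (intro AE_I2) auto
  qed
  have "complex_of_real (LINT \<xi>|lborel. (cmod (F \<xi>))\<^sup>2 * gauss (c *\<^sub>R \<xi>))
    = (LINT \<xi>|lborel. F \<xi> * (cnj (F \<xi>) * G \<xi>))"
    unfolding integral_complex_of_real[symmetric] G_def
    by (intro Bochner_Integration.integral_cong refl) (simp only: of_real_mult complex_norm_square mult.assoc)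
  also have "\<dots> = (LINT x|lborel. ?u x * complex_of_real (LINT y|lborel. u y * k (y - x)))"
    unfolding F_def by (subst char_transform_exchange[OF fu h[unfolded F_def]]) (simp only: inner[unfolded F_def])
  also have "\<dots> = complex_of_real (LINT x|lborel. LINT w|lborel. ?H w x)"
    unfolding integral_complex_of_real[symmetric] shift of_real_mult[symmetric]
    by (intro Bochner_Integration.integral_cong refl arg_cong[of _ _ complex_of_real])
      (simp add: ac_simps flip: integral_mult_right_zero)
  also have "(LINT x|lborel. LINT w|lborel. ?H w x) = (LINT w|lborel. LINT x|lborel. ?H w x)"
    using lborel_pair.Fubini_integral[OF Hi] .
  also have "\<dots> = (LINT w|lborel. sqrt (2 * pi) ^ ?n * gauss w * autocorrelation u (c *\<^sub>R w))"
    unfolding autocorrelation_def integral_mult_right_zero ..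
  finally show "(LINT \<xi>|lborel. (cmod (F \<xi>))\<^sup>2 * gauss (c *\<^sub>R \<xi>))
      = (LINT w|lborel. sqrt (2 * pi) ^ ?n * gauss w * autocorrelation u (c *\<^sub>R w))"
    by (simp only: of_real_eq_iff)
qed

text \<open>
  As \<open>c\<close> tends to 0, the left side of the regularised identity increases to the full integral, and
  the right side converges because the autocorrelation is bounded and continuous at 0.
\<close>

lemma Plancherel_char_transform:
  fixes u :: "'a::euclidean_space \<Rightarrow> real"
  assumes u1: "integrable lborel u" and u2: "square_integrable u"
  defines "F \<equiv> char_transform (\<lambda>x. complex_of_real (u x))"
  shows "square_integrable F" and "mean_square F = (2 * pi) ^ DIM('a) * mean_square u"
proof -
  let ?n = "DIM('a)"
  have um[measurable]: "u \<in> borel_measurable borel" using u2 by (rule square_integrable_borel)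
  have Fm[measurable]: "F \<in> borel_measurable borel" unfolding F_def by measurable
  define e where "e k = 1 / real (Suc k)" for k
  have e: "e k > 0" for k by (simp add: e_def)
  have e0: "e \<longlonglongrightarrow> 0" unfolding e_def using LIMSEQ_inverse_real_of_nat by (simp add: inverse_eq_divide)
  note reg = Plancherel_regularised[OF u1 u2 e, folded F_def]
  have [measurable]: "autocorrelation u \<in> borel_measurable borel"
    unfolding autocorrelation_def by measurable
  have "(\<lambda>k. LINT w|lborel. sqrt (2 * pi) ^ ?n * gauss w * autocorrelation u (e k *\<^sub>R w))
    \<longlonglongrightarrow> (LINT w|lborel. sqrt (2 * pi) ^ ?n * gauss (w::'a) * mean_square u)"
  proof (rule integral_dominated_convergence[where w="\<lambda>w. (sqrt (2 * pi) ^ ?n * mean_square u) * gauss w"])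
    show "integrable lborel (\<lambda>w::'a. (sqrt (2 * pi) ^ ?n * mean_square u) * gauss w)"
      by (intro integrable_mult_right integrable_gauss)
    show "AE w in lborel. (\<lambda>k. sqrt (2 * pi) ^ ?n * gauss w * autocorrelation u (e k *\<^sub>R w))
       \<longlonglongrightarrow> sqrt (2 * pi) ^ ?n * gauss (w::'a) * mean_square u"
    proof (rule AE_I2, intro tendsto_intros autocorrelation_tendsto u2)
      fix w :: 'a
      have "(\<lambda>k. e k *\<^sub>R w) \<longlonglongrightarrow> 0 *\<^sub>R w" by (intro tendsto_intros e0)
      then show "(\<lambda>k. e k *\<^sub>R w) \<longlonglongrightarrow> 0" by simp
    qed
    show "AE w in lborel. norm (sqrt (2 * pi) ^ ?n * gauss w * autocorrelation u (e k *\<^sub>R w))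
       \<le> (sqrt (2 * pi) ^ ?n * mean_square u) * gauss w" for k
    proof (rule AE_I2)
      fix w :: 'a
      have "sqrt (2 * pi) ^ ?n * gauss w * \<bar>autocorrelation u (e k *\<^sub>R w)\<bar> \<le> sqrt (2 * pi) ^ ?n * gauss w * mean_square u"
        by (intro mult_left_mono autocorrelation_abs_le u2) auto
      then show "norm (sqrt (2 * pi) ^ ?n * gauss w * autocorrelation u (e k *\<^sub>R w))
         \<le> (sqrt (2 * pi) ^ ?n * mean_square u) * gauss w"
        by (simp add: abs_mult ac_simps)
    qed
  qed measurable
  also have "(LINT w|lborel. sqrt (2 * pi) ^ ?n * gauss (w::'a) * mean_square u)
    = sqrt (2 * pi) ^ ?n * mean_square u * (LINT w|lborel. gauss (w::'a))"
    by simp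
  also have "\<dots> = (2 * pi) ^ ?n * mean_square u"
  proof -
    have "sqrt (2 * pi) ^ ?n * sqrt (2 * pi) ^ ?n = (sqrt (2 * pi) * sqrt (2 * pi)) ^ ?n"
      by (rule power_mult_distrib[symmetric])
    also have "\<dots> = (2 * pi) ^ ?n" by (simp only: real_sqrt_mult_self) simp
    finally show ?thesis unfolding integral_gauss by (simp only: ac_simps)
  qed
  finally have lim: "(\<lambda>k. LINT \<xi>|lborel. (cmod (F \<xi>))\<^sup>2 * gauss (e k *\<^sub>R \<xi>)) \<longlonglongrightarrow> (2 * pi) ^ ?n * mean_square u"
    by (simp only: reg(2))
  have mono: "AE \<xi> in lborel. mono (\<lambda>k. (cmod (F \<xi>))\<^sup>2 * gauss (e k *\<^sub>R \<xi>))"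
  proof (intro AE_I2 monoI mult_left_mono)
    fix \<xi> :: 'a and k l :: nat assume "k \<le> l"
    then have "e l \<le> e k" by (simp add: e_def frac_le)
    then have "norm (e l *\<^sub>R \<xi>) \<le> norm (e k *\<^sub>R \<xi>)" using e[of l] by (auto intro!: mult_right_mono)
    then show "gauss (e k *\<^sub>R \<xi>) \<le> gauss (e l *\<^sub>R \<xi>)" unfolding gauss_def by (auto intro: power_mono)
  qed auto
  have pt: "AE \<xi> in lborel. (\<lambda>k. (cmod (F \<xi>))\<^sup>2 * gauss (e k *\<^sub>R \<xi>)) \<longlonglongrightarrow> (cmod (F \<xi>))\<^sup>2"
  proof (rule AE_I2)
    fix \<xi> :: 'a
    have "(\<lambda>k. (cmod (F \<xi>))\<^sup>2 * exp (- (norm (e k *\<^sub>R \<xi>))\<^sup>2 / 2)) \<longlonglongrightarrow> (cmod (F \<xi>))\<^sup>2 * exp (- (norm (0 *\<^sub>R \<xi>))\<^sup>2 / 2)"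
      by (intro tendsto_intros e0) simp
    then show "(\<lambda>k. (cmod (F \<xi>))\<^sup>2 * gauss (e k *\<^sub>R \<xi>)) \<longlonglongrightarrow> (cmod (F \<xi>))\<^sup>2"
      by (simp add: gauss_def)
  qed
  note mc = integrable_monotone_convergence[OF reg(1) mono pt lim] integral_monotone_convergence[OF reg(1) mono pt lim]
  show "square_integrable F" using mc(1) unfolding square_integrable_def by auto
  show "mean_square F = (2 * pi) ^ ?n * mean_square u" using mc(2) unfolding mean_square_def by auto
qed

section \<open>The Fourier transform on square integrable functions\<close>

lemma integrable_truncation:
  fixes u :: "'a::euclidean_space \<Rightarrow> real"
  assumes "square_integrable u"
  shows "integrable lborel (\<lambda>x. indicator (ball 0 R) x * u x)"
proof (rule square_integrable_times[OF _ assms])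
  show "square_integrable (indicator (ball 0 R) :: 'a \<Rightarrow> real)"
  proof (rule square_integrable_bound[where g="indicator (ball 0 R)"])
    show "integrable lborel (indicator (ball 0 R) :: 'a \<Rightarrow> real)"
      by (intro integrable_real_indicator emeasure_lborel_ball_finite) simp
    show "(indicator (ball 0 R) :: 'a \<Rightarrow> real) \<in> borel_measurable borel"
      by (intro borel_measurable_indicator) simp
  qed (simp add: indicator_def)
qed

lemma truncation_tendsto:
  fixes u :: "'a::euclidean_space \<Rightarrow> 'b::{real_normed_field, banach, second_countable_topology}"
  assumes u: "square_integrable u"
  shows "((\<lambda>R. mean_square (\<lambda>x. indicator (ball 0 R) x * u x - u x)) \<longlongrightarrow> 0) at_top"
proof (rule tendsto_at_topI_sequentially)
  have [measurable]: "u \<in> borel_measurable borel" using u by (rule square_integrable_borel)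
  fix X :: "nat \<Rightarrow> real" assume X: "filterlim X at_top sequentially"
  have "(\<lambda>n. LINT x|lborel. (norm (indicator (ball 0 (X n)) x * u x - u x))\<^sup>2) \<longlonglongrightarrow> (LINT x::'a|lborel. (0::real))"
  proof (rule integral_dominated_convergence[where w="\<lambda>x. (norm (u x))\<^sup>2"])
    show "integrable lborel (\<lambda>x. (norm (u x))\<^sup>2)" by (rule square_integrable_integrable[OF u])
    show "AE x in lborel. (\<lambda>n. (norm (indicator (ball 0 (X n)) x * u x - u x))\<^sup>2) \<longlonglongrightarrow> 0"
    proof (rule AE_I2)
      fix x :: 'a
      have "eventually (\<lambda>n. norm x < X n) sequentially"
        using X by (simp add: filterlim_at_top_dense)
      then have "eventually (\<lambda>n. (norm (indicator (ball 0 (X n)) x * u x - u x))\<^sup>2 = 0) sequentially"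
        by eventually_elim simp
      then show "(\<lambda>n. (norm (indicator (ball 0 (X n)) x * u x - u x))\<^sup>2) \<longlonglongrightarrow> 0"
        by (rule tendsto_eventually)
    qed
  qed (auto simp: indicator_def)
  then show "(\<lambda>n. mean_square (\<lambda>x. indicator (ball 0 (X n)) x * u x - u x)) \<longlonglongrightarrow> 0"
    by (simp add: mean_square_def)
qed

lemma fourier_integral_eq:
  "fourier_integral (u :: 'a::euclidean_space \<Rightarrow> real) \<xi>
    = complex_of_real ((2 * pi) powr (- real DIM('a) / 2)) * char_transform (\<lambda>x. complex_of_real (u x)) \<xi>"
  by (simp add: fourier_integral_def char_transform_def)

lemma Plancherel_fourier_integral:
  fixes u :: "'a::euclidean_space \<Rightarrow> real"
  assumes u: "integrable lborel u" "square_integrable u"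
  shows "square_integrable (fourier_integral u)" and "mean_square (fourier_integral u) = mean_square u"
proof -
  let ?c = "complex_of_real ((2 * pi) powr (- real DIM('a) / 2))"
  note P = Plancherel_char_transform[OF u]
  have eq: "fourier_integral u = (\<lambda>\<xi>. ?c * char_transform (\<lambda>x. complex_of_real (u x)) \<xi>)"
    by (simp add: fun_eq_iff fourier_integral_eq)
  show "square_integrable (fourier_integral u)"
    unfolding eq by (intro square_integrable_cmult P)
  have "(norm ?c)\<^sup>2 = (2 * pi) powr (- real DIM('a))"
    by (simp add: power2_eq_square flip: powr_add)
  also have "\<dots> * (2 * pi) ^ DIM('a) = 1"
  proof -
    have "(2 * pi) ^ DIM('a) = (2 * pi) powr real DIM('a)"
      by (rule powr_realpow[symmetric]) simp
    then show ?thesis by (simp only: powr_add[symmetric]) simp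
  qed
  finally show "mean_square (fourier_integral u) = mean_square u"
    unfolding eq mean_square_cmult P(2)
    by (metis (no_types, lifting) mult.assoc mult.left_neutral)
qed

lemma fourier_integral_add:
  assumes "integrable lborel u" "integrable lborel v"
  shows "fourier_integral (\<lambda>x. u x + v x) \<xi> = fourier_integral u \<xi> + fourier_integral v \<xi>"
proof -
  have "char_transform (\<lambda>x. complex_of_real (u x + v x)) \<xi>
    = char_transform (\<lambda>x. complex_of_real (u x)) \<xi> + char_transform (\<lambda>x. complex_of_real (v x)) \<xi>"
    using integrable_character_mult[of "\<lambda>x. complex_of_real (u x)" \<xi>]
      integrable_character_mult[of "\<lambda>x. complex_of_real (v x)" \<xi>] assms
    by (simp add: char_transform_def distrib_left)
  then show ?thesis by (simp add: fourier_integral_eq distrib_left)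
qed

lemma fourier_integral_cmult:
  "fourier_integral (\<lambda>x. a * u x) \<xi> = complex_of_real a * fourier_integral u \<xi>"
proof -
  have "char_transform (\<lambda>x. complex_of_real (a * u x)) \<xi> 
    = (LINT x|lborel. complex_of_real a * (exp (- \<i> * complex_of_real (x \<bullet> \<xi>)) * complex_of_real (u x)))"
    unfolding char_transform_def by (intro Bochner_Integration.integral_cong refl) simp
  also have "\<dots> = complex_of_real a * char_transform (\<lambda>x. complex_of_real (u x)) \<xi>"
    unfolding char_transform_def by (rule integral_mult_right_zero)
  finally show ?thesis by (simp add: fourier_integral_eq)
qed

lemma fourier_integral_diff:
  assumes "integrable lborel u" "integrable lborel v"
  shows "fourier_integral (\<lambda>x. u x - v x) \<xi> = fourier_integral u \<xi> - fourier_integral v \<xi>"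
  using fourier_integral_add[of u "\<lambda>x. (-1) * v x" \<xi>] fourier_integral_cmult[of "-1" v \<xi>] assms by simp

lemma fourier_integral_translate:
  fixes u :: "'a::euclidean_space \<Rightarrow> real"
  assumes [measurable]: "u \<in> borel_measurable borel"
  shows "fourier_integral (\<lambda>x. u (x + y)) \<xi> = exp (\<i> * complex_of_real (y \<bullet> \<xi>)) * fourier_integral u \<xi>"
proof -
  have "char_transform (\<lambda>x. complex_of_real (u (x + y))) \<xi>
    = (LINT x|lborel. exp (- \<i> * complex_of_real (((x + y) - y) \<bullet> \<xi>)) * complex_of_real (u (x + y)))"
    by (simp add: char_transform_def)
  also have "\<dots> = (LINT x|lborel. exp (- \<i> * complex_of_real ((x - y) \<bullet> \<xi>)) * complex_of_real (u x))"
    by (rule integral_translate[of "\<lambda>x. exp (- \<i> * complex_of_real ((x - y) \<bullet> \<xi>)) * complex_of_real (u x)"]) measurable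
  also have "\<dots> = (LINT x|lborel. exp (\<i> * complex_of_real (y \<bullet> \<xi>)) * (exp (- \<i> * complex_of_real (x \<bullet> \<xi>)) * complex_of_real (u x)))"
  proof (intro Bochner_Integration.integral_cong refl)
    fix x :: 'a
    have "exp (- \<i> * complex_of_real ((x - y) \<bullet> \<xi>)) = exp (\<i> * complex_of_real (y \<bullet> \<xi>)) * exp (- \<i> * complex_of_real (x \<bullet> \<xi>))"
      unfolding exp_add[symmetric] by (rule arg_cong[of _ _ exp]) (simp add: inner_diff_left algebra_simps)
    then show "exp (- \<i> * complex_of_real ((x - y) \<bullet> \<xi>)) * complex_of_real (u x)
      = exp (\<i> * complex_of_real (y \<bullet> \<xi>)) * (exp (- \<i> * complex_of_real (x \<bullet> \<xi>)) * complex_of_real (u x))"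
      by (simp only: mult.assoc)
  qed
  also have "\<dots> = exp (\<i> * complex_of_real (y \<bullet> \<xi>)) * char_transform (\<lambda>x. complex_of_real (u x)) \<xi>"
    unfolding char_transform_def by (rule integral_mult_right_zero)
  finally show ?thesis by (simp add: fourier_integral_eq)
qed

lemma mean_square_fourier_integral_diff:
  assumes u: "integrable lborel u" "square_integrable u" and v: "integrable lborel v" "square_integrable v"
  shows "mean_square (\<lambda>\<xi>. fourier_integral u \<xi> - fourier_integral v \<xi>) = mean_square (\<lambda>x. u x - v x)"
proof -
  have "fourier_integral (\<lambda>x. u x - v x) = (\<lambda>\<xi>. fourier_integral u \<xi> - fourier_integral v \<xi>)"
    using fourier_integral_diff[OF u(1) v(1)] by (rule ext)
  moreover have "mean_square (fourier_integral (\<lambda>x. u x - v x)) = mean_square (\<lambda>x. u x - v x)"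
    by (intro Plancherel_fourier_integral Bochner_Integration.integrable_diff square_integrable_diff u v)
  ultimately show ?thesis by (simp only:)
qed

lemma is_fourier_transform_iff:
  assumes u: "square_integrable u"
  shows "is_fourier_transform u g \<longleftrightarrow> square_integrable g \<and>
    ((\<lambda>R. mean_square (\<lambda>\<xi>. fourier_integral (\<lambda>x. indicator (ball 0 R) x * u x) \<xi> - g \<xi>)) \<longlongrightarrow> 0) at_top"
proof (cases "square_integrable g")
  case True
  have *: "(\<integral>\<^sup>+ \<xi>. ennreal ((cmod (fourier_integral (\<lambda>x. indicator (ball 0 R) x * u x) \<xi> - g \<xi>))\<^sup>2) \<partial>lborel)
    = ennreal (mean_square (\<lambda>\<xi>. fourier_integral (\<lambda>x. indicator (ball 0 R) x * u x) \<xi> - g \<xi>))" for R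
    by (intro nn_integral_mean_square square_integrable_diff True Plancherel_fourier_integral
      integrable_truncation square_integrable_indicator_ball u)
  have **: "((\<lambda>R. ennreal (f R)) \<longlongrightarrow> 0) at_top \<longleftrightarrow> (f \<longlongrightarrow> 0) at_top" if "\<And>R. 0 \<le> f R" for f :: "real \<Rightarrow> real"
    using tendsto_ennreal_iff[of f at_top 0] that by simp
  show ?thesis
    unfolding is_fourier_transform_def * using True by (subst **) auto
qed (simp add: is_fourier_transform_def)

lemma mean_square_fourier_truncations:
  assumes u: "square_integrable u"
  shows "mean_square (\<lambda>\<xi>. fourier_integral (\<lambda>x. indicator (ball 0 R) x * u x) \<xi> - fourier_integral (\<lambda>x. indicator (ball 0 S) x * u x) \<xi>)
    \<le> 2 * mean_square (\<lambda>x. indicator (ball 0 R) x * u x - u x) + 2 * mean_square (\<lambda>x. indicator (ball 0 S) x * u x - u x)"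
proof -
  let ?t = "\<lambda>R x. indicator (ball 0 R) x * u x"
  have t: "integrable lborel (?t R)" "square_integrable (?t R)" for R
    using u by (auto intro: integrable_truncation square_integrable_indicator_ball)
  have "mean_square (\<lambda>\<xi>. fourier_integral (?t R) \<xi> - fourier_integral (?t S) \<xi>) = mean_square (\<lambda>x. ?t R x - ?t S x)"
    by (intro mean_square_fourier_integral_diff t)
  also have "\<dots> \<le> 2 * mean_square (\<lambda>x. ?t R x - u x) + 2 * mean_square (\<lambda>x. u x - ?t S x)"
    by (intro mean_square_diff_triangle t u)
  finally show ?thesis by (simp only: mean_square_minus_commute[of u])
qed

text \<open>
  The transforms of the truncations form a Cauchy sequence along the natural numbers, by Plancherel's
  theorem; the limit along all real radii follows by comparison with the truncations of integer radius.
\<close>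

lemma is_fourier_transform_exists:
  assumes u: "square_integrable u"
  shows "\<exists>g. is_fourier_transform u g"
proof -
  let ?t = "\<lambda>R x. indicator (ball 0 R) x * u x"
  let ?m = "\<lambda>R. mean_square (\<lambda>x. ?t R x - u x)"
  note lim = truncation_tendsto[OF u]
  have limk: "(\<lambda>k. ?m (real k)) \<longlonglongrightarrow> 0"
    using filterlim_compose[OF lim filterlim_real_sequentially] by simp
  have t: "integrable lborel (?t R)" "square_integrable (?t R)" for R
    using u by (auto intro: integrable_truncation square_integrable_indicator_ball)
  have ft: "square_integrable (fourier_integral (?t R))" for R
    by (intro Plancherel_fourier_integral t)
  have c: "\<exists>N. \<forall>k\<ge>N. \<forall>l\<ge>N. mean_square (\<lambda>\<xi>. fourier_integral (?t (real k)) \<xi> - fourier_integral (?t (real l)) \<xi>) < e"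
    if e: "e > 0" for e
  proof -
    from LIMSEQ_D[OF limk, of "e/4"] e obtain N where N: "\<And>k. k \<ge> N \<Longrightarrow> ?m (real k) < e/4" by auto
    show ?thesis
    proof (intro exI[of _ N] allI impI)
      fix k l assume "N \<le> k" "N \<le> l"
      then show "mean_square (\<lambda>\<xi>. fourier_integral (?t (real k)) \<xi> - fourier_integral (?t (real l)) \<xi>) < e"
        using mean_square_fourier_truncations[OF u, of "real k" "real l"] N[of k] N[of l] by linarith
    qed
  qed
  obtain g r where g: "square_integrable g"
    "(\<lambda>k. mean_square (\<lambda>\<xi>. fourier_integral (?t (real k)) \<xi> - g \<xi>)) \<longlonglongrightarrow> 0"
    using mean_square_complete[of "\<lambda>k. fourier_integral (?t (real k))", OF ft c] by blast
  have "mean_square (\<lambda>\<xi>. fourier_integral (?t R) \<xi> - g \<xi>) \<le> 4 * ?m R" for R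
  proof (rule LIMSEQ_le_const)
    have "(\<lambda>k. 2 * (2 * ?m R + 2 * ?m (real k)) + 2 * mean_square (\<lambda>\<xi>. fourier_integral (?t (real k)) \<xi> - g \<xi>))
       \<longlonglongrightarrow> 2 * (2 * ?m R + 2 * 0) + 2 * 0"
      by (intro tendsto_intros g limk)
    then show "(\<lambda>k. 2 * (2 * ?m R + 2 * ?m (real k)) + 2 * mean_square (\<lambda>\<xi>. fourier_integral (?t (real k)) \<xi> - g \<xi>))
       \<longlonglongrightarrow> 4 * ?m R" by simp
    show "\<exists>N. \<forall>k\<ge>N. mean_square (\<lambda>\<xi>. fourier_integral (?t R) \<xi> - g \<xi>)
       \<le> 2 * (2 * ?m R + 2 * ?m (real k)) + 2 * mean_square (\<lambda>\<xi>. fourier_integral (?t (real k)) \<xi> - g \<xi>)"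
    proof (intro exI[of _ 0] allI impI)
      fix k
      show "mean_square (\<lambda>\<xi>. fourier_integral (?t R) \<xi> - g \<xi>)
       \<le> 2 * (2 * ?m R + 2 * ?m (real k)) + 2 * mean_square (\<lambda>\<xi>. fourier_integral (?t (real k)) \<xi> - g \<xi>)"
        by (intro order_trans[OF mean_square_diff_triangle[OF ft ft[of "real k"] g(1)]]
          add_right_mono mult_left_mono mean_square_fourier_truncations[OF u]) simp
    qed
  qed
  then have "((\<lambda>R. mean_square (\<lambda>\<xi>. fourier_integral (?t R) \<xi> - g \<xi>)) \<longlongrightarrow> 0) at_top"
    by (intro Lim_null_comparison[OF always_eventually tendsto_mult_right_zero[OF lim, of 4]])
      (simp only: real_norm_def abs_of_nonneg mean_square_nonneg, blast)
  with g show ?thesis using is_fourier_transform_iff[OF u] by blast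
qed

lemma
  assumes u: "square_integrable u"
  shows square_integrable_fourier: "square_integrable (fourier u)"
    and fourier_tendsto: "((\<lambda>R. mean_square (\<lambda>\<xi>. fourier_integral (\<lambda>x. indicator (ball 0 R) x * u x) \<xi> - fourier u \<xi>)) \<longlongrightarrow> 0) at_top"
proof -
  have "is_fourier_transform u (fourier u)"
    unfolding fourier_def by (rule someI_ex[OF is_fourier_transform_exists[OF u]])
  then show "square_integrable (fourier u)"
    and "((\<lambda>R. mean_square (\<lambda>\<xi>. fourier_integral (\<lambda>x. indicator (ball 0 R) x * u x) \<xi> - fourier u \<xi>)) \<longlongrightarrow> 0) at_top"
    using is_fourier_transform_iff[OF u] by auto
qed

lemma fourier_tendsto_sequentially:
  assumes u: "square_integrable u"
  shows "(\<lambda>k. mean_square (\<lambda>\<xi>. fourier_integral (\<lambda>x. indicator (ball 0 (real k)) x * u x) \<xi> - fourier u \<xi>)) \<longlonglongrightarrow> 0"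
    "(\<lambda>k. mean_square (\<lambda>x. indicator (ball 0 (real k)) x * u x - u x)) \<longlonglongrightarrow> 0"
  using filterlim_compose[OF fourier_tendsto[OF u] filterlim_real_sequentially]
    filterlim_compose[OF truncation_tendsto[OF u] filterlim_real_sequentially] by simp_all

text \<open>Any approximation by integrable functions determines the transform.\<close>

lemma fourier_unique:
  assumes u: "square_integrable u" and g: "square_integrable g"
    and w: "\<And>k. integrable lborel (w k)" "\<And>k. square_integrable (w k)"
    and wu: "(\<lambda>k. mean_square (\<lambda>x. w k x - u x)) \<longlonglongrightarrow> 0"
    and wg: "(\<lambda>k. mean_square (\<lambda>\<xi>. fourier_integral (w k) \<xi> - g \<xi>)) \<longlonglongrightarrow> 0"
  shows "AE \<xi> in lborel. fourier u \<xi> = g \<xi>"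
proof -
  let ?t = "\<lambda>k x. indicator (ball 0 (real k)) x * u x"
  have t: "integrable lborel (?t R)" "square_integrable (?t R)" for R
    using u by (auto intro: integrable_truncation square_integrable_indicator_ball)
  have ft: "square_integrable (fourier_integral (?t R))" "square_integrable (fourier_integral (w R))" for R
    by (intro Plancherel_fourier_integral t w)+
  have F: "square_integrable (fourier u)" by (rule square_integrable_fourier[OF u])
  let ?b = "\<lambda>k. 2 * mean_square (\<lambda>\<xi>. fourier_integral (?t k) \<xi> - fourier u \<xi>)
      + 2 * (2 * (2 * mean_square (\<lambda>x. ?t k x - u x) + 2 * mean_square (\<lambda>x. w k x - u x))
        + 2 * mean_square (\<lambda>\<xi>. fourier_integral (w k) \<xi> - g \<xi>))"
  have "?b \<longlonglongrightarrow> 2 * 0 + 2 * (2 * (2 * 0 + 2 * 0) + 2 * 0)"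
    by (intro tendsto_intros fourier_tendsto_sequentially u wu wg)
  then have b: "?b \<longlonglongrightarrow> 0" by simp
  have "mean_square (\<lambda>\<xi>. fourier u \<xi> - g \<xi>) \<le> ?b k" for k
  proof -
    have wt: "mean_square (\<lambda>\<xi>. fourier_integral (?t k) \<xi> - fourier_integral (w k) \<xi>)
      \<le> 2 * mean_square (\<lambda>x. ?t k x - u x) + 2 * mean_square (\<lambda>x. w k x - u x)"
      unfolding mean_square_fourier_integral_diff[OF t w] mean_square_minus_commute[of "w k" u]
      by (rule mean_square_diff_triangle[OF t(2) u w(2)])
    have tg: "mean_square (\<lambda>\<xi>. fourier_integral (?t k) \<xi> - g \<xi>)
      \<le> 2 * (2 * mean_square (\<lambda>x. ?t k x - u x) + 2 * mean_square (\<lambda>x. w k x - u x))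
        + 2 * mean_square (\<lambda>\<xi>. fourier_integral (w k) \<xi> - g \<xi>)"
      by (intro order_trans[OF mean_square_diff_triangle[OF ft(1) ft(2)[of k] g]]
        add_right_mono mult_left_mono wt) simp
    show ?thesis
      unfolding mean_square_minus_commute[of _ "fourier u"]
      by (intro order_trans[OF mean_square_diff_triangle[OF F ft(1)[of k] g]] add_left_mono mult_left_mono tg) simp
  qed
  then have "mean_square (\<lambda>\<xi>. fourier u \<xi> - g \<xi>) \<le> 0"
    by (intro LIMSEQ_le_const[OF b]) auto
  then have "mean_square (\<lambda>\<xi>. fourier u \<xi> - g \<xi>) = 0" using mean_square_nonneg[of "\<lambda>\<xi>. fourier u \<xi> - g \<xi>"] by linarith
  from mean_square_eq_0_AE[OF square_integrable_diff[OF F g] this] show ?thesis by eventually_elim simp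
qed

lemma fourier_eq_fourier_integral:
  assumes u: "integrable lborel u" "square_integrable u"
  shows "AE \<xi> in lborel. fourier u \<xi> = fourier_integral u \<xi>"
  by (rule fourier_unique[where w="\<lambda>_. u"]) (use u Plancherel_fourier_integral in \<open>auto simp: mean_square_def\<close>)

lemma Plancherel:
  assumes u: "square_integrable u"
  shows "mean_square (fourier u) = mean_square u"
proof (rule LIMSEQ_unique)
  let ?t = "\<lambda>k x. indicator (ball 0 (real k)) x * u x"
  have t: "integrable lborel (?t R)" "square_integrable (?t R)" for R
    using u by (auto intro: integrable_truncation square_integrable_indicator_ball)
  show "(\<lambda>k. mean_square (fourier_integral (?t k))) \<longlonglongrightarrow> mean_square (fourier u)"
    by (intro mean_square_tendsto Plancherel_fourier_integral t square_integrable_fourier u fourier_tendsto_sequentially)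
  have "(\<lambda>k. mean_square (\<lambda>x. complex_of_real (?t k x))) \<longlonglongrightarrow> mean_square (\<lambda>x. complex_of_real (u x))"
    by (intro mean_square_tendsto square_integrable_of_real t u)
      (use fourier_tendsto_sequentially(2)[OF u] in \<open>simp only: mean_square_of_real flip: of_real_diff\<close>)
  then show "(\<lambda>k. mean_square (fourier_integral (?t k))) \<longlonglongrightarrow> mean_square u"
    by (simp only: mean_square_of_real Plancherel_fourier_integral(2)[OF t])
qed

lemma mean_square_tendsto_add:
  assumes f: "\<And>k. square_integrable (f k)" "square_integrable f'"
    and g: "\<And>k. square_integrable (g k)" "square_integrable g'"
    and lim: "(\<lambda>k. mean_square (\<lambda>x. f k x - f' x)) \<longlonglongrightarrow> 0" "(\<lambda>k. mean_square (\<lambda>x. g k x - g' x)) \<longlonglongrightarrow> 0"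
  shows "(\<lambda>k. mean_square (\<lambda>x. (f k x + g k x) - (f' x + g' x))) \<longlonglongrightarrow> 0"
proof -
  have "(\<lambda>k. 2 * mean_square (\<lambda>x. f k x - f' x) + 2 * mean_square (\<lambda>x. g k x - g' x)) \<longlonglongrightarrow> 2 * 0 + 2 * 0"
    by (intro tendsto_intros lim)
  then have b: "(\<lambda>k. 2 * mean_square (\<lambda>x. f k x - f' x) + 2 * mean_square (\<lambda>x. g k x - g' x)) \<longlonglongrightarrow> 0" by simp
  show ?thesis
  proof (rule Lim_null_comparison[OF always_eventually b], intro allI)
    fix k
    have "(\<lambda>x. (f k x + g k x) - (f' x + g' x)) = (\<lambda>x. (f k x - f' x) + (g k x - g' x))" by (simp add: fun_eq_iff)
    then show "norm (mean_square (\<lambda>x. (f k x + g k x) - (f' x + g' x)))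
      \<le> 2 * mean_square (\<lambda>x. f k x - f' x) + 2 * mean_square (\<lambda>x. g k x - g' x)"
      using mean_square_add_le[OF square_integrable_diff[OF f(1)[of k] f(2)] square_integrable_diff[OF g(1)[of k] g(2)]]
      by simp
  qed
qed

lemma fourier_add:
  assumes u: "square_integrable u" and v: "square_integrable v"
  shows "AE \<xi> in lborel. fourier (\<lambda>x. u x + v x) \<xi> = fourier u \<xi> + fourier v \<xi>"
proof -
  let ?t = "\<lambda>u k x. indicator (ball 0 (real k)) x * u x"
  have t: "integrable lborel (?t u R)" "square_integrable (?t u R)" "integrable lborel (?t v R)" "square_integrable (?t v R)" for R
    using u v by (auto intro: integrable_truncation square_integrable_indicator_ball)
  note F = fourier_integral_add[OF t(1,3)]
  show ?thesis
  proof (rule fourier_unique[where w="\<lambda>k x. ?t u k x + ?t v k x"])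
    show "(\<lambda>k. mean_square (\<lambda>x. ?t u k x + ?t v k x - (u x + v x))) \<longlonglongrightarrow> 0"
      by (intro mean_square_tendsto_add t u v fourier_tendsto_sequentially)
    show "(\<lambda>k. mean_square (\<lambda>\<xi>. fourier_integral (\<lambda>x. ?t u k x + ?t v k x) \<xi> - (fourier u \<xi> + fourier v \<xi>))) \<longlonglongrightarrow> 0"
      unfolding F by (intro mean_square_tendsto_add Plancherel_fourier_integral t square_integrable_fourier u v fourier_tendsto_sequentially)
  qed (intro square_integrable_add square_integrable_fourier u v t Bochner_Integration.integrable_add)+
qed

lemma fourier_mult:
  assumes u: "square_integrable u"
  shows "AE \<xi> in lborel. fourier (\<lambda>x. a * u x) \<xi> = complex_of_real a * fourier u \<xi>"
proof -
  let ?t = "\<lambda>k x. indicator (ball 0 (real k)) x * u x"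
  have t: "integrable lborel (?t R)" "square_integrable (?t R)" for R
    using u by (auto intro: integrable_truncation square_integrable_indicator_ball)
  show ?thesis
  proof (rule fourier_unique[where w="\<lambda>k x. a * ?t k x"])
    have "(\<lambda>k. (norm a)\<^sup>2 * mean_square (\<lambda>x. ?t k x - u x)) \<longlonglongrightarrow> (norm a)\<^sup>2 * 0"
      by (intro tendsto_intros u fourier_tendsto_sequentially)
    then show "(\<lambda>k. mean_square (\<lambda>x. a * ?t k x - a * u x)) \<longlonglongrightarrow> 0"
      by (simp only: mean_square_cmult[symmetric] right_diff_distrib[symmetric] mult_zero_right)
    have "(\<lambda>k. (norm (complex_of_real a))\<^sup>2 * mean_square (\<lambda>\<xi>. fourier_integral (?t k) \<xi> - fourier u \<xi>))
      \<longlonglongrightarrow> (norm (complex_of_real a))\<^sup>2 * 0"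
      by (intro tendsto_intros u fourier_tendsto_sequentially)
    then show "(\<lambda>k. mean_square (\<lambda>\<xi>. fourier_integral (\<lambda>x. a * ?t k x) \<xi> - complex_of_real a * fourier u \<xi>)) \<longlonglongrightarrow> 0"
      by (simp only: fourier_integral_cmult mean_square_cmult[symmetric] right_diff_distrib[symmetric] mult_zero_right)
  qed (intro square_integrable_cmult square_integrable_fourier u t integrable_mult_right)+
qed

lemma fourier_translate:
  assumes u: "square_integrable u"
  shows "AE \<xi> in lborel. fourier (\<lambda>x. u (x + y)) \<xi> = exp (\<i> * complex_of_real (y \<bullet> \<xi>)) * fourier u \<xi>"
proof -
  let ?t = "\<lambda>k x. indicator (ball 0 (real k)) x * u x"
  let ?e = "\<lambda>\<xi>. exp (\<i> * complex_of_real (y \<bullet> \<xi>))"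
  have t: "integrable lborel (?t R)" "square_integrable (?t R)" for R
    using u by (auto intro: integrable_truncation square_integrable_indicator_ball)
  have tm: "?t R \<in> borel_measurable borel" for R using t(2) by (rule square_integrable_borel)
  have um: "u \<in> borel_measurable borel" using u by (rule square_integrable_borel)
  have e1: "norm (?e \<xi>) = 1" for \<xi> by simp
  show ?thesis
  proof (rule fourier_unique[where w="\<lambda>k x. ?t k (x + y)"])
    show "integrable lborel (\<lambda>x. ?t k (x + y))" for k
      using integrable_translate_iff[OF tm, of k y] t(1)[of k] by blast
    show "square_integrable (\<lambda>x. ?t k (x + y))" for k
      by (rule square_integrable_translate[OF t(2)])
    have "mean_square (\<lambda>x. ?t k (x + y) - u (x + y)) = mean_square (\<lambda>x. ?t k x - u x)" for k
      by (rule mean_square_translate[OF square_integrable_borel[OF square_integrable_diff[OF t(2) u]]])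
    then show "(\<lambda>k. mean_square (\<lambda>x. ?t k (x + y) - u (x + y))) \<longlonglongrightarrow> 0"
      using fourier_tendsto_sequentially(2)[OF u] by (simp only:)
    have "mean_square (\<lambda>\<xi>. fourier_integral (\<lambda>x. ?t k (x + y)) \<xi> - ?e \<xi> * fourier u \<xi>)
       = mean_square (\<lambda>\<xi>. fourier_integral (?t k) \<xi> - fourier u \<xi>)" for k
      unfolding mean_square_def fourier_integral_translate[OF tm] right_diff_distrib[symmetric] norm_mult e1 by simp
    then show "(\<lambda>k. mean_square (\<lambda>\<xi>. fourier_integral (\<lambda>x. ?t k (x + y)) \<xi> - ?e \<xi> * fourier u \<xi>)) \<longlonglongrightarrow> 0"
      using fourier_tendsto_sequentially(1)[OF u] by (simp only:)
    show "square_integrable (\<lambda>\<xi>. ?e \<xi> * fourier u \<xi>)"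
      by (rule square_integrable_mult_bounded[OF square_integrable_fourier[OF u], where B=1]) auto
  qed (rule square_integrable_translate[OF u])
qed

lemma cmod_add_square: "(cmod (a + b))\<^sup>2 = (cmod a)\<^sup>2 + (cmod b)\<^sup>2 + 2 * Re (a * cnj b)"
  by (simp add: cmod_power2 power2_sum algebra_simps)

lemma mean_square_add_complex:
  fixes f g :: "'a::euclidean_space \<Rightarrow> complex"
  assumes f: "square_integrable f" and g: "square_integrable g"
  shows "mean_square (\<lambda>x. f x + g x) = mean_square f + mean_square g + 2 * Re (LINT x|lborel. f x * cnj (g x))"
proof -
  have i: "integrable lborel (\<lambda>x. f x * cnj (g x))"
    by (intro square_integrable_times square_integrable_cnj f g)
  define r where "r x = Re (f x * cnj (g x))" for x
  have r: "integrable lborel r" "(LINT x|lborel. r x) = Re (LINT x|lborel. f x * cnj (g x))"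
    unfolding r_def[abs_def] using i by (auto simp only: integrable_Re integral_Re)
  have "mean_square (\<lambda>x. f x + g x) = (LINT x|lborel. (cmod (f x))\<^sup>2 + (cmod (g x))\<^sup>2 + 2 * r x)"
    by (simp only: mean_square_def cmod_add_square r_def)
  also have "\<dots> = mean_square f + mean_square g + 2 * (LINT x|lborel. r x)"
    using square_integrable_integrable[OF f] square_integrable_integrable[OF g] r(1)
    by (simp add: mean_square_def)
  finally show ?thesis by (simp only: r(2))
qed

text \<open>
  Polarisation of Plancherel's theorem: both sides are the mixed term in the mean square of a sum.
\<close>

lemma Parseval:
  assumes u: "square_integrable u" and v: "square_integrable v"
  shows "Re (LINT \<xi>|lborel. fourier u \<xi> * cnj (fourier v \<xi>)) = (LINT x|lborel. u x * v x)"
proof -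
  have [measurable]: "fourier u \<in> borel_measurable borel" "fourier v \<in> borel_measurable borel" "fourier (\<lambda>x. u x + v x) \<in> borel_measurable borel"
    using u v by (auto intro!: square_integrable_borel square_integrable_fourier square_integrable_add)
  have "mean_square (\<lambda>x. u x + v x) = mean_square (fourier (\<lambda>x. u x + v x))"
    by (rule Plancherel[symmetric]) (intro square_integrable_add u v)
  also have "\<dots> = mean_square (\<lambda>\<xi>. fourier u \<xi> + fourier v \<xi>)"
    by (rule mean_square_cong_AE[OF fourier_add[OF u v]]) measurable
  also have "\<dots> = mean_square u + mean_square v + 2 * Re (LINT \<xi>|lborel. fourier u \<xi> * cnj (fourier v \<xi>))"
    using mean_square_add_complex[OF square_integrable_fourier[OF u] square_integrable_fourier[OF v]]
    by (simp add: Plancherel u v)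
  finally have 1: "mean_square (\<lambda>x. u x + v x) = mean_square u + mean_square v + 2 * Re (LINT \<xi>|lborel. fourier u \<xi> * cnj (fourier v \<xi>))" .
  have "mean_square (\<lambda>x. u x + v x) = (LINT x|lborel. (norm (u x))\<^sup>2 + (norm (v x))\<^sup>2 + 2 * (u x * v x))"
    unfolding mean_square_def by (intro Bochner_Integration.integral_cong refl) (simp add: power2_sum)
  also have "\<dots> = mean_square u + mean_square v + 2 * (LINT x|lborel. u x * v x)"
    using square_integrable_integrable[OF u] square_integrable_integrable[OF v] square_integrable_times[OF u v]
    by (simp add: mean_square_def)
  finally show ?thesis using 1 by simp
qed

text \<open>
  For truncations this is Fubini's theorem; both sides are continuous in mean square.
\<close>

lemma fourier_exchange:
  fixes u h :: "'a::euclidean_space \<Rightarrow> real"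
  assumes u: "square_integrable u" and h: "square_integrable h"
  shows "(LINT \<xi>|lborel. fourier u \<xi> * complex_of_real (h \<xi>)) = (LINT x|lborel. complex_of_real (u x) * fourier h x)"
proof (rule LIMSEQ_unique)
  let ?t = "\<lambda>u k x. indicator (ball 0 (real k)) x * u x"
  have t: "integrable lborel (?t u R)" "square_integrable (?t u R)" "integrable lborel (?t h R)" "square_integrable (?t h R)" for R
    using u h by (auto intro: integrable_truncation square_integrable_indicator_ball)
  have lu: "(\<lambda>k. mean_square (\<lambda>x. complex_of_real (?t u k x) - complex_of_real (u x))) \<longlonglongrightarrow> 0"
    using fourier_tendsto_sequentially(2)[OF u] by (simp only: mean_square_of_real flip: of_real_diff)
  have lh: "(\<lambda>k. mean_square (\<lambda>x. complex_of_real (?t h k x) - complex_of_real (h x))) \<longlonglongrightarrow> 0"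
    using fourier_tendsto_sequentially(2)[OF h] by (simp only: mean_square_of_real flip: of_real_diff)
  show "(\<lambda>k. LINT \<xi>|lborel. fourier_integral (?t u k) \<xi> * complex_of_real (?t h k \<xi>))
    \<longlonglongrightarrow> (LINT \<xi>|lborel. fourier u \<xi> * complex_of_real (h \<xi>))"
    by (intro inner_product_tendsto Plancherel_fourier_integral square_integrable_fourier square_integrable_of_real t u h
      fourier_tendsto_sequentially lh)
  have "(LINT \<xi>|lborel. fourier_integral (?t u k) \<xi> * complex_of_real (?t h k \<xi>))
    = (LINT x|lborel. complex_of_real (?t u k x) * fourier_integral (?t h k) x)" for k
  proof -
    let ?c = "complex_of_real ((2 * pi) powr (- real DIM('a) / 2))"
    have "(LINT \<xi>|lborel. fourier_integral (?t u k) \<xi> * complex_of_real (?t h k \<xi>))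
      = ?c * (LINT \<xi>|lborel. char_transform (\<lambda>x. complex_of_real (?t u k x)) \<xi> * complex_of_real (?t h k \<xi>))"
      unfolding fourier_integral_eq mult.assoc by (rule integral_mult_right_zero)
    also have "\<dots> = ?c * (LINT x|lborel. complex_of_real (?t u k x) * char_transform (\<lambda>x. complex_of_real (?t h k x)) x)"
      using t by (subst char_transform_exchange) (simp_all only: integrable_of_real)
    also have "\<dots> = (LINT x|lborel. complex_of_real (?t u k x) * fourier_integral (?t h k) x)"
      unfolding fourier_integral_eq mult.left_commute[of _ ?c] by (rule integral_mult_right_zero[symmetric])
    finally show ?thesis .
  qed
  moreover have "(\<lambda>k. LINT x|lborel. complex_of_real (?t u k x) * fourier_integral (?t h k) x)
    \<longlonglongrightarrow> (LINT x|lborel. complex_of_real (u x) * fourier h x)"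
    by (intro inner_product_tendsto Plancherel_fourier_integral square_integrable_fourier square_integrable_of_real t u h
      fourier_tendsto_sequentially lu)
  ultimately show "(\<lambda>k. LINT \<xi>|lborel. fourier_integral (?t u k) \<xi> * complex_of_real (?t h k \<xi>))
    \<longlonglongrightarrow> (LINT x|lborel. complex_of_real (u x) * fourier h x)" by (simp only:)
qed


section \<open>Quadratic forms of order one\<close>

text \<open>By the Cauchy-Schwarz inequality, changing the test function slightly changes the integrals slightly, uniformly in \<open>k\<close>.\<close>

lemma weak_limit_closed:
  fixes g :: "nat \<Rightarrow> 'a::euclidean_space \<Rightarrow> complex"
  assumes g: "\<And>k. square_integrable (g k)" "square_integrable g'" and h: "square_integrable h"
    and B: "\<And>k. mean_square (g k) \<le> B" "mean_square g' \<le> B"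
    and approx: "\<And>e. e > 0 \<Longrightarrow> \<exists>h'. square_integrable h' \<and> mean_square (\<lambda>x. h x - h' x) < e \<and>
      (\<lambda>k. LINT x|lborel. g k x * h' x) \<longlonglongrightarrow> (LINT x|lborel. g' x * h' x)"
  shows "(\<lambda>k. LINT x|lborel. g k x * h x) \<longlonglongrightarrow> (LINT x|lborel. g' x * h x)"
proof (rule LIMSEQ_I)
  fix e :: real assume e: "e > 0"
  have B0: "0 \<le> B" using B(2) mean_square_nonneg[of g'] by linarith
  \<comment> \<open>Replacing \<open>h\<close> by \<open>h'\<close> then costs at most \<open>sqrt B * sqrt d \<le> e / 4\<close>; adding 1 keeps the denominator positive for \<open>B = 0\<close>.\<close>
  define d where "d = (e / (4 * (sqrt B + 1)))\<^sup>2"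
  have sB: "0 < sqrt B + 1" using B0 by (simp add: add_nonneg_pos)
  have d: "d > 0" unfolding d_def using e sB by simp
  have "sqrt d = e / (4 * (sqrt B + 1))"
    unfolding d_def real_sqrt_abs using e sB by (simp add: abs_of_pos)
  then have sd: "(sqrt B + 1) * sqrt d = e / 4" 
    using nonzero_mult_divide_mult_cancel_left[of "sqrt B + 1" e 4] sB by (simp add: mult.commute[of 4])
  obtain h' where h': "square_integrable h'" "mean_square (\<lambda>x. h x - h' x) < d"
    "(\<lambda>k. LINT x|lborel. g k x * h' x) \<longlonglongrightarrow> (LINT x|lborel. g' x * h' x)"
    using approx[OF d] by blast
  obtain N where N: "\<And>k. k \<ge> N \<Longrightarrow> norm ((LINT x|lborel. g k x * h' x) - (LINT x|lborel. g' x * h' x)) < e/2"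
    using LIMSEQ_D[OF h'(3), of "e/2"] e by auto
  have small: "norm ((LINT x|lborel. f x * h x) - (LINT x|lborel. f x * h' x)) \<le> e/4"
    if f: "square_integrable f" "mean_square f \<le> B" for f
  proof -
    have eq: "(LINT x|lborel. f x * h x) - (LINT x|lborel. f x * h' x) = (LINT x|lborel. f x * (h x - h' x))"
      using square_integrable_times[OF f(1) h] square_integrable_times[OF f(1) h'(1)]
      by (simp add: right_diff_distrib)
    have "norm (LINT x|lborel. f x * (h x - h' x)) \<le> sqrt (mean_square f) * sqrt (mean_square (\<lambda>x. h x - h' x))"
      by (intro Cauchy_Schwarz_mean_square square_integrable_diff f h h')
    moreover have "sqrt (mean_square f) * sqrt (mean_square (\<lambda>x. h x - h' x)) \<le> (sqrt B + 1) * sqrt d"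
    proof (rule mult_mono)
      show "sqrt (mean_square f) \<le> sqrt B + 1" using f(2) real_sqrt_le_mono[of "mean_square f" B] by linarith
      show "sqrt (mean_square (\<lambda>x. h x - h' x)) \<le> sqrt d" using h'(2) by (intro real_sqrt_le_mono) simp
    qed (use sB in auto)
    ultimately show ?thesis unfolding eq sd by (rule order_trans)
  qed
  have "norm ((LINT x|lborel. g k x * h x) - (LINT x|lborel. g' x * h x)) < e" if k: "k \<ge> N" for k
  proof -
    let ?a = "LINT x|lborel. g k x * h x" and ?b = "LINT x|lborel. g k x * h' x"
    let ?c = "LINT x|lborel. g' x * h' x" and ?d = "LINT x|lborel. g' x * h x"
    have eq: "?a - ?d = (?a - ?b) + ((?b - ?c) - (?d - ?c))" by simp
    have "norm (?a - ?d) \<le> norm (?a - ?b) + (norm (?b - ?c) + norm (?d - ?c))"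
      unfolding eq by (rule order_trans[OF norm_triangle_ineq add_left_mono[OF norm_triangle_ineq4]])
    then show ?thesis
      using small[OF g(1) B(1), of k] small[OF g(2) B(2)] N[OF k] e by linarith
  qed
  then show "\<exists>no. \<forall>n\<ge>no. norm ((LINT x|lborel. g n x * h x) - (LINT x|lborel. g' x * h x)) < e" by blast
qed

text \<open>For real \<open>h\<close> the exchange formula moves the transform from \<open>u k\<close> to \<open>h\<close>.\<close>

lemma fourier_weak_limit:
  fixes u :: "nat \<Rightarrow> 'a::euclidean_space \<Rightarrow> real" and h :: "'a \<Rightarrow> complex"
  assumes u: "\<And>k. square_integrable (u k)" "square_integrable u'"
    and weak: "\<And>f. square_integrable f \<Longrightarrow> (\<lambda>k. LINT x|lborel. u k x * f x) \<longlonglongrightarrow> (LINT x|lborel. u' x * f x)"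
    and h: "square_integrable h"
  shows "(\<lambda>k. LINT \<xi>|lborel. fourier (u k) \<xi> * h \<xi>) \<longlonglongrightarrow> (LINT \<xi>|lborel. fourier u' \<xi> * h \<xi>)"
proof -
  have real: "(\<lambda>k. LINT \<xi>|lborel. fourier (u k) \<xi> * complex_of_real (f \<xi>)) \<longlonglongrightarrow> (LINT \<xi>|lborel. fourier u' \<xi> * complex_of_real (f \<xi>))"
    if f: "square_integrable f" for f
  proof -
    have F: "square_integrable (fourier f)" by (rule square_integrable_fourier[OF f])
    have Fm[measurable]: "fourier f \<in> borel_measurable borel" by (rule square_integrable_borel[OF F])
    have ReF: "square_integrable (\<lambda>x. Re (fourier f x))"
      by (rule square_integrable_bound[OF _ square_integrable_integrable[OF F]]) (auto simp: cmod_power2)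
    have ImF: "square_integrable (\<lambda>x. Im (fourier f x))"
      by (rule square_integrable_bound[OF _ square_integrable_integrable[OF F]]) (auto simp: cmod_power2)
    have eq: "(LINT \<xi>|lborel. fourier w \<xi> * complex_of_real (f \<xi>))
       = Complex (LINT x|lborel. w x * Re (fourier f x)) (LINT x|lborel. w x * Im (fourier f x))"
      if w: "square_integrable w" for w
    proof -
      have i: "integrable lborel (\<lambda>x. complex_of_real (w x) * fourier f x)"
        by (intro square_integrable_times square_integrable_of_real w F)
      have "(LINT \<xi>|lborel. fourier w \<xi> * complex_of_real (f \<xi>)) = (LINT x|lborel. complex_of_real (w x) * fourier f x)"
        by (rule fourier_exchange[OF w f])
      also have "\<dots> = Complex (LINT x|lborel. Re (complex_of_real (w x) * fourier f x)) (LINT x|lborel. Im (complex_of_real (w x) * fourier f x))"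
        by (rule complex_eqI) (simp_all only: complex.sel integral_Re[OF i] integral_Im[OF i])
      finally show ?thesis by simp
    qed
    show ?thesis unfolding eq[OF u(1)] eq[OF u(2)]
      by (intro tendsto_Complex weak ReF ImF)
  qed
  have hm[measurable]: "h \<in> borel_measurable borel" by (rule square_integrable_borel[OF h])
  have Reh: "square_integrable (\<lambda>x. Re (h x))"
    by (rule square_integrable_bound[OF _ square_integrable_integrable[OF h]]) (auto simp: cmod_power2)
  have Imh: "square_integrable (\<lambda>x. Im (h x))"
    by (rule square_integrable_bound[OF _ square_integrable_integrable[OF h]]) (auto simp: cmod_power2)
  have eq: "(LINT \<xi>|lborel. fourier w \<xi> * h \<xi>)
    = (LINT \<xi>|lborel. fourier w \<xi> * complex_of_real (Re (h \<xi>))) + \<i> * (LINT \<xi>|lborel. fourier w \<xi> * complex_of_real (Im (h \<xi>)))"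
    if w: "square_integrable w" for w
  proof -
    have i: "integrable lborel (\<lambda>\<xi>. fourier w \<xi> * complex_of_real (Re (h \<xi>)))"
      "integrable lborel (\<lambda>\<xi>. fourier w \<xi> * complex_of_real (Im (h \<xi>)))"
      by (intro square_integrable_times square_integrable_of_real square_integrable_fourier w Reh Imh)+
    have "(LINT \<xi>|lborel. fourier w \<xi> * h \<xi>)
      = (LINT \<xi>|lborel. fourier w \<xi> * complex_of_real (Re (h \<xi>)) + \<i> * (fourier w \<xi> * complex_of_real (Im (h \<xi>))))"
      by (intro Bochner_Integration.integral_cong refl) (simp add: complex_eq_iff)
    then show ?thesis using i by simp
  qed
  show ?thesis unfolding eq[OF u(1)] eq[OF u(2)]
    by (intro tendsto_intros real Reh Imh)
qed

lemma powr_half_le: "(1 + (norm \<xi>)\<^sup>2) powr (1 / 2) \<le> 1 + norm (\<xi>::'a::euclidean_space)"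
proof -
  have "sqrt (1 + (norm \<xi>)\<^sup>2) \<le> 1 + norm \<xi>"
    by (intro real_le_lsqrt) (auto simp: power2_sum)
  then show ?thesis by (simp add: powr_half_sqrt)
qed

lemma fourier_borel: "square_integrable u \<Longrightarrow> fourier u \<in> borel_measurable borel"
  by (intro square_integrable_borel square_integrable_fourier)

lemma square_integrable_cong_AE:
  assumes "AE x in lborel. f x = g x" "f \<in> borel_measurable borel" "square_integrable g"
  shows "square_integrable f"
  by (rule square_integrable_bound[OF assms(2) square_integrable_integrable[OF assms(3)]]) (use assms(1) in eventually_elim, simp)

lemma cmod_exp_minus_1_square_le: "(cmod (exp (\<i> * complex_of_real t) - 1))\<^sup>2 \<le> 2 * \<bar>t\<bar>"
proof -
  have "cmod (exp (\<i> * complex_of_real t) - 1) \<le> \<bar>t\<bar>" using iexp_approx1[of t 0] by simp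
  moreover have "cmod (exp (\<i> * complex_of_real t) - 1) \<le> 2"
    using norm_triangle_ineq4[of "exp (\<i> * complex_of_real t)" 1] by simp
  ultimately have "cmod (exp (\<i> * complex_of_real t) - 1) * cmod (exp (\<i> * complex_of_real t) - 1) \<le> 2 * \<bar>t\<bar>"
    by (intro mult_mono) auto
  then show ?thesis by (simp add: power2_eq_square)
qed

lemma gauss_square_integrable: "square_integrable (gauss :: 'a::euclidean_space \<Rightarrow> real)"
proof (rule square_integrable_bound[OF _ integrable_gauss])
  have "gauss x * gauss x \<le> gauss x * 1" for x :: 'a by (intro mult_left_mono) auto
  then show "AE x::'a in lborel. (norm (gauss x))\<^sup>2 \<le> gauss x" by (auto simp: power2_eq_square)
qed measurable

text \<open>
  The transform of a Gaussian is a Gaussian, which decays faster than the weight grows.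
\<close>

lemma gauss_sobolev: "(gauss :: 'a::euclidean_space \<Rightarrow> real) \<in> sobolev (1 / 2)"
proof -
  define \<kappa> where "\<kappa> = (2 * pi) powr (- real DIM('a) / 2) * sqrt (2 * pi) ^ DIM('a)"
  have [measurable]: "fourier (gauss :: 'a \<Rightarrow> real) \<in> borel_measurable borel"
    by (rule fourier_borel[OF gauss_square_integrable])
  have F: "AE \<xi>::'a in lborel. fourier gauss \<xi> = complex_of_real (\<kappa> * gauss \<xi>)"
    using fourier_eq_fourier_integral[OF integrable_gauss gauss_square_integrable]
    by eventually_elim (simp only: fourier_integral_eq gauss_transform(2) \<kappa>_def of_real_mult mult.assoc)
  have le: "(1 + (norm \<xi>)\<^sup>2) powr (1 / 2) * (gauss \<xi>)\<^sup>2 \<le> 2 * gauss \<xi>" for \<xi> :: 'a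
  proof -
    have "(1 + (norm \<xi>)\<^sup>2) powr (1 / 2) \<le> (1 + (norm \<xi>)\<^sup>2) powr 1" by (rule powr_mono) auto
    also have "\<dots> \<le> 2 * (1 + (norm \<xi>)\<^sup>2 / 2)" by simp
    also have "\<dots> \<le> 2 * exp ((norm \<xi>)\<^sup>2 / 2)" by (intro mult_left_mono exp_ge_add_one_self) simp
    finally have "(1 + (norm \<xi>)\<^sup>2) powr (1 / 2) * gauss \<xi> \<le> 2 * exp ((norm \<xi>)\<^sup>2 / 2) * gauss \<xi>"
      by (rule mult_right_mono) simp
    also have "\<dots> = 2" by (simp add: gauss_def exp_minus)
    finally have "(1 + (norm \<xi>)\<^sup>2) powr (1 / 2) * gauss \<xi> * gauss \<xi> \<le> 2 * gauss \<xi>"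
      by (rule mult_right_mono) simp
    then show ?thesis by (simp add: power2_eq_square mult.assoc)
  qed
  have "integrable lborel (\<lambda>\<xi>::'a. (1 + (norm \<xi>)\<^sup>2) powr (1 / 2) * (cmod (fourier gauss \<xi>))\<^sup>2)"
  proof (rule Bochner_Integration.integrable_bound)
    show "integrable lborel (\<lambda>\<xi>::'a. \<kappa>\<^sup>2 * (2 * gauss \<xi>))"
      by (intro integrable_mult_right integrable_gauss)
    show "AE \<xi>::'a in lborel. norm ((1 + (norm \<xi>)\<^sup>2) powr (1 / 2) * (cmod (fourier gauss \<xi>))\<^sup>2) \<le> norm (\<kappa>\<^sup>2 * (2 * gauss \<xi>))"
      using F
    proof eventually_elim
      case (elim \<xi>)
      have "(1 + (norm \<xi>)\<^sup>2) powr (1 / 2) * (cmod (fourier gauss \<xi>))\<^sup>2 = \<kappa>\<^sup>2 * ((1 + (norm \<xi>)\<^sup>2) powr (1 / 2) * (gauss \<xi>)\<^sup>2)"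
        unfolding elim norm_of_real by (simp add: power_mult_distrib)
      also have "\<dots> \<le> \<kappa>\<^sup>2 * (2 * gauss \<xi>)" by (intro mult_left_mono le) simp
      finally show ?case by (simp add: abs_mult)
    qed
  qed measurable
  then show ?thesis using gauss_square_integrable by (simp add: sobolev_def)
qed

text \<open>
  A symbol comparable to \<open>1 + norm \<xi>\<close>: its form is then equivalent to the norm of the Sobolev space of
  order \<open>1/2\<close>. The upper bound is stated with the weight of that norm.
\<close>

locale elliptic_symbol =
  fixes A :: "'a::euclidean_space \<Rightarrow> real" and a b :: real
  assumes A_measurable [measurable]: "A \<in> borel_measurable borel"
    and a_pos: "0 < a"
    and A_lower: "a * (1 + norm \<xi>) \<le> A \<xi>"
    and A_upper: "A \<xi> \<le> b * (1 + (norm \<xi>)\<^sup>2) powr (1 / 2)"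
begin

definition form :: "('a \<Rightarrow> real) \<Rightarrow> ('a \<Rightarrow> real) \<Rightarrow> real"
  where "form u v = Re (LINT \<xi>|lborel. complex_of_real (A \<xi>) * fourier u \<xi> * cnj (fourier v \<xi>))"

text \<open>
  The factor \<open>sqrt (A \<xi>)\<close> turns the form into an \<open>L2\<close> inner product.
\<close>

definition weighted :: "('a \<Rightarrow> real) \<Rightarrow> 'a \<Rightarrow> complex"
  where "weighted u \<xi> = complex_of_real (sqrt (A \<xi>)) * fourier u \<xi>"

lemma A_pos: "0 < A \<xi>"
proof -
  have "0 < a * (1 + norm \<xi>)" using a_pos by (intro mult_pos_pos) (auto intro: add_pos_nonneg)
  then show ?thesis using A_lower[of \<xi>] by linarith
qed

lemma A_nonneg: "0 \<le> A \<xi>"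
  using A_pos[of \<xi>] by simp

lemma norm_weighted_square: "(cmod (weighted u \<xi>))\<^sup>2 = A \<xi> * (cmod (fourier u \<xi>))\<^sup>2"
  using A_nonneg[of \<xi>] by (simp add: weighted_def norm_mult power_mult_distrib)

lemma sobolev_half_iff: "u \<in> sobolev (1 / 2) \<longleftrightarrow> square_integrable u \<and> square_integrable (weighted u)"
proof (cases "square_integrable u")
  case True
  have [measurable]: "fourier u \<in> borel_measurable borel" by (rule fourier_borel[OF True])
  have m[measurable]: "weighted u \<in> borel_measurable borel" unfolding weighted_def by measurable
  have "integrable lborel (\<lambda>\<xi>. (1 + (norm \<xi>)\<^sup>2) powr (1 / 2) * (cmod (fourier u \<xi>))\<^sup>2)
    \<longleftrightarrow> integrable lborel (\<lambda>\<xi>. (cmod (weighted u \<xi>))\<^sup>2)"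
  proof
    assume i: "integrable lborel (\<lambda>\<xi>. (1 + (norm \<xi>)\<^sup>2) powr (1 / 2) * (cmod (fourier u \<xi>))\<^sup>2)"
    show "integrable lborel (\<lambda>\<xi>. (cmod (weighted u \<xi>))\<^sup>2)"
    proof (rule Bochner_Integration.integrable_bound)
      show "integrable lborel (\<lambda>\<xi>. b * ((1 + (norm \<xi>)\<^sup>2) powr (1 / 2) * (cmod (fourier u \<xi>))\<^sup>2))"
        using i by (rule integrable_mult_right)
      show "AE \<xi> in lborel. norm ((cmod (weighted u \<xi>))\<^sup>2) \<le> norm (b * ((1 + (norm \<xi>)\<^sup>2) powr (1 / 2) * (cmod (fourier u \<xi>))\<^sup>2))"
      proof (rule AE_I2)
        fix \<xi> :: 'a
        have "norm ((cmod (weighted u \<xi>))\<^sup>2) = A \<xi> * (cmod (fourier u \<xi>))\<^sup>2" by (simp add: norm_weighted_square A_nonneg)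
        also have "\<dots> \<le> b * (1 + (norm \<xi>)\<^sup>2) powr (1 / 2) * (cmod (fourier u \<xi>))\<^sup>2"
          by (intro mult_right_mono A_upper) simp
        also have "\<dots> \<le> norm \<dots>" by simp
        finally show "norm ((cmod (weighted u \<xi>))\<^sup>2) \<le> norm (b * ((1 + (norm \<xi>)\<^sup>2) powr (1 / 2) * (cmod (fourier u \<xi>))\<^sup>2))"
          by (simp only: mult.assoc)
      qed
    qed measurable
  next
    assume i: "integrable lborel (\<lambda>\<xi>. (cmod (weighted u \<xi>))\<^sup>2)"
    show "integrable lborel (\<lambda>\<xi>. (1 + (norm \<xi>)\<^sup>2) powr (1 / 2) * (cmod (fourier u \<xi>))\<^sup>2)"
    proof (rule Bochner_Integration.integrable_bound)
      show "integrable lborel (\<lambda>\<xi>. (1 / a) * (cmod (weighted u \<xi>))\<^sup>2)"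
        using i by (rule integrable_mult_right)
      show "AE \<xi> in lborel. norm ((1 + (norm \<xi>)\<^sup>2) powr (1 / 2) * (cmod (fourier u \<xi>))\<^sup>2) \<le> norm ((1 / a) * (cmod (weighted u \<xi>))\<^sup>2)"
      proof (rule AE_I2)
        fix \<xi> :: 'a
        have "(1 + (norm \<xi>)\<^sup>2) powr (1 / 2) \<le> (1 / a) * A \<xi>"
          using order_trans[OF mult_left_mono[OF powr_half_le[of \<xi>], of a] A_lower[of \<xi>]] a_pos
          by (simp add: field_simps)
        then have "(1 + (norm \<xi>)\<^sup>2) powr (1 / 2) * (cmod (fourier u \<xi>))\<^sup>2 \<le> (1 / a) * A \<xi> * (cmod (fourier u \<xi>))\<^sup>2"
          by (rule mult_right_mono) simp
        then show "norm ((1 + (norm \<xi>)\<^sup>2) powr (1 / 2) * (cmod (fourier u \<xi>))\<^sup>2) \<le> norm ((1 / a) * (cmod (weighted u \<xi>))\<^sup>2)"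
          using a_pos A_nonneg[of \<xi>] by (simp add: norm_weighted_square abs_mult)
      qed
    qed measurable
  qed
  then show ?thesis using True m by (auto simp: sobolev_def square_integrable_def)
qed (simp add: sobolev_def)

lemma sobolev_square_integrable: "u \<in> sobolev (1 / 2) \<Longrightarrow> square_integrable u"
  and weighted_square_integrable: "u \<in> sobolev (1 / 2) \<Longrightarrow> square_integrable (weighted u)"
  by (auto simp: sobolev_half_iff)

lemma symbol_product_eq:
  "complex_of_real (A \<xi>) * fourier u \<xi> * cnj (fourier v \<xi>) = weighted u \<xi> * cnj (weighted v \<xi>)"
proof -
  have "complex_of_real (A \<xi>) = complex_of_real (sqrt (A \<xi>)) * complex_of_real (sqrt (A \<xi>))"
    using A_nonneg[of \<xi>] by (simp flip: of_real_mult)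
  then show ?thesis by (simp add: weighted_def ac_simps)
qed

lemma form_eq: "form u v = Re (LINT \<xi>|lborel. weighted u \<xi> * cnj (weighted v \<xi>))"
  by (simp add: form_def symbol_product_eq)

lemma form_self: "form u u = mean_square (weighted u)"
proof -
  have "(LINT \<xi>|lborel. weighted u \<xi> * cnj (weighted u \<xi>)) = complex_of_real (mean_square (weighted u))"
    unfolding mean_square_def integral_complex_of_real[symmetric] by (simp only: complex_norm_square)
  then show ?thesis by (simp add: form_eq)
qed

lemma form_self_integral: "form u u = (LINT \<xi>|lborel. A \<xi> * (cmod (fourier u \<xi>))\<^sup>2)"
  by (simp add: form_self mean_square_def norm_weighted_square)

lemma form_nonneg: "0 \<le> form u u"
  by (simp add: form_self)

lemma form_commute: "form u v = form v u"
proof -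
  have "form v u = Re (cnj (LINT \<xi>|lborel. weighted u \<xi> * cnj (weighted v \<xi>)))"
    unfolding form_eq Bochner_Integration.integral_cnj[symmetric] by (simp add: mult.commute)
  then show ?thesis by (simp add: form_eq)
qed

lemma weighted_borel: "square_integrable u \<Longrightarrow> weighted u \<in> borel_measurable borel"
proof -
  assume "square_integrable u"
  then have [measurable]: "fourier u \<in> borel_measurable borel" by (rule fourier_borel)
  show ?thesis unfolding weighted_def by measurable
qed

lemma weighted_add:
  assumes "square_integrable u" "square_integrable v"
  shows "AE \<xi> in lborel. weighted (\<lambda>x. u x + v x) \<xi> = weighted u \<xi> + weighted v \<xi>"
  using fourier_add[OF assms] by eventually_elim (simp add: weighted_def distrib_left)

lemma weighted_mult:
  assumes "square_integrable u"
  shows "AE \<xi> in lborel. weighted (\<lambda>x. c * u x) \<xi> = complex_of_real c * weighted u \<xi>"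
  using fourier_mult[OF assms, of c] by eventually_elim (simp add: weighted_def)

lemma weighted_translate:
  assumes "square_integrable u"
  shows "AE \<xi> in lborel. weighted (\<lambda>x. u (x + y)) \<xi> = exp (\<i> * complex_of_real (y \<bullet> \<xi>)) * weighted u \<xi>"
  using fourier_translate[OF assms, of y] by eventually_elim (simp add: weighted_def)

lemma sobolev_add:
  fixes u v :: "'a \<Rightarrow> real"
  assumes u: "u \<in> sobolev (1 / 2)" and v: "v \<in> sobolev (1 / 2)"
  shows "(\<lambda>x. u x + v x) \<in> sobolev (1 / 2)"
proof -
  note u' = sobolev_square_integrable[OF u] weighted_square_integrable[OF u]
  note v' = sobolev_square_integrable[OF v] weighted_square_integrable[OF v]
  show ?thesis unfolding sobolev_half_iff
    by (intro conjI square_integrable_add u' v' square_integrable_cong_AE[OF weighted_add[OF u'(1) v'(1)] weighted_borel])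
qed

lemma sobolev_mult:
  fixes u :: "'a \<Rightarrow> real"
  assumes u: "u \<in> sobolev (1 / 2)"
  shows "(\<lambda>x. c * u x) \<in> sobolev (1 / 2)"
proof -
  note u' = sobolev_square_integrable[OF u] weighted_square_integrable[OF u]
  show ?thesis unfolding sobolev_half_iff
    by (intro conjI square_integrable_cmult u' square_integrable_cong_AE[OF weighted_mult[OF u'(1)] weighted_borel])
qed

lemma sobolev_translate:
  fixes u :: "'a \<Rightarrow> real"
  assumes u: "u \<in> sobolev (1 / 2)"
  shows "(\<lambda>x. u (x + y)) \<in> sobolev (1 / 2)"
proof -
  note u' = sobolev_square_integrable[OF u] weighted_square_integrable[OF u]
  have "square_integrable (\<lambda>\<xi>. exp (\<i> * complex_of_real (y \<bullet> \<xi>)) * weighted u \<xi>)"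
    by (rule square_integrable_mult_bounded[OF u'(2), where B=1]) auto
  then show ?thesis unfolding sobolev_half_iff
    by (intro conjI square_integrable_translate u' square_integrable_cong_AE[OF weighted_translate[OF u'(1)] weighted_borel])
qed

lemma form_translate:
  assumes u: "u \<in> sobolev (1 / 2)"
  shows "form (\<lambda>x. u (x + y)) (\<lambda>x. u (x + y)) = form u u"
proof -
  note u' = sobolev_square_integrable[OF u]
  have [measurable]: "weighted u \<in> borel_measurable borel" by (rule weighted_borel[OF u'])
  have "mean_square (weighted (\<lambda>x. u (x + y))) = mean_square (\<lambda>\<xi>. exp (\<i> * complex_of_real (y \<bullet> \<xi>)) * weighted u \<xi>)"
    by (intro mean_square_cong_AE weighted_translate u' weighted_borel square_integrable_translate) measurable
  then show ?thesis by (simp add: form_self mean_square_def norm_mult)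
qed

lemma weighted_product_integrable:
  "u \<in> sobolev (1 / 2) \<Longrightarrow> v \<in> sobolev (1 / 2) \<Longrightarrow> integrable lborel (\<lambda>\<xi>. weighted u \<xi> * cnj (weighted v \<xi>))"
  by (intro square_integrable_times square_integrable_cnj weighted_square_integrable)

lemma form_add_left:
  assumes u: "u \<in> sobolev (1 / 2)" and v: "v \<in> sobolev (1 / 2)" and w: "w \<in> sobolev (1 / 2)"
  shows "form (\<lambda>x. u x + v x) w = form u w + form v w"
proof -
  note sq = sobolev_square_integrable
  have [measurable]: "weighted u \<in> borel_measurable borel" "weighted v \<in> borel_measurable borel"
    by (intro weighted_borel sq u v)+
  have [measurable]: "(\<lambda>\<xi>. cnj (weighted w \<xi>)) \<in> borel_measurable borel" "weighted (\<lambda>x. u x + v x) \<in> borel_measurable borel"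
    by (intro square_integrable_borel square_integrable_cnj weighted_square_integrable w sobolev_add u v)+
  have "(LINT \<xi>|lborel. weighted (\<lambda>x. u x + v x) \<xi> * cnj (weighted w \<xi>))
    = (LINT \<xi>|lborel. weighted u \<xi> * cnj (weighted w \<xi>) + weighted v \<xi> * cnj (weighted w \<xi>))"
  proof (rule integral_cong_AE)
    show "AE \<xi> in lborel. weighted (\<lambda>x. u x + v x) \<xi> * cnj (weighted w \<xi>)
      = weighted u \<xi> * cnj (weighted w \<xi>) + weighted v \<xi> * cnj (weighted w \<xi>)"
      using weighted_add[OF sq[OF u] sq[OF v]] by eventually_elim (simp add: distrib_right)
  qed measurable
  then show ?thesis
    using weighted_product_integrable[OF u w] weighted_product_integrable[OF v w] by (simp add: form_eq)
qed

lemma form_mult_left: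
  assumes u: "u \<in> sobolev (1 / 2)" and w: "w \<in> sobolev (1 / 2)"
  shows "form (\<lambda>x. c * u x) w = c * form u w"
proof -
  note sq = sobolev_square_integrable
  have [measurable]: "weighted u \<in> borel_measurable borel" by (intro weighted_borel sq u)
  have [measurable]: "(\<lambda>\<xi>. cnj (weighted w \<xi>)) \<in> borel_measurable borel" "weighted (\<lambda>x. c * u x) \<in> borel_measurable borel"
    by (intro square_integrable_borel square_integrable_cnj weighted_square_integrable w sobolev_mult u)+
  have "(LINT \<xi>|lborel. weighted (\<lambda>x. c * u x) \<xi> * cnj (weighted w \<xi>))
    = (LINT \<xi>|lborel. complex_of_real c * (weighted u \<xi> * cnj (weighted w \<xi>)))"
  proof (rule integral_cong_AE)
    show "AE \<xi> in lborel. weighted (\<lambda>x. c * u x) \<xi> * cnj (weighted w \<xi>)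
      = complex_of_real c * (weighted u \<xi> * cnj (weighted w \<xi>))"
      using weighted_mult[OF sq[OF u], of c] by eventually_elim simp
  qed measurable
  then show ?thesis by (simp add: form_eq)
qed

lemma mean_square_le_form:
  assumes u: "u \<in> sobolev (1 / 2)"
  shows "mean_square u \<le> 2 / a * form u u"
proof -
  note u' = sobolev_square_integrable[OF u] weighted_square_integrable[OF u]
  have "mean_square u = (LINT \<xi>|lborel. (cmod (fourier u \<xi>))\<^sup>2)"
    using Plancherel[OF u'(1)] by (simp add: mean_square_def)
  also have "\<dots> \<le> (LINT \<xi>|lborel. 2 / a * (cmod (weighted u \<xi>))\<^sup>2)"
  proof (rule integral_mono)
    show "integrable lborel (\<lambda>\<xi>. (cmod (fourier u \<xi>))\<^sup>2)"
      by (intro square_integrable_integrable square_integrable_fourier u')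
    show "integrable lborel (\<lambda>\<xi>. 2 / a * (cmod (weighted u \<xi>))\<^sup>2)"
      by (intro integrable_mult_right square_integrable_integrable u')
    fix \<xi> :: 'a
    have "a * 1 \<le> a * (1 + norm \<xi>)" using a_pos by (intro mult_left_mono) auto
    then have "a \<le> A \<xi>" using A_lower[of \<xi>] by linarith
    then have "1 \<le> A \<xi> / a" using a_pos by simp
    then have "1 \<le> 2 / a * A \<xi>" by simp
    then have "1 * (cmod (fourier u \<xi>))\<^sup>2 \<le> 2 / a * A \<xi> * (cmod (fourier u \<xi>))\<^sup>2"
      by (rule mult_right_mono) simp
    then show "(cmod (fourier u \<xi>))\<^sup>2 \<le> 2 / a * (cmod (weighted u \<xi>))\<^sup>2" by (simp add: norm_weighted_square)
  qed
  also have "\<dots> = 2 / a * form u u" by (simp add: form_self mean_square_def)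
  finally show ?thesis .
qed

text \<open>
  A translation by \<open>y\<close> multiplies the transform by a character, and
  \<open>(cmod (exp (\<i> * t) - 1))^2 \<le> 2 * \<bar>t\<bar>\<close> is of first order in \<open>\<bar>t\<bar> \<le> norm y * norm \<xi>\<close>, like the symbol.
\<close>

lemma mean_square_translate_diff_le:
  assumes u: "u \<in> sobolev (1 / 2)"
  shows "mean_square (\<lambda>x. u (x + y) - u x) \<le> 2 / a * form u u * norm y"
proof -
  note u' = sobolev_square_integrable[OF u] weighted_square_integrable[OF u]
  let ?e = "\<lambda>\<xi>. exp (\<i> * complex_of_real (y \<bullet> \<xi>))"
  let ?d = "\<lambda>x. u (x + y) - u x"
  have ut: "square_integrable (\<lambda>x. u (x + y))" "square_integrable (\<lambda>x. (-1) * u x)" "square_integrable ?d"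
    by (intro square_integrable_translate square_integrable_cmult square_integrable_diff u')+
  have [measurable]: "fourier u \<in> borel_measurable borel" "fourier ?d \<in> borel_measurable borel"
    by (intro fourier_borel u' ut)+
  have F: "AE \<xi> in lborel. fourier ?d \<xi> = (?e \<xi> - 1) * fourier u \<xi>"
    using fourier_add[OF ut(1,2)] fourier_translate[OF u'(1), of y] fourier_mult[OF u'(1), of "-1"]
    by eventually_elim (simp add: algebra_simps)
  have "mean_square ?d = mean_square (fourier ?d)" by (rule Plancherel[OF ut(3), symmetric])
  also have "\<dots> = mean_square (\<lambda>\<xi>. (?e \<xi> - 1) * fourier u \<xi>)"
    by (rule mean_square_cong_AE[OF F]) measurable
  also have "\<dots> \<le> (LINT \<xi>|lborel. (2 / a * norm y) * (cmod (weighted u \<xi>))\<^sup>2)"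
    unfolding mean_square_def
  proof (rule integral_mono)
    show "integrable lborel (\<lambda>\<xi>. (norm ((?e \<xi> - 1) * fourier u \<xi>))\<^sup>2)"
    proof (intro square_integrable_integrable square_integrable_mult_bounded[where B=2] square_integrable_fourier u')
      show "norm (?e \<xi> - 1) \<le> 2" for \<xi> using norm_triangle_ineq4[of "?e \<xi>" 1] by simp
    qed measurable
    show "integrable lborel (\<lambda>\<xi>. (2 / a * norm y) * (cmod (weighted u \<xi>))\<^sup>2)"
      by (intro integrable_mult_right square_integrable_integrable u')
    fix \<xi> :: 'a
    have "a * norm \<xi> \<le> A \<xi>" using A_lower[of \<xi>] a_pos by (simp add: distrib_left)
    then have n: "norm \<xi> \<le> A \<xi> / a" using a_pos by (simp add: field_simps)
    have "(cmod (?e \<xi> - 1))\<^sup>2 \<le> 2 * \<bar>y \<bullet> \<xi>\<bar>" by (rule cmod_exp_minus_1_square_le)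
    also have "\<dots> \<le> 2 * (norm y * (A \<xi> / a))"
      by (intro mult_left_mono order_trans[OF Cauchy_Schwarz_ineq2] n) auto
    finally have "(cmod (?e \<xi> - 1))\<^sup>2 * (cmod (fourier u \<xi>))\<^sup>2 \<le> 2 * (norm y * (A \<xi> / a)) * (cmod (fourier u \<xi>))\<^sup>2"
      by (rule mult_right_mono) simp
    then show "(norm ((?e \<xi> - 1) * fourier u \<xi>))\<^sup>2 \<le> (2 / a * norm y) * (cmod (weighted u \<xi>))\<^sup>2"
      by (simp add: norm_weighted_square norm_mult power_mult_distrib)
  qed
  also have "\<dots> = 2 / a * form u u * norm y" by (simp add: form_self mean_square_def)
  finally show ?thesis .
qed

text \<open>
  The truncated weight is bounded, so weak convergence of the transforms passes to it;
  boundedness of the forms controls the high frequencies.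
\<close>

lemma form_weak_limit:
  fixes u :: "nat \<Rightarrow> 'a \<Rightarrow> real"
  assumes u: "\<And>k. u k \<in> sobolev (1 / 2)" and K: "\<And>k. form (u k) (u k) \<le> K"
    and u': "square_integrable u'"
    and weak: "\<And>f. square_integrable f \<Longrightarrow> (\<lambda>k. LINT x|lborel. u k x * f x) \<longlonglongrightarrow> (LINT x|lborel. u' x * f x)"
  shows "u' \<in> sobolev (1 / 2)" and "\<And>v. v \<in> sobolev (1 / 2) \<Longrightarrow> (\<lambda>k. form (u k) v) \<longlonglongrightarrow> form u' v"
proof -
  let ?c = "\<lambda>R \<xi>. complex_of_real (indicator (ball 0 R) \<xi>)"
  note sq = sobolev_square_integrable[OF u]
  have Am: "A \<xi> \<le> \<bar>b\<bar> * (1 + R)" if "\<xi> \<in> ball 0 R" for \<xi> R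
  proof -
    have "A \<xi> \<le> \<bar>b\<bar> * (1 + (norm \<xi>)\<^sup>2) powr (1 / 2)"
      by (rule order_trans[OF A_upper mult_right_mono]) auto
    also have "\<dots> \<le> \<bar>b\<bar> * (1 + R)"
      using that powr_half_le[of \<xi>] by (intro mult_left_mono) auto
    finally show ?thesis .
  qed
  have [measurable]: "ball (0::'a) R \<in> sets borel" for R by simp
  have bdd: "norm (complex_of_real (sqrt (A \<xi>)) * ?c R \<xi>) \<le> sqrt (\<bar>b\<bar> * (1 + \<bar>R\<bar>))" for \<xi> R
  proof (cases "\<xi> \<in> ball 0 R")
    case True
    then have "\<xi> \<in> ball 0 \<bar>R\<bar>" by auto
    with True show ?thesis using Am[of \<xi> "\<bar>R\<bar>"] A_nonneg[of \<xi>] by (simp add: norm_mult)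
  qed (simp add: norm_mult)
  have cut: "square_integrable (\<lambda>\<xi>. (complex_of_real (sqrt (A \<xi>)) * ?c R \<xi>) * h \<xi>)" if "square_integrable h" for h R
    by (rule square_integrable_mult_bounded[OF that _ bdd]) measurable
  have cut_lim: "(\<lambda>k. LINT \<xi>|lborel. weighted (u k) \<xi> * (?c R \<xi> * h \<xi>)) \<longlonglongrightarrow> (LINT \<xi>|lborel. weighted u' \<xi> * (?c R \<xi> * h \<xi>))"
    if h: "square_integrable h" for h R
  proof -
    have eq: "weighted w \<xi> * (?c R \<xi> * h \<xi>) = fourier w \<xi> * ((complex_of_real (sqrt (A \<xi>)) * ?c R \<xi>) * h \<xi>)" for w \<xi>
      by (simp add: weighted_def ac_simps)
    show ?thesis unfolding eq by (rule fourier_weak_limit[OF sq u' weak cut[OF h]])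
  qed
  have K0: "0 \<le> K" using form_nonneg[of "u 0"] K[of 0] by linarith
  have W': "square_integrable (\<lambda>\<xi>. ?c R \<xi> * weighted u' \<xi>)" for R
    using cut[OF square_integrable_fourier[OF u'], of R] by (simp add: weighted_def ac_simps)
  have trunc: "mean_square (\<lambda>\<xi>. ?c R \<xi> * weighted u' \<xi>) \<le> K" for R
  proof -
    let ?t = "mean_square (\<lambda>\<xi>. ?c R \<xi> * weighted u' \<xi>)"
    let ?h = "\<lambda>\<xi>. cnj (?c R \<xi> * weighted u' \<xi>)"
    have h: "square_integrable ?h" by (rule square_integrable_cnj[OF W'])
    have idem: "?c R \<xi> * ?h \<xi> = ?h \<xi>" for \<xi> by (simp add: indicator_def)
    have "(\<lambda>k. LINT \<xi>|lborel. weighted (u k) \<xi> * ?h \<xi>) \<longlonglongrightarrow> (LINT \<xi>|lborel. weighted u' \<xi> * ?h \<xi>)"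
      using cut_lim[OF h, of R] by (simp only: idem)
    moreover have "(LINT \<xi>|lborel. weighted u' \<xi> * ?h \<xi>) = complex_of_real ?t"
      unfolding mean_square_def integral_complex_of_real[symmetric]
      by (intro Bochner_Integration.integral_cong refl) (simp add: complex_norm_square indicator_def del: of_real_power)
    ultimately have "(\<lambda>k. norm (LINT \<xi>|lborel. weighted (u k) \<xi> * ?h \<xi>)) \<longlonglongrightarrow> norm (complex_of_real ?t)"
      by (simp only: tendsto_norm)
    moreover have "norm (LINT \<xi>|lborel. weighted (u k) \<xi> * ?h \<xi>) \<le> sqrt K * sqrt ?t" for k
    proof -
      have "norm (LINT \<xi>|lborel. weighted (u k) \<xi> * ?h \<xi>) \<le> sqrt (mean_square (weighted (u k))) * sqrt (mean_square ?h)"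
        by (intro Cauchy_Schwarz_mean_square h weighted_square_integrable u)
      also have "mean_square ?h = ?t" by (simp add: mean_square_def norm_mult)
      also have "sqrt (mean_square (weighted (u k))) * sqrt ?t \<le> sqrt K * sqrt ?t"
        using K[of k] by (intro mult_right_mono real_sqrt_le_mono) (auto simp: form_self)
      finally show ?thesis .
    qed
    ultimately have "norm (complex_of_real ?t) \<le> sqrt K * sqrt ?t"
      by (intro LIMSEQ_le_const2) auto
    \<comment> \<open>Tested with itself, the truncated limit has mean square \<open>t\<close> at most \<open>sqrt K * sqrt t\<close>.\<close>
    then have "?t \<le> sqrt (K * ?t)" by (simp add: real_sqrt_mult)
    then have "?t\<^sup>2 \<le> K * ?t"
      using K0 by (metis mean_square_nonneg mult_nonneg_nonneg real_sqrt_ge_0_iff real_sqrt_pow2 power_mono)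
    then show ?thesis
      using K0 mean_square_nonneg[of "\<lambda>\<xi>. ?c R \<xi> * weighted u' \<xi>"]
      by (cases "?t = 0") (auto simp: power2_eq_square mult_le_cancel_right)
  qed
  have wm[measurable]: "weighted u' \<in> borel_measurable borel" by (rule weighted_borel[OF u'])
  have pt: "AE \<xi> in lborel. (\<lambda>k. (norm (?c (real k) \<xi> * weighted u' \<xi>))\<^sup>2) \<longlonglongrightarrow> (norm (weighted u' \<xi>))\<^sup>2"
  proof (rule AE_I2, rule tendsto_eventually)
    fix \<xi> :: 'a
    have "eventually (\<lambda>k. norm \<xi> < real k) sequentially"
      using filterlim_real_sequentially by (simp add: filterlim_at_top_dense)
    then show "eventually (\<lambda>k. (norm (?c (real k) \<xi> * weighted u' \<xi>))\<^sup>2 = (norm (weighted u' \<xi>))\<^sup>2) sequentially"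
      by eventually_elim simp
  qed
  have i: "integrable lborel (\<lambda>\<xi>. (norm (?c (real k) \<xi> * weighted u' \<xi>))\<^sup>2)" for k
    by (rule square_integrable_integrable[OF W'])
  have le: "eventually (\<lambda>k. (LINT \<xi>|lborel. (norm (?c (real k) \<xi> * weighted u' \<xi>))\<^sup>2) \<le> K) sequentially"
    using trunc by (intro always_eventually) (simp add: mean_square_def)
  have fin: "integrable lborel (\<lambda>\<xi>. (norm (weighted u' \<xi>))\<^sup>2)" "(LINT \<xi>|lborel. (norm (weighted u' \<xi>))\<^sup>2) \<le> K"
    using Fatou_bound[OF i _ _ _ pt le K0] by auto
  then show H: "u' \<in> sobolev (1 / 2)" unfolding sobolev_half_iff square_integrable_def using u' by (auto simp: square_integrable_def)
  fix v :: "'a \<Rightarrow> real" assume v: "v \<in> sobolev (1 / 2)"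
  let ?h = "\<lambda>\<xi>. cnj (weighted v \<xi>)"
  have h: "square_integrable ?h" by (intro square_integrable_cnj weighted_square_integrable v)
  have "(\<lambda>k. LINT \<xi>|lborel. weighted (u k) \<xi> * ?h \<xi>) \<longlonglongrightarrow> (LINT \<xi>|lborel. weighted u' \<xi> * ?h \<xi>)"
  proof (rule weak_limit_closed[OF weighted_square_integrable[OF u] weighted_square_integrable[OF H] h, where B=K])
    show "mean_square (weighted (u k)) \<le> K" for k using K[of k] by (simp add: form_self)
    show "mean_square (weighted u') \<le> K" using fin(2) by (simp add: mean_square_def)
    fix e :: real assume e: "e > 0"
    have "((\<lambda>R. mean_square (\<lambda>\<xi>. indicator (ball 0 R) \<xi> * ?h \<xi> - ?h \<xi>)) \<longlongrightarrow> 0) at_top"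
      by (rule truncation_tendsto[OF h])
    then have "eventually (\<lambda>R. mean_square (\<lambda>\<xi>. indicator (ball 0 R) \<xi> * ?h \<xi> - ?h \<xi>) < e) at_top"
      using e by (rule order_tendstoD)
    then obtain R where R: "mean_square (\<lambda>\<xi>. indicator (ball 0 R) \<xi> * ?h \<xi> - ?h \<xi>) < e"
      by (auto simp: eventually_at_top_linorder)
    have ind: "indicator (ball 0 R) \<xi> = ?c R \<xi>" for \<xi> by (simp add: indicator_def)
    show "\<exists>h'. square_integrable h' \<and> mean_square (\<lambda>x. ?h x - h' x) < e \<and>
      (\<lambda>k. LINT x|lborel. weighted (u k) x * h' x) \<longlonglongrightarrow> (LINT x|lborel. weighted u' x * h' x)"
    proof (intro exI[of _ "\<lambda>\<xi>. ?c R \<xi> * ?h \<xi>"] conjI cut_lim h)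
      show "square_integrable (\<lambda>\<xi>. ?c R \<xi> * ?h \<xi>)"
        by (rule square_integrable_mult_bounded[OF h, where B=1]) (auto simp: indicator_def)
      show "mean_square (\<lambda>\<xi>. ?h \<xi> - ?c R \<xi> * ?h \<xi>) < e"
        using R unfolding ind by (subst mean_square_minus_commute)
    qed
  qed
  then show "(\<lambda>k. form (u k) v) \<longlonglongrightarrow> form u' v" unfolding form_eq by (rule tendsto_Re)
qed

end

section \<open>Averages over balls\<close>

text \<open>
  The \<open>L2\<close> modulus of continuity is of order \<open>1/2\<close>. Bounded sets of the Sobolev space of order \<open>1/2\<close> lie in such a class. Unlike the definition by the Fourier
  transform, it is visibly preserved by Lipschitz maps such as truncation of the values.
\<close>

definition half_modulus :: "real \<Rightarrow> ('a::euclidean_space \<Rightarrow> real) set"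
  where "half_modulus K = {u. square_integrable u \<and> mean_square u \<le> K \<and>
    (\<forall>y. mean_square (\<lambda>x. u (x + y) - u x) \<le> K * norm y)}"

definition ball_average :: "real \<Rightarrow> ('a::euclidean_space \<Rightarrow> real) \<Rightarrow> 'a \<Rightarrow> real"
  where "ball_average r u x = (LINT z|lborel. indicator (ball 0 r) z * u (x + z)) / measure lborel (ball (0::'a) r)"

lemma half_modulusD:
  assumes "u \<in> half_modulus K"
  shows "square_integrable u" "mean_square u \<le> K" "mean_square (\<lambda>x. u (x + y) - u x) \<le> K * norm y" "0 \<le> K"
    "u \<in> borel_measurable borel"
  using assms order_trans[OF mean_square_nonneg, of u K] by (auto simp: half_modulus_def square_integrable_borel)

lemma ball_borel [measurable]: "ball (c::'a::euclidean_space) r \<in> sets borel"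
  by simp

lemma measure_ball_eq:
  "r \<ge> 0 \<Longrightarrow> measure lborel (ball (0::'a::euclidean_space) r) = unit_ball_vol (real DIM('a)) * r ^ DIM('a)"
  by (rule content_ball)

lemma measure_ball_pos: "r > 0 \<Longrightarrow> 0 < measure lborel (ball (0::'a::euclidean_space) r)"
  by (simp add: measure_ball_eq)

lemma integrable_indicator_ball: "integrable lborel (indicator (ball (0::'a::euclidean_space) r) :: 'a \<Rightarrow> real)"
  by (intro integrable_real_indicator emeasure_lborel_ball_finite) simp

lemma square_integrable_ball: "square_integrable (indicator (ball (0::'a::euclidean_space) r) :: 'a \<Rightarrow> real)"
proof (rule square_integrable_bound[OF _ integrable_indicator_ball[of r]])
  show "(indicator (ball (0::'a) r) :: 'a \<Rightarrow> real) \<in> borel_measurable borel"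
    by (intro borel_measurable_indicator) simp
qed (simp add: indicator_def)

lemma mean_square_ball: "mean_square (indicator (ball (0::'a::euclidean_space) r) :: 'a \<Rightarrow> real) = measure lborel (ball (0::'a) r)"
proof -
  have "(\<lambda>x::'a. (norm (indicator (ball 0 r) x :: real))\<^sup>2) = indicator (ball 0 r)"
    by (simp add: fun_eq_iff indicator_def)
  then show ?thesis by (simp add: mean_square_def)
qed

lemma square_integrable_shift:
  fixes u :: "'a::euclidean_space \<Rightarrow> real"
  shows "square_integrable u \<Longrightarrow> square_integrable (\<lambda>z. u (x + z))"
  using square_integrable_translate[of u x] by (simp add: add.commute)

lemma ball_product_integrable:
  fixes u :: "'a::euclidean_space \<Rightarrow> real"
  shows "square_integrable u \<Longrightarrow> integrable lborel (\<lambda>z. indicator (ball 0 r) z * u (x + z))"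
  by (intro square_integrable_times square_integrable_ball square_integrable_shift)

lemma ball_average_measurable [measurable]:
  assumes [measurable]: "u \<in> borel_measurable borel"
  shows "ball_average r u \<in> borel_measurable borel"
  unfolding ball_average_def by measurable

lemma norm_ball_integral_square_le:
  fixes f :: "'a::euclidean_space \<Rightarrow> real"
  assumes f: "square_integrable f"
  shows "(LINT z|lborel. indicator (ball 0 r) z * f z)\<^sup>2 \<le> measure lborel (ball (0::'a) r) * mean_square f"
proof -
  have "\<bar>LINT z|lborel. indicator (ball 0 r) z * f z\<bar> \<le> sqrt (measure lborel (ball (0::'a) r)) * sqrt (mean_square f)"
    using Cauchy_Schwarz_mean_square[OF square_integrable_ball[of r] f] by (simp add: mean_square_ball)
  then have "\<bar>LINT z|lborel. indicator (ball 0 r) z * f z\<bar>\<^sup>2 \<le> (sqrt (measure lborel (ball (0::'a) r)) * sqrt (mean_square f))\<^sup>2"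
    by (intro power_mono) auto
  then show ?thesis by (simp add: power_mult_distrib)
qed

lemma ball_average_diff_square_le:
  fixes u :: "'a::euclidean_space \<Rightarrow> real"
  assumes u: "square_integrable u" and r: "r > 0"
  shows "ennreal ((u x - ball_average r u x)\<^sup>2)
    \<le> ennreal (1 / measure lborel (ball (0::'a) r)) * (\<integral>\<^sup>+z. indicator (ball 0 r) z * ennreal ((u (x + z) - u x)\<^sup>2) \<partial>lborel)"
proof -
  let ?V = "measure lborel (ball (0::'a) r)"
  let ?i = "indicator (ball (0::'a) r) :: 'a \<Rightarrow> real"
  have V: "?V > 0" by (rule measure_ball_pos[OF r])
  let ?f = "\<lambda>z. ?i z * u (x + z) - ?i z * u x"
  have iu: "square_integrable (\<lambda>z. ?i z * u (x + z))"
    by (intro square_integrable_indicator_ball square_integrable_shift u)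
  have ic: "square_integrable (\<lambda>z. ?i z * u x)"
    using square_integrable_cmult[OF square_integrable_ball[of r], of "u x"] by (simp add: mult.commute)
  have f: "square_integrable ?f" by (rule square_integrable_diff[OF iu ic])
  have idem: "?i z * ?f z = ?f z" for z by (simp add: indicator_def)
  have "(LINT z|lborel. ?f z) = (LINT z|lborel. ?i z * u (x + z)) - (LINT z|lborel. ?i z * u x)"
    by (intro Bochner_Integration.integral_diff ball_product_integrable u integrable_mult_left integrable_indicator_ball)
  also have "(LINT z|lborel. ?i z * u x) = ?V * u x" by simp
  finally have d: "(LINT z|lborel. ?i z * ?f z) = ?V * (ball_average r u x - u x)"
    unfolding idem using V by (simp add: ball_average_def right_diff_distrib)
  have "(?V * (ball_average r u x - u x))\<^sup>2 \<le> ?V * mean_square ?f"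
    using norm_ball_integral_square_le[OF f, of r] unfolding d .
  then have "?V * (?V * (u x - ball_average r u x)\<^sup>2) \<le> ?V * mean_square ?f"
    by (simp add: power_mult_distrib power2_eq_square[of ?V] power2_commute mult.assoc)
  then have "(u x - ball_average r u x)\<^sup>2 \<le> 1 / ?V * mean_square ?f"
    using V by (simp add: field_simps)
  then have "ennreal ((u x - ball_average r u x)\<^sup>2) \<le> ennreal (1 / ?V) * ennreal (mean_square ?f)"
    using V by (subst ennreal_mult[symmetric]) (auto intro: ennreal_leI)
  also have "ennreal (mean_square ?f) = (\<integral>\<^sup>+z. indicator (ball 0 r) z * ennreal ((u (x + z) - u x)\<^sup>2) \<partial>lborel)"
    unfolding nn_integral_mean_square[OF f, symmetric]
    by (intro nn_integral_cong) (simp add: indicator_def)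
  finally show ?thesis .
qed

text \<open>Averaging over a ball costs at most its radius, because every translation by \<open>z\<close> costs \<open>norm z\<close>.\<close>

lemma ball_average_close:
  fixes u :: "'a::euclidean_space \<Rightarrow> real"
  assumes u: "u \<in> half_modulus K" and r: "r > 0"
  shows "square_integrable (\<lambda>x. u x - ball_average r u x)" and "mean_square (\<lambda>x. u x - ball_average r u x) \<le> K * r"
proof -
  note D = half_modulusD[OF u]
  have [measurable]: "u \<in> borel_measurable borel" by (rule D(5))
  let ?V = "measure lborel (ball (0::'a) r)"
  have V: "?V > 0" by (rule measure_ball_pos[OF r])
  have "(\<integral>\<^sup>+x. (\<integral>\<^sup>+z. indicator (ball 0 r) z * ennreal ((u (x + z) - u x)\<^sup>2) \<partial>lborel) \<partial>lborel)
     = (\<integral>\<^sup>+z. (\<integral>\<^sup>+x. indicator (ball (0::'a) r) z * ennreal ((u (x + z) - u x)\<^sup>2) \<partial>lborel) \<partial>lborel)"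
    by (rule lborel_pair.Fubini'[symmetric]) measurable
  also have "\<dots> = (\<integral>\<^sup>+z. indicator (ball (0::'a) r) z * ennreal (mean_square (\<lambda>x. u (x + z) - u x)) \<partial>lborel)"
  proof (intro nn_integral_cong)
    fix z :: 'a
    have "square_integrable (\<lambda>x. u (x + z) - u x)" by (intro square_integrable_diff square_integrable_translate D)
    from nn_integral_mean_square[OF this]
    show "(\<integral>\<^sup>+x. indicator (ball (0::'a) r) z * ennreal ((u (x + z) - u x)\<^sup>2) \<partial>lborel)
      = indicator (ball (0::'a) r) z * ennreal (mean_square (\<lambda>x. u (x + z) - u x))"
      by (simp add: nn_integral_cmult)
  qed
  also have "\<dots> \<le> (\<integral>\<^sup>+z. ennreal (K * r) * indicator (ball (0::'a) r) z \<partial>lborel)"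
  proof (intro nn_integral_mono)
    fix z :: 'a
    show "indicator (ball (0::'a) r) z * ennreal (mean_square (\<lambda>x. u (x + z) - u x)) \<le> ennreal (K * r) * indicator (ball (0::'a) r) z"
    proof (cases "z \<in> ball 0 r")
      case True
      then have "mean_square (\<lambda>x. u (x + z) - u x) \<le> K * r"
        using D(4) by (intro order_trans[OF D(3)] mult_left_mono) auto
      then show ?thesis using True by (simp add: ennreal_leI)
    qed simp
  qed
  also have "\<dots> = ennreal (K * r) * emeasure lborel (ball (0::'a) r)"
    by (simp add: nn_integral_cmult)
  also have "emeasure lborel (ball (0::'a) r) = ennreal ?V"
    using emeasure_lborel_ball_finite[of "0::'a" r] by (intro emeasure_eq_ennreal_measure) auto
  finally have inner: "(\<integral>\<^sup>+x. (\<integral>\<^sup>+z. indicator (ball 0 r) z * ennreal ((u (x + z) - u x)\<^sup>2) \<partial>lborel) \<partial>lborel)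
    \<le> ennreal (K * r) * ennreal ?V" .
  have "(\<integral>\<^sup>+x. ennreal ((u x - ball_average r u x)\<^sup>2) \<partial>lborel)
     \<le> (\<integral>\<^sup>+x. ennreal (1 / ?V) * (\<integral>\<^sup>+z. indicator (ball 0 r) z * ennreal ((u (x + z) - u x)\<^sup>2) \<partial>lborel) \<partial>lborel)"
    by (intro nn_integral_mono ball_average_diff_square_le D(1) r)
  also have "\<dots> = ennreal (1 / ?V) * (\<integral>\<^sup>+x. (\<integral>\<^sup>+z. indicator (ball 0 r) z * ennreal ((u (x + z) - u x)\<^sup>2) \<partial>lborel) \<partial>lborel)"
    by (rule nn_integral_cmult) measurable
  also have "\<dots> \<le> ennreal (1 / ?V) * (ennreal (K * r) * ennreal ?V)"
    by (rule mult_left_mono[OF inner]) simp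
  also have "\<dots> = ennreal (K * r)"
    using V D(4) r by (simp flip: ennreal_mult)
  finally have le: "(\<integral>\<^sup>+x. ennreal ((norm (u x - ball_average r u x))\<^sup>2) \<partial>lborel) \<le> ennreal (K * r)"
    by simp
  have i: "integrable lborel (\<lambda>x. (norm (u x - ball_average r u x))\<^sup>2)"
    by (rule integrableI_nonneg) (use le in \<open>auto intro: le_less_trans\<close>)
  then show "square_integrable (\<lambda>x. u x - ball_average r u x)" by (simp add: square_integrable_def)
  show "mean_square (\<lambda>x. u x - ball_average r u x) \<le> K * r"
    using le D(4) r i unfolding mean_square_def by (simp add: nn_integral_eq_integral)
qed

text \<open>
  Integrated over a ball, this serves in place of the Hoelder inequality; \<open>\<tau>\<close> is chosen according to the level.
\<close>

lemma abs_le_add_powr: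
  fixes t \<tau> p :: real
  assumes "\<tau> > 0" "p \<ge> 1"
  shows "\<bar>t\<bar> \<le> \<tau> + \<bar>t\<bar> powr p * \<tau> powr (1 - p)"
proof (cases "\<bar>t\<bar> \<le> \<tau>")
  case False
  then have "\<bar>t\<bar> powr (1 - p) \<le> \<tau> powr (1 - p)"
    using assms by (intro powr_mono2') auto
  then have "\<bar>t\<bar> powr p * \<bar>t\<bar> powr (1 - p) \<le> \<bar>t\<bar> powr p * \<tau> powr (1 - p)"
    by (intro mult_left_mono) auto
  moreover have "\<bar>t\<bar> powr p * \<bar>t\<bar> powr (1 - p) = \<bar>t\<bar>"
    using False assms by (simp flip: powr_add)
  ultimately show ?thesis using assms by linarith
qed (simp add: add_increasing2)

lemma ball_average_bound_powr:
  fixes u :: "'a::euclidean_space \<Rightarrow> real"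
  assumes u: "square_integrable u" and p: "p \<ge> 1" and N: "integrable lborel (\<lambda>x. \<bar>u x\<bar> powr p)"
    and r: "r > 0" and \<tau>: "\<tau> > 0"
  shows "\<bar>ball_average r u x\<bar> \<le> \<tau> + (LINT x|lborel. \<bar>u x\<bar> powr p) * \<tau> powr (1 - p) / measure lborel (ball (0::'a) r)"
proof -
  let ?V = "measure lborel (ball (0::'a) r)"
  let ?i = "indicator (ball (0::'a) r) :: 'a \<Rightarrow> real"
  have V: "?V > 0" by (rule measure_ball_pos[OF r])
  have [measurable]: "u \<in> borel_measurable borel" by (rule square_integrable_borel[OF u])
  have m: "(\<lambda>x. \<bar>u x\<bar> powr p) \<in> borel_measurable borel" by measurable
  have Nt: "integrable lborel (\<lambda>z. \<bar>u (x + z)\<bar> powr p)"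
    using integrable_translate_iff[OF m, of x] N by (simp add: add.commute)
  have "\<bar>LINT z|lborel. ?i z * u (x + z)\<bar> \<le> (LINT z|lborel. \<bar>?i z * u (x + z)\<bar>)"
    by (rule integral_abs_bound)
  also have "\<dots> \<le> (LINT z|lborel. \<tau> * ?i z + \<tau> powr (1 - p) * \<bar>u (x + z)\<bar> powr p)"
  proof (rule integral_mono)
    show "integrable lborel (\<lambda>z. \<bar>?i z * u (x + z)\<bar>)" by (intro integrable_abs ball_product_integrable u)
    show "integrable lborel (\<lambda>z. \<tau> * ?i z + \<tau> powr (1 - p) * \<bar>u (x + z)\<bar> powr p)"
      by (intro Bochner_Integration.integrable_add integrable_mult_right integrable_indicator_ball Nt)
    show "\<bar>?i z * u (x + z)\<bar> \<le> \<tau> * ?i z + \<tau> powr (1 - p) * \<bar>u (x + z)\<bar> powr p" for z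
      using abs_le_add_powr[OF \<tau> p, of "u (x + z)"] by (auto simp: indicator_def mult.commute)
  qed
  also have "\<dots> = \<tau> * ?V + \<tau> powr (1 - p) * (LINT z|lborel. \<bar>u (x + z)\<bar> powr p)"
    by (subst Bochner_Integration.integral_add)
      (auto intro!: integrable_mult_right integrable_indicator_ball Nt)
  also have "(LINT z|lborel. \<bar>u (x + z)\<bar> powr p) = (LINT x|lborel. \<bar>u x\<bar> powr p)"
    using integral_translate[OF m, of x] by (simp add: add.commute)
  finally have "\<bar>LINT z|lborel. ?i z * u (x + z)\<bar> / ?V \<le> (\<tau> * ?V + \<tau> powr (1 - p) * (LINT x|lborel. \<bar>u x\<bar> powr p)) / ?V"
    using V by (intro divide_right_mono) auto
  then show ?thesis using V by (simp add: ball_average_def abs_divide add_divide_distrib mult.commute)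
qed

lemma ball_average_bound:
  fixes u :: "'a::euclidean_space \<Rightarrow> real"
  assumes u: "u \<in> half_modulus K" and r: "r > 0"
  shows "\<bar>ball_average r u x\<bar> \<le> sqrt (K / measure lborel (ball (0::'a) r))"
proof -
  let ?V = "measure lborel (ball (0::'a) r)"
  have V: "?V > 0" by (rule measure_ball_pos[OF r])
  note D = half_modulusD[OF u]
  have "(LINT z|lborel. indicator (ball 0 r) z * u (x + z))\<^sup>2 \<le> ?V * mean_square (\<lambda>z. u (x + z))"
    by (rule norm_ball_integral_square_le[OF square_integrable_shift[OF D(1)]])
  also have "mean_square (\<lambda>z. u (x + z)) = mean_square u"
    using mean_square_translate[OF D(5), of x] by (simp add: add.commute)
  also have "?V * mean_square u \<le> ?V * K" using D(2) V by (intro mult_left_mono) auto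
  finally have "(ball_average r u x)\<^sup>2 \<le> K / ?V"
    using V by (simp add: ball_average_def power_divide field_simps power2_eq_square)
  then have "sqrt ((ball_average r u x)\<^sup>2) \<le> sqrt (K / ?V)" by (rule real_sqrt_le_mono)
  then show ?thesis by simp
qed

lemma ball_average_equicontinuous:
  fixes u :: "'a::euclidean_space \<Rightarrow> real"
  assumes u: "u \<in> half_modulus K" and r: "r > 0"
  shows "\<bar>ball_average r u x - ball_average r u y\<bar> \<le> sqrt (K * norm (x - y) / measure lborel (ball (0::'a) r))"
proof -
  let ?V = "measure lborel (ball (0::'a) r)"
  have V: "?V > 0" by (rule measure_ball_pos[OF r])
  note D = half_modulusD[OF u]
  have m: "(\<lambda>x. u (x + (x' - y)) - u x) \<in> borel_measurable borel" for x' using D(5) by measurable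
  let ?f = "\<lambda>z. u (x + z) - u (y + z)"
  have f: "square_integrable ?f" by (intro square_integrable_diff square_integrable_shift D)
  have "ball_average r u x - ball_average r u y = (LINT z|lborel. indicator (ball 0 r) z * ?f z) / ?V"
    using ball_product_integrable[OF D(1), of r x] ball_product_integrable[OF D(1), of r y]
    by (simp add: ball_average_def right_diff_distrib diff_divide_distrib)
  then have "(ball_average r u x - ball_average r u y)\<^sup>2 = (LINT z|lborel. indicator (ball 0 r) z * ?f z)\<^sup>2 / ?V\<^sup>2"
    by (simp only: power_divide)
  also have "\<dots> \<le> (?V * mean_square ?f) / ?V\<^sup>2"
    by (intro divide_right_mono norm_ball_integral_square_le f) auto
  also have "mean_square ?f = mean_square (\<lambda>z. u (z + (x - y)) - u z)"
    using mean_square_translate[OF m[of x], of y] by (simp add: algebra_simps)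
  also have "?V * mean_square (\<lambda>z. u (z + (x - y)) - u z) / ?V\<^sup>2 \<le> ?V * (K * norm (x - y)) / ?V\<^sup>2"
    using V by (intro divide_right_mono mult_left_mono D(3)) auto
  also have "\<dots> = K * norm (x - y) / ?V" using V by (simp add: power2_eq_square)
  finally have "sqrt ((ball_average r u x - ball_average r u y)\<^sup>2) \<le> sqrt (K * norm (x - y) / ?V)"
    by (rule real_sqrt_le_mono)
  then show ?thesis by simp
qed

section \<open>Subcritical embedding\<close>

text \<open>
  The radius is chosen such that the average is at most half the level; the level set is then
  contained in the set where the function differs from its average by half the level.
\<close>

lemma level_set_bound:
  fixes u :: "'a::euclidean_space \<Rightarrow> real"
  assumes u: "u \<in> half_modulus K" and p: "p \<ge> 1" and i: "integrable lborel (\<lambda>x. \<bar>u x\<bar> powr p)"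
    and N: "N = (LINT x|lborel. \<bar>u x\<bar> powr p)" "N > 0" and l: "l > 0"
  shows "emeasure lborel {x. l \<le> \<bar>u x\<bar>}
    \<le> ennreal (4 / l\<^sup>2 * (K * (N * (l / 4) powr (- p) / unit_ball_vol (real DIM('a))) powr (1 / real DIM('a))))"
proof -
  let ?v = "unit_ball_vol (real DIM('a))"
  let ?n = "real DIM('a)"
  define \<tau> where "\<tau> = l / 4"
  have \<tau>: "\<tau> > 0" using l by (simp add: \<tau>_def)
  \<comment> \<open>With this radius the volume of the ball is \<open>N * \<tau> powr (- p)\<close>, so both terms of the bound of the average equal \<open>\<tau>\<close>.\<close>
  define r where "r = (N * \<tau> powr (- p) / ?v) powr (1 / ?n)"
  have b: "N * \<tau> powr (- p) / ?v > 0" using N(2) \<tau> by simp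
  have r: "r > 0" unfolding r_def powr_gt_zero using b by linarith
  have "r ^ DIM('a) = r powr ?n" using r by (simp add: powr_realpow)
  also have "\<dots> = N * \<tau> powr (- p) / ?v"
  proof -
    have e1: "1 / ?n * ?n = 1" by simp
    show ?thesis unfolding r_def powr_powr e1 by (rule powr_one[OF less_imp_le[OF b]])
  qed
  finally have rn: "r ^ DIM('a) = N * \<tau> powr (- p) / ?v" .
  have "?v \<noteq> 0" by (metis less_irrefl of_nat_0_le_iff unit_ball_vol_pos)
  then have V: "measure lborel (ball (0::'a) r) = N * \<tau> powr (- p)"
    unfolding measure_ball_eq[OF less_imp_le[OF r]] rn by simp
  note D = half_modulusD[OF u]
  have [measurable]: "u \<in> borel_measurable borel" by (rule D(5))
  have avg: "\<bar>ball_average r u x\<bar> \<le> l / 2" for x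
  proof -
    have "\<bar>ball_average r u x\<bar> \<le> \<tau> + N * \<tau> powr (1 - p) / (N * \<tau> powr (- p))"
      using ball_average_bound_powr[OF D(1) p i r \<tau>, of x] unfolding V N(1)[symmetric] .
    also have "N * \<tau> powr (1 - p) / (N * \<tau> powr (- p)) = \<tau> powr ((1 - p) - (- p))"
      using N(2) by (simp only: powr_diff) simp
    also have "\<dots> = \<tau>" using \<tau> by simp
    finally show ?thesis by (simp add: \<tau>_def)
  qed
  let ?d = "\<lambda>x. (u x - ball_average r u x)\<^sup>2"
  have sub: "indicator {x. l \<le> \<bar>u x\<bar>} x \<le> ennreal (4 / l\<^sup>2) * ennreal (?d x)" for x
  proof (cases "l \<le> \<bar>u x\<bar>")
    case True
    have "l / 2 \<le> \<bar>u x - ball_average r u x\<bar>" using True avg[of x] by linarith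
    then have "(l / 2)\<^sup>2 \<le> \<bar>u x - ball_average r u x\<bar>\<^sup>2" using l by (intro power_mono) auto
    then have "1 \<le> 4 / l\<^sup>2 * ?d x" using l by (simp add: field_simps power2_eq_square)
    then show ?thesis using True by (subst ennreal_mult[symmetric]) (auto simp: ennreal_ge_1)
  qed simp
  have "emeasure lborel {x. l \<le> \<bar>u x\<bar>} = (\<integral>\<^sup>+x. indicator {x. l \<le> \<bar>u x\<bar>} x \<partial>lborel)"
    by (rule nn_integral_indicator[symmetric]) measurable
  also have "\<dots> \<le> (\<integral>\<^sup>+x. ennreal (4 / l\<^sup>2) * ennreal (?d x) \<partial>lborel)"
    by (intro nn_integral_mono sub)
  also have "\<dots> = ennreal (4 / l\<^sup>2) * (\<integral>\<^sup>+x. ennreal (?d x) \<partial>lborel)"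
    by (rule nn_integral_cmult) measurable
  also have "(\<integral>\<^sup>+x. ennreal (?d x) \<partial>lborel) = ennreal (mean_square (\<lambda>x. u x - ball_average r u x))"
    using nn_integral_mean_square[OF ball_average_close(1)[OF u r]] by simp
  also have "ennreal (4 / l\<^sup>2) * \<dots> \<le> ennreal (4 / l\<^sup>2) * ennreal (K * r)"
    by (intro mult_left_mono ennreal_leI ball_average_close(2)[OF u r]) auto
  also have "\<dots> = ennreal (4 / l\<^sup>2 * (K * r))"
    using D(4) r by (simp flip: ennreal_mult)
  finally show ?thesis unfolding r_def \<tau>_def .
qed

text \<open>
  Every value of modulus at least 1 lies in exactly one dyadic shell; values below 1 are
  controlled by the square because \<open>p \<ge> 2\<close>.
\<close>

lemma abs_powr_le_dyadic:
  fixes t p :: real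
  assumes p: "p \<ge> 2"
  shows "ennreal (\<bar>t\<bar> powr p) \<le> ennreal (t\<^sup>2) + (\<Sum>j. ennreal (2 powr (p * (real j + 1))) * indicator {s. 2 ^ j \<le> \<bar>s\<bar>} t)"
    (is "_ \<le> _ + (\<Sum>j. ?f j)")
proof (cases "\<bar>t\<bar> < 1")
  case True
  have "\<bar>t\<bar> powr p \<le> \<bar>t\<bar> powr 2"
    by (rule powr_mono') (use True p in auto)
  also have "\<dots> = t\<^sup>2" by (cases "t = 0") (auto simp: powr_numeral)
  finally show ?thesis by (intro add_increasing2) (auto intro: ennreal_leI)
next
  case False
  obtain m where "\<bar>t\<bar> < 2 ^ m" using real_arch_pow[of 2 "\<bar>t\<bar>"] by auto
  define k where "k = (LEAST m. \<bar>t\<bar> < 2 ^ m)"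
  have k: "\<bar>t\<bar> < 2 ^ k" unfolding k_def by (rule LeastI) fact
  then have "k \<noteq> 0" using False by (cases k) auto
  then obtain j where j: "k = Suc j" by (cases k) auto
  have jl: "2 ^ j \<le> \<bar>t\<bar>" using not_less_Least[of j "\<lambda>m. \<bar>t\<bar> < 2 ^ m"] j unfolding k_def by simp
  have "\<bar>t\<bar> powr p \<le> (2 ^ k) powr p" using k p by (intro powr_mono2) auto
  also have "(2::real) ^ k = 2 powr (real j + 1)" unfolding j by (simp add: powr_add powr_realpow)
  also have "(2 powr (real j + 1)) powr p = 2 powr (p * (real j + 1))" by (simp add: powr_powr mult.commute)
  finally have le: "ennreal (\<bar>t\<bar> powr p) \<le> ?f j" using jl by (simp add: ennreal_leI)
  define g where "g = ?f"
  have "sum g {j} \<le> suminf g" by (rule sum_le_suminf) auto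
  then have "g j \<le> suminf g" by simp
  then have "?f j \<le> suminf ?f" unfolding g_def .
  with le show ?thesis by (intro add_increasing) (auto intro: order_trans)
qed

text \<open>
  Summing the level set bounds over dyadic levels gives a geometric series with ratio
  \<open>2 powr (p - 2 - p / n)\<close>, where \<open>n\<close> is the dimension. The ratio is below 1 exactly for subcritical \<open>p\<close>.
\<close>

lemma powr_bound_self:
  fixes p :: real
  assumes p: "2 \<le> p" "p < 2 + p / real DIM('a::euclidean_space)"
  shows "\<exists>D\<ge>0. \<forall>K. \<forall>u\<in>half_modulus K. \<forall>N. integrable lborel (\<lambda>x::'a. \<bar>u x\<bar> powr p) \<longrightarrow>
    N = (LINT x|lborel. \<bar>u x\<bar> powr p) \<longrightarrow> N > 0 \<longrightarrow> N \<le> K + D * K * N powr (1 / real DIM('a))"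
proof -
  let ?v = "unit_ball_vol (real DIM('a))"
  define e where "e = 1 / real DIM('a)"
  define \<theta> where "\<theta> = 2 powr (p - 2 - p * e)"
  have \<theta>: "0 < \<theta>" "\<theta> < 1" using p by (auto simp: \<theta>_def e_def powr_less_one)
  define M where "M = 2 powr p * 4 * (1 / ?v) powr e * 4 powr (p * e)"
  have M: "M \<ge> 0" by (simp add: M_def)
  show ?thesis
  proof (intro exI[of _ "M / (1 - \<theta>)"] conjI allI ballI impI)
    show "0 \<le> M / (1 - \<theta>)" using M \<theta> by simp
    fix K u N assume u: "u \<in> half_modulus K" and i: "integrable lborel (\<lambda>x::'a. \<bar>u x\<bar> powr p)"
      and N: "N = (LINT x|lborel. \<bar>u x\<bar> powr p)" "N > 0"
    note D = half_modulusD[OF u]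
    have [measurable]: "u \<in> borel_measurable borel" by (rule D(5))
    have level: "ennreal (2 powr (p * (real j + 1))) * emeasure lborel {x. 2 ^ j \<le> \<bar>u x\<bar>}
      \<le> ennreal (M * K * N powr e * \<theta> ^ j)" for j
    proof -
      define x where "x = (2::real) ^ j"
      have x: "x > 0" "x = 2 powr real j" by (auto simp: x_def powr_realpow)
      have "(N * (x / 4) powr (- p) / ?v) powr e = N powr e * (1 / ?v) powr e * ((x / 4) powr (- p)) powr e"
        using N(2) x(1) by (simp add: powr_mult powr_divide)
      also have "((x / 4) powr (- p)) powr e = 4 powr (p * e) * x powr (- (p * e))"
        using x(1) by (simp add: powr_powr powr_divide powr_minus field_simps)
      finally have 1: "(N * (x / 4) powr (- p) / ?v) powr e = N powr e * (1 / ?v) powr e * (4 powr (p * e) * x powr (- (p * e)))" .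
      have 2: "2 powr (p * (real j + 1)) = 2 powr p * x powr p"
        unfolding x(2) powr_powr by (simp add: powr_add[symmetric] algebra_simps)
      have 3: "4 / x\<^sup>2 = 4 * x powr (- 2)"
        using x(1) by (simp add: powr_minus powr_numeral divide_inverse)
      have 4: "x powr p * x powr (- 2) * x powr (- (p * e)) = \<theta> ^ j"
      proof -
        have "x powr p * x powr (- 2) * x powr (- (p * e)) = x powr (p - 2 - p * e)"
          by (simp flip: powr_add)
        also have "\<dots> = \<theta> powr real j" unfolding x(2) \<theta>_def powr_powr by (simp add: mult.commute)
        also have "\<dots> = \<theta> ^ j" using \<theta> by (simp add: powr_realpow)
        finally show ?thesis .
      qed
      have "ennreal (2 powr (p * (real j + 1))) * emeasure lborel {x. 2 ^ j \<le> \<bar>u x\<bar>}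
        \<le> ennreal (2 powr (p * (real j + 1))) * ennreal (4 / x\<^sup>2 * (K * (N * (x / 4) powr (- p) / ?v) powr e))"
        unfolding x_def e_def using p by (intro mult_left_mono level_set_bound[OF u _ i N]) auto
      also have "\<dots> = ennreal (2 powr (p * (real j + 1)) * (4 / x\<^sup>2 * (K * (N * (x / 4) powr (- p) / ?v) powr e)))"
        using D(4) by (intro ennreal_mult[symmetric]) auto
      also have "2 powr (p * (real j + 1)) * (4 / x\<^sup>2 * (K * (N * (x / 4) powr (- p) / ?v) powr e))
        = M * K * N powr e * (x powr p * x powr (- 2) * x powr (- (p * e)))"
        unfolding 1 2 3 M_def by (simp only: ac_simps)
      finally show ?thesis unfolding 4 .
    qed
    have "ennreal N = (\<integral>\<^sup>+x. ennreal (\<bar>u x\<bar> powr p) \<partial>lborel)"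
      unfolding N(1) by (rule nn_integral_eq_integral[symmetric]) (use i in auto)
    also have "\<dots> \<le> (\<integral>\<^sup>+x. ennreal ((u x)\<^sup>2) + (\<Sum>j. ennreal (2 powr (p * (real j + 1))) * indicator {s. 2 ^ j \<le> \<bar>s\<bar>} (u x)) \<partial>lborel)"
      by (intro nn_integral_mono abs_powr_le_dyadic p)
    also have "\<dots> = (\<integral>\<^sup>+x. ennreal ((u x)\<^sup>2) \<partial>lborel) + (\<integral>\<^sup>+x. (\<Sum>j. ennreal (2 powr (p * (real j + 1))) * indicator {s. 2 ^ j \<le> \<bar>s\<bar>} (u x)) \<partial>lborel)"
      by (rule nn_integral_add) measurable
    also have "(\<integral>\<^sup>+x. (\<Sum>j. ennreal (2 powr (p * (real j + 1))) * indicator {s. 2 ^ j \<le> \<bar>s\<bar>} (u x)) \<partial>lborel)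
      = (\<Sum>j. \<integral>\<^sup>+x. ennreal (2 powr (p * (real j + 1))) * indicator {s. 2 ^ j \<le> \<bar>s\<bar>} (u x) \<partial>lborel)"
      by (rule nn_integral_suminf) measurable
    also have "\<dots> = (\<Sum>j. ennreal (2 powr (p * (real j + 1))) * emeasure lborel {x. 2 ^ j \<le> \<bar>u x\<bar>})"
    proof (intro suminf_cong)
      fix j
      have "(\<integral>\<^sup>+x. ennreal (2 powr (p * (real j + 1))) * indicator {s. 2 ^ j \<le> \<bar>s\<bar>} (u x) \<partial>lborel)
        = (\<integral>\<^sup>+x. ennreal (2 powr (p * (real j + 1))) * indicator {x. 2 ^ j \<le> \<bar>u x\<bar>} x \<partial>lborel)"
        by (intro nn_integral_cong) (simp add: indicator_def)
      also have "\<dots> = ennreal (2 powr (p * (real j + 1))) * emeasure lborel {x. 2 ^ j \<le> \<bar>u x\<bar>}"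
        by (rule nn_integral_cmult_indicator) measurable
      finally show "(\<integral>\<^sup>+x. ennreal (2 powr (p * (real j + 1))) * indicator {s. 2 ^ j \<le> \<bar>s\<bar>} (u x) \<partial>lborel)
        = ennreal (2 powr (p * (real j + 1))) * emeasure lborel {x. 2 ^ j \<le> \<bar>u x\<bar>}" .
    qed
    also have "\<dots> \<le> (\<Sum>j. ennreal (M * K * N powr e * \<theta> ^ j))"
      by (intro suminf_le level) auto
    also have "\<dots> = ennreal (\<Sum>j. M * K * N powr e * \<theta> ^ j)"
      using M D(4) \<theta> by (intro suminf_ennreal2) (auto intro!: summable_mult summable_geometric)
    also have "(\<Sum>j. M * K * N powr e * \<theta> ^ j) = M * K * N powr e * (1 / (1 - \<theta>))"
      using \<theta> by (subst suminf_mult) (auto simp: suminf_geometric intro!: summable_geometric)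
    also have "(\<integral>\<^sup>+x. ennreal ((u x)\<^sup>2) \<partial>lborel) = ennreal (mean_square u)"
      using nn_integral_mean_square[OF D(1)] by simp
    also have "ennreal (mean_square u) + ennreal (M * K * N powr e * (1 / (1 - \<theta>)))
      = ennreal (mean_square u + M * K * N powr e * (1 / (1 - \<theta>)))"
      using M D(4) \<theta> by (intro ennreal_plus[symmetric]) auto
    finally have "ennreal N \<le> ennreal (mean_square u + M * K * N powr e * (1 / (1 - \<theta>)))"
      by (simp add: add_left_mono)
    then have "N \<le> mean_square u + M * K * N powr e * (1 / (1 - \<theta>))"
      using M D(4) \<theta> by (subst (asm) ennreal_le_iff) auto
    then show "N \<le> K + M / (1 - \<theta>) * K * N powr (1 / real DIM('a))"
      using D(2) by (simp add: e_def mult.assoc mult.commute mult.left_commute)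
  qed
qed

lemma half_modulus_clamp:
  assumes u: "u \<in> half_modulus K" and T: "T \<ge> 0"
  shows "(\<lambda>x. max (- T) (min T (u x))) \<in> half_modulus K"
proof -
  note D = half_modulusD[OF u]
  have [measurable]: "u \<in> borel_measurable borel" by (rule D(5))
  let ?c = "\<lambda>x. max (- T) (min T (u x))"
  have le: "(norm (?c x))\<^sup>2 \<le> (norm (u x))\<^sup>2" for x
    using T by (intro power_mono) (auto simp: max_def min_def)
  have le2: "(norm (?c x - ?c y))\<^sup>2 \<le> (norm (u x - u y))\<^sup>2" for x y
    using T by (intro power_mono) (auto simp: max_def min_def abs_if)
  have c: "square_integrable ?c"
    by (rule square_integrable_bound[OF _ square_integrable_integrable[OF D(1)]]) (use le in auto)
  have "mean_square ?c \<le> mean_square u"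
    unfolding mean_square_def by (intro integral_mono square_integrable_integrable c D le)
  moreover have "mean_square (\<lambda>x. ?c (x + y) - ?c x) \<le> mean_square (\<lambda>x. u (x + y) - u x)" for y
    unfolding mean_square_def
    by (intro integral_mono square_integrable_integrable square_integrable_diff square_integrable_translate c D le2)
  ultimately show ?thesis using c D order_trans unfolding half_modulus_def by blast
qed

text \<open>
  The bound of the power integral by its own root gives an absolute bound once the integral is
  known to be finite, which holds for the truncations of the function.
\<close>

lemma half_modulus_embedding:
  fixes p :: real
  assumes n: "DIM('a::euclidean_space) \<ge> 2" and p: "2 \<le> p" "p < 2 + p / real DIM('a)"
  shows "\<exists>B\<ge>0. \<forall>u\<in>half_modulus K. integrable lborel (\<lambda>x::'a. \<bar>u x\<bar> powr p) \<and> (LINT x|lborel. \<bar>u x\<bar> powr p) \<le> B"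
proof -
  obtain D where D: "D \<ge> 0" "\<And>K u N. u \<in> half_modulus K \<Longrightarrow> integrable lborel (\<lambda>x::'a. \<bar>u x\<bar> powr p) \<Longrightarrow>
    N = (LINT x|lborel. \<bar>u x\<bar> powr p) \<Longrightarrow> N > 0 \<Longrightarrow> N \<le> K + D * K * N powr (1 / real DIM('a))"
    using powr_bound_self[where 'a='a, OF p] by metis
  define B where "B = 1 + (K + D * K)\<^sup>2"
  have fin: "(LINT x|lborel. \<bar>u x\<bar> powr p) \<le> B"
    if u: "u \<in> half_modulus K" and i: "integrable lborel (\<lambda>x::'a. \<bar>u x\<bar> powr p)" for u
  proof -
    define N where "N = (LINT x|lborel. \<bar>u x\<bar> powr p)"
    have K: "K \<ge> 0" using half_modulusD[OF u] by simp
    show ?thesis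
    proof (cases "N \<le> 1")
      case True then show ?thesis by (simp add: N_def B_def add_increasing2)
    next
      case False
      then have N1: "N \<ge> 1" by simp
      have "N powr (1 / real DIM('a)) \<le> N powr (1 / 2)"
        using n N1 by (intro powr_mono) (auto simp: field_simps)
      \<comment> \<open>In dimension at least 2 the right side grows at most like the square root of \<open>N\<close>.\<close>
      then have root: "N powr (1 / real DIM('a)) \<le> sqrt N" using N1 by (simp add: powr_half_sqrt)
      have "N \<le> K + D * K * N powr (1 / real DIM('a))"
        using N1 by (intro D(2)[OF u i]) (auto simp: N_def)
      also have "\<dots> \<le> K * sqrt N + D * K * sqrt N"
      proof (rule add_mono)
        show "K \<le> K * sqrt N" using mult_left_mono[of 1 "sqrt N" K] K N1 by simp
        show "D * K * N powr (1 / real DIM('a)) \<le> D * K * sqrt N"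
          using root K D(1) by (intro mult_left_mono) auto
      qed
      also have "\<dots> = (K + D * K) * sqrt N" by (simp add: distrib_right)
      finally have "sqrt N * sqrt N \<le> (K + D * K) * sqrt N" using N1 by simp
      then have "sqrt N \<le> K + D * K" 
        by (rule mult_le_cancel_right_pos[THEN iffD1, rotated]) (use N1 in simp)
      then have "(sqrt N)\<^sup>2 \<le> (K + D * K)\<^sup>2" using N1 by (intro power_mono) auto
      then show ?thesis using N1 by (simp add: B_def N_def)
    qed
  qed
  have "integrable lborel (\<lambda>x::'a. \<bar>u x\<bar> powr p)" if u: "u \<in> half_modulus K" for u
  proof -
    note U = half_modulusD[OF u]
    have [measurable]: "u \<in> borel_measurable borel" by (rule U(5))
    let ?c = "\<lambda>k x. max (- real k) (min (real k) (u x))"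
    have c: "?c k \<in> half_modulus K" for k by (rule half_modulus_clamp[OF u]) simp
    have ci: "integrable lborel (\<lambda>x. \<bar>?c k x\<bar> powr p)" for k
    proof (rule Bochner_Integration.integrable_bound)
      show "integrable lborel (\<lambda>x. real k powr (p - 2) * (norm (?c k x))\<^sup>2)"
        by (intro integrable_mult_right square_integrable_integrable half_modulusD(1)[OF c])
      show "AE x in lborel. norm (\<bar>?c k x\<bar> powr p) \<le> norm (real k powr (p - 2) * (norm (?c k x))\<^sup>2)"
      proof (rule AE_I2)
        fix x
        have le: "\<bar>?c k x\<bar> \<le> real k" by (auto simp: max_def min_def)
        have "\<bar>?c k x\<bar> powr p = \<bar>?c k x\<bar> powr (p - 2) * \<bar>?c k x\<bar> powr 2"
          by (simp only: powr_add[symmetric]) simp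
        also have "\<dots> \<le> real k powr (p - 2) * \<bar>?c k x\<bar> powr 2"
          using p le by (intro mult_right_mono powr_mono2) auto
        also have "\<bar>?c k x\<bar> powr 2 = (norm (?c k x))\<^sup>2" by (cases "?c k x = 0") (auto simp: powr_numeral)
        finally show "norm (\<bar>?c k x\<bar> powr p) \<le> norm (real k powr (p - 2) * (norm (?c k x))\<^sup>2)" by (simp add: abs_mult)
      qed
    qed measurable
    have lim: "AE x in lborel. (\<lambda>k. \<bar>?c k x\<bar> powr p) \<longlonglongrightarrow> \<bar>u x\<bar> powr p"
    proof (rule AE_I2, rule tendsto_eventually)
      fix x :: 'a
      have "eventually (\<lambda>k. \<bar>u x\<bar> < real k) sequentially"
        using filterlim_real_sequentially by (simp add: filterlim_at_top_dense)
      then show "eventually (\<lambda>k. \<bar>?c k x\<bar> powr p = \<bar>u x\<bar> powr p) sequentially"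
        by eventually_elim (auto simp: max_def min_def)
    qed
    have bd: "eventually (\<lambda>k. (LINT x|lborel. \<bar>?c k x\<bar> powr p) \<le> B) sequentially"
      by (intro always_eventually allI fin c ci)
    show ?thesis
      by (rule Fatou_bound(1)[OF ci _ _ _ lim bd]) (auto simp: B_def add_increasing)
  qed
  with fin show ?thesis by (intro exI[of _ B]) (auto simp: B_def add_increasing)
qed


section \<open>Non-vanishing\<close>

text \<open>
  If all averages over balls of radius \<open>r\<close> are below \<open>\<delta>\<close>, then the part of the integral over
  \<open>\<bar>u\<bar> \<le> 2 * \<delta>\<close> is small because \<open>p > 2\<close>, the part over \<open>\<bar>u\<bar> > T\<close> because a slightly larger power
  is still integrable, and the part in between because \<open>u\<close> differs there from its average by \<open>\<delta>\<close>.
\<close>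

lemma half_modulus_nonvanishing:
  fixes p :: real
  assumes n: "DIM('a::euclidean_space) \<ge> 2" and p: "2 < p" "p < 2 * real DIM('a) / (real DIM('a) - 1)"
    and K: "0 \<le> K"
  shows "\<exists>r>0. \<exists>\<delta>>0. \<forall>u\<in>half_modulus K. (LINT x|lborel. \<bar>u (x::'a)\<bar> powr p) = 1 \<longrightarrow> (\<exists>x. \<delta> \<le> \<bar>ball_average r u x\<bar>)"
proof -
  define q where "q = (p + 2 * real DIM('a) / (real DIM('a) - 1)) / 2"
  have q: "p < q" "q < 2 * real DIM('a) / (real DIM('a) - 1)" using p by (auto simp: q_def)
  have sub: "s < 2 + s / real DIM('a)" if "s < 2 * real DIM('a) / (real DIM('a) - 1)" for s
    using that n by (simp add: field_simps)
  obtain B where B: "B \<ge> 0" "\<And>u. u \<in> half_modulus K \<Longrightarrow> integrable lborel (\<lambda>x::'a. \<bar>u x\<bar> powr q) \<and> (LINT x|lborel. \<bar>u x\<bar> powr q) \<le> B"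
    using half_modulus_embedding[OF n _ sub[OF q(2)], of K] p q by (auto; metis)
  obtain B' where B': "\<And>u. u \<in> half_modulus K \<Longrightarrow> integrable lborel (\<lambda>x::'a. \<bar>u x\<bar> powr p)"
    using half_modulus_embedding[OF n _ sub[OF p(2)], of K] p by (auto; metis)
  \<comment> \<open>The constants make each of the three parts at most 1/4: \<open>T\<close> the part above \<open>T\<close>, \<open>\<delta>\<close> the part below \<open>2 * \<delta>\<close>, and \<open>r\<close> the middle part.\<close>
  define T where "T = (4 * (B + 1)) powr (1 / (q - p))"
  have T: "T > 0" using B(1) by (simp add: T_def)
  have TB: "T powr (p - q) * B \<le> 1/4"
  proof -
    have "T powr (p - q) = (4 * (B + 1)) powr (1 / (q - p) * (p - q))" unfolding T_def powr_powr ..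
    also have "1 / (q - p) * (p - q) = - 1" using q by (simp add: field_simps)
    also have "(4 * (B + 1)) powr (- 1) = 1 / (4 * (B + 1))" using B(1) by (simp add: powr_minus_divide)
    finally have eq: "T powr (p - q) = 1 / (4 * (B + 1))" .
    have "B / (4 * (B + 1)) \<le> 1/4" using B(1) by (simp add: divide_simps)
    then show ?thesis by (simp add: eq)
  qed
  define \<delta> where "\<delta> = (1 / (4 * (K + 1))) powr (1 / (p - 2)) / 2"
  have \<delta>: "\<delta> > 0" using K by (simp add: \<delta>_def)
  have dK: "(2 * \<delta>) powr (p - 2) * K \<le> 1/4"
  proof -
    have "(2 * \<delta>) powr (p - 2) = (1 / (4 * (K + 1))) powr (1 / (p - 2) * (p - 2))"
      unfolding \<delta>_def by (simp add: powr_powr)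
    also have "1 / (p - 2) * (p - 2) = 1" using p by simp
    also have "(1 / (4 * (K + 1))) powr 1 = 1 / (4 * (K + 1))" using K by simp
    finally have eq: "(2 * \<delta>) powr (p - 2) = 1 / (4 * (K + 1))" .
    have "K / (4 * (K + 1)) \<le> 1/4" using K by (simp add: divide_simps)
    then show ?thesis by (simp add: eq)
  qed
  define r where "r = \<delta>\<^sup>2 / (4 * (K + 1) * T powr p)"
  have r: "r > 0" using \<delta> K T by (simp add: r_def)
  have rK: "T powr p / \<delta>\<^sup>2 * (K * r) \<le> 1/4"
  proof -
    have "T powr p / \<delta>\<^sup>2 * (K * r) = K / (4 * (K + 1))"
    proof -
      have gen: "t / d * (K * (d / (4 * c * t))) = K / (4 * c)" if "t \<noteq> 0" "d \<noteq> 0" for t d c :: real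
        using that by simp
      show ?thesis unfolding r_def by (rule gen) (use \<delta> T in auto)
    qed
    also have "\<dots> \<le> 1/4" using K by (simp add: field_simps)
    finally show ?thesis .
  qed
  show ?thesis
  proof (rule exI[of _ r], rule conjI[OF r], rule exI[of _ \<delta>], rule conjI[OF \<delta>], intro ballI impI)
    fix u :: "'a \<Rightarrow> real" assume u: "u \<in> half_modulus K" and one: "(LINT x|lborel. \<bar>u x\<bar> powr p) = 1"
    note U = half_modulusD[OF u]
    show "\<exists>x. \<delta> \<le> \<bar>ball_average r u x\<bar>"
    proof (rule ccontr)
      assume "\<not> ?thesis"
      then have small: "\<bar>ball_average r u x\<bar> < \<delta>" for x by (auto simp: not_le)
      let ?g = "\<lambda>x. (2 * \<delta>) powr (p - 2) * (norm (u x))\<^sup>2 + T powr p / \<delta>\<^sup>2 * (norm (u x - ball_average r u x))\<^sup>2 + T powr (p - q) * \<bar>u x\<bar> powr q"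
      have pt: "\<bar>u x\<bar> powr p \<le> ?g x" for x
      proof -
        define t where "t = \<bar>u x\<bar>"
        have t: "t \<ge> 0" by (simp add: t_def)
        have nn: "0 \<le> (2 * \<delta>) powr (p - 2) * (norm (u x))\<^sup>2" "0 \<le> T powr p / \<delta>\<^sup>2 * (norm (u x - ball_average r u x))\<^sup>2"
          "0 \<le> T powr (p - q) * \<bar>u x\<bar> powr q" by auto
        consider "t \<le> 2 * \<delta>" | "2 * \<delta> < t" "t \<le> T" | "T < t" by linarith
        then show ?thesis
        proof cases
          case 1
          have "t powr p = t powr (p - 2) * t powr 2" by (simp only: powr_add[symmetric]) simp
          also have "\<dots> \<le> (2 * \<delta>) powr (p - 2) * t powr 2"
            using 1 t p by (intro mult_right_mono powr_mono2) auto
          also have "t powr 2 = (norm (u x))\<^sup>2" using t by (cases "t = 0") (auto simp: powr_numeral t_def)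
          finally show ?thesis using nn unfolding t_def[symmetric] by linarith
        next
          case 2
          have "t powr p \<le> T powr p" using 2 t p by (intro powr_mono2) auto
          moreover have "\<delta> \<le> norm (u x - ball_average r u x)" using 2 small[of x] by (simp add: t_def)
          then have "\<delta>\<^sup>2 \<le> (norm (u x - ball_average r u x))\<^sup>2" using \<delta> by (intro power_mono) auto
          then have "T powr p * 1 \<le> T powr p * ((norm (u x - ball_average r u x))\<^sup>2 / \<delta>\<^sup>2)"
            using \<delta> by (intro mult_left_mono) auto
          then have "T powr p \<le> T powr p / \<delta>\<^sup>2 * (norm (u x - ball_average r u x))\<^sup>2" by simp
          ultimately show ?thesis using nn unfolding t_def[symmetric] by linarith
        next
          case 3
          have "t powr p = t powr (p - q) * t powr q" by (simp only: powr_add[symmetric]) simp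
          also have "\<dots> \<le> T powr (p - q) * t powr q"
            using 3 T q by (intro mult_right_mono powr_mono2') auto
          finally show ?thesis using nn unfolding t_def[symmetric] by linarith
        qed
      qed
      note i1 = square_integrable_integrable[OF U(1)] and i2 = square_integrable_integrable[OF ball_average_close(1)[OF u r]]
        and i3 = B(2)[OF u, THEN conjunct1]
      have "1 \<le> (LINT x|lborel. ?g x)"
        unfolding one[symmetric]
        by (intro integral_mono B'[OF u] Bochner_Integration.integrable_add integrable_mult_right i1 i2 i3 pt)
      also have "\<dots> = (2 * \<delta>) powr (p - 2) * mean_square u + T powr p / \<delta>\<^sup>2 * mean_square (\<lambda>x. u x - ball_average r u x)
          + T powr (p - q) * (LINT x|lborel. \<bar>u x\<bar> powr q)"
        unfolding mean_square_def
        by (subst Bochner_Integration.integral_add;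
          (intro Bochner_Integration.integrable_add integrable_mult_right i1 i2 i3)?)+ simp
      also have "\<dots> \<le> (2 * \<delta>) powr (p - 2) * K + T powr p / \<delta>\<^sup>2 * (K * r) + T powr (p - q) * B"
        by (intro add_mono mult_left_mono U(2) ball_average_close(2)[OF u r] B(2)[OF u, THEN conjunct2]) auto
      also have "\<dots> \<le> 1/4 + 1/4 + 1/4" by (intro add_mono dK rK TB)
      finally show False by simp
    qed
  qed
qed

section \<open>Compactness\<close>

text \<open>
  For each radius the averages are uniformly bounded and equicontinuous. A diagonal subsequence converges
  for all the radii \<open>1 / (j + 1)\<close> at the points of a countable dense set, hence everywhere.
\<close>

lemma ball_averages_converge:
  fixes u :: "nat \<Rightarrow> 'a::euclidean_space \<Rightarrow> real"
  assumes u: "\<And>k. u k \<in> half_modulus K"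
  obtains s where "strict_mono (s :: nat \<Rightarrow> nat)"
    "\<And>j x. convergent (\<lambda>k. ball_average (1 / real (Suc j)) (u (s k)) x)"
proof -
  define \<rho> where "\<rho> j = 1 / real (Suc j)" for j
  have \<rho>: "\<rho> j > 0" for j by (simp add: \<rho>_def)
  define V where "V j = measure lborel (ball (0::'a) (\<rho> j))" for j
  have V: "V j > 0" for j unfolding V_def by (rule measure_ball_pos[OF \<rho>])
  have K: "K \<ge> 0" using half_modulusD[OF u[of 0]] by simp
  define c where "c j = sqrt (K / V j) + 1" for j
  have c: "c j > 0" for j using K V[of j] by (simp add: c_def add_nonneg_pos)
  obtain D :: "'a set" where D: "countable D" "\<And>U. open U \<Longrightarrow> U \<noteq> {} \<Longrightarrow> \<exists>d\<in>D. d \<in> U"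
    using countable_dense_setE by blast
  \<comment> \<open>Division by \<open>c j\<close> makes the bound uniform in the radius as well.\<close>
  define f where "f k z = ball_average (\<rho> (snd z)) (u k) (fst z) / c (snd z)" for k and z :: "'a \<times> nat"
  have "norm (f k z) \<le> 1" for k z
  proof -
    have "\<bar>ball_average (\<rho> (snd z)) (u k) (fst z)\<bar> \<le> c (snd z)"
      using ball_average_bound[OF u \<rho>, of "snd z" k "fst z"] unfolding c_def V_def by linarith
    then show ?thesis using c[of "snd z"] by (simp add: f_def)
  qed
  moreover have "countable (D \<times> (UNIV :: nat set))" using D(1) by simp
  ultimately obtain s where s: "strict_mono (s :: nat \<Rightarrow> nat)" "\<And>z. z \<in> D \<times> UNIV \<Longrightarrow> \<exists>l. (\<lambda>n. f (s n) z) \<longlonglongrightarrow> l"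
    using function_convergent_subsequence[of "D \<times> UNIV" f 1] by metis
  have onD: "Cauchy (\<lambda>k. ball_average (\<rho> j) (u (s k)) d)" if d: "d \<in> D" for j d
  proof -
    obtain l where "(\<lambda>n. f (s n) (d, j)) \<longlonglongrightarrow> l" using s(2)[of "(d, j)"] d by auto
    then have "(\<lambda>n. c j * f (s n) (d, j)) \<longlonglongrightarrow> c j * l" by (intro tendsto_intros)
    then have "(\<lambda>k. ball_average (\<rho> j) (u (s k)) d) \<longlonglongrightarrow> c j * l" using c[of j] by (simp add: f_def)
    then show ?thesis by (rule LIMSEQ_imp_Cauchy)
  qed
  have "Cauchy (\<lambda>k. ball_average (\<rho> j) (u (s k)) x)" for j x
  proof (rule CauchyI)
    fix e :: real assume e: "e > 0"
    define h where "h = (e / 4)\<^sup>2 * V j / (K + 1)"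
    have h: "h > 0" using e V[of j] K by (simp add: h_def)
    obtain d where d: "d \<in> D" "d \<in> ball x h" using D(2)[of "ball x h"] h by auto
    have close: "\<bar>ball_average (\<rho> j) (u k) x - ball_average (\<rho> j) (u k) d\<bar> \<le> e / 4" for k
    proof -
      have "K * norm (x - d) \<le> (K + 1) * h"
        using d K by (intro mult_mono) (auto simp: dist_norm)
      then have "K * norm (x - d) / V j \<le> (K + 1) * h / V j" using V[of j] by (intro divide_right_mono) auto
      also have "\<dots> = (e / 4)\<^sup>2" using V[of j] K by (simp add: h_def)
      finally have "sqrt (K * norm (x - d) / V j) \<le> sqrt ((e / 4)\<^sup>2)" by (rule real_sqrt_le_mono)
      then show ?thesis using ball_average_equicontinuous[OF u \<rho>, of j k x d] e by (simp add: V_def)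
    qed
    obtain M where M: "\<And>k l. k \<ge> M \<Longrightarrow> l \<ge> M \<Longrightarrow>
      norm (ball_average (\<rho> j) (u (s k)) d - ball_average (\<rho> j) (u (s l)) d) < e / 2"
      using CauchyD[OF onD[OF d(1), of j], of "e/2"] e by auto
    show "\<exists>M. \<forall>m\<ge>M. \<forall>n\<ge>M. norm (ball_average (\<rho> j) (u (s m)) x - ball_average (\<rho> j) (u (s n)) x) < e"
    proof (intro exI[of _ M] allI impI)
      fix k l assume "M \<le> k" "M \<le> l"
      then show "norm (ball_average (\<rho> j) (u (s k)) x - ball_average (\<rho> j) (u (s l)) x) < e"
        using M[of k l] close[of "s k"] close[of "s l"] unfolding real_norm_def by linarith
    qed
  qed
  then show ?thesis using that[OF s(1)] unfolding \<rho>_def by (simp add: Cauchy_convergent_iff)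
qed

text \<open>
  Averages converge at every point, hence in mean square against the weight; the error of
  averaging is uniformly small. So the weighted sequence is Cauchy in mean square.
\<close>

lemma half_modulus_compact:
  fixes u :: "nat \<Rightarrow> 'a::euclidean_space \<Rightarrow> real"
  assumes u: "\<And>k. u k \<in> half_modulus K"
  obtains s v where "strict_mono (s :: nat \<Rightarrow> nat)" "square_integrable v" "mean_square v \<le> K"
    "AE x in lborel. (\<lambda>k. u (s k) x) \<longlonglongrightarrow> v x"
proof -
  obtain s where s: "strict_mono (s :: nat \<Rightarrow> nat)"
    "\<And>j x. convergent (\<lambda>k. ball_average (1 / real (Suc j)) (u (s k)) x)"
    using ball_averages_converge[of u, OF u] by blast
  have K: "K \<ge> 0" using half_modulusD[OF u[of 0]] by simp
  define w where "w k x = gauss x * u (s k) x" for k x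
  note U = half_modulusD[OF u]
  have um[measurable]: "u k \<in> borel_measurable borel" for k by (rule U(5))
  have gmul: "square_integrable (\<lambda>x. gauss x * f x)" if "square_integrable f" for f :: "'a \<Rightarrow> real"
    by (rule square_integrable_mult_bounded[OF that, where B=1]) auto
  have gle: "mean_square (\<lambda>x. gauss x * f x) \<le> mean_square f" if f: "square_integrable f" for f :: "'a \<Rightarrow> real"
    unfolding mean_square_def
  proof (rule integral_mono[OF square_integrable_integrable[OF gmul[OF f]] square_integrable_integrable[OF f]])
    fix x
    have "\<bar>gauss x\<bar> * \<bar>f x\<bar> \<le> 1 * \<bar>f x\<bar>" by (intro mult_right_mono) auto
    then show "(norm (gauss x * f x))\<^sup>2 \<le> (norm (f x))\<^sup>2" by (intro power_mono) (auto simp: abs_mult)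
  qed
  have w: "square_integrable (w k)" for k unfolding w_def by (rule gmul[OF U(1)])
  have cauchy: "\<exists>N. \<forall>k\<ge>N. \<forall>l\<ge>N. mean_square (\<lambda>x. w k x - w l x) < e" if e: "e > 0" for e
  proof -
    obtain j where j: "1 / real (Suc j) < e / (16 * (K + 1))"
      using nat_approx_posE[of "e / (16 * (K + 1))"] e K by (auto simp: inverse_eq_divide)
    define r where "r = 1 / real (Suc j)"
    have r: "r > 0" by (simp add: r_def)
    have rK: "4 * (K * r) \<le> e / 4"
    proof -
      have "K * r \<le> (K + 1) * (e / (16 * (K + 1)))" using j K r by (intro mult_mono) (auto simp: r_def)
      also have "\<dots> = e / 16"
      proof -
        have "c * (e / (16 * c)) = e / 16" if "c \<noteq> 0" for c :: real using that by simp
        then show ?thesis using K by (metis add_nonneg_pos less_irrefl zero_less_one)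
      qed
      finally show ?thesis by simp
    qed
    define V where "V = measure lborel (ball (0::'a) r)"
    define c where "c = sqrt (K / V)"
    define m where "m x = lim (\<lambda>k. ball_average r (u (s k)) x)" for x
    have mlim: "(\<lambda>k. ball_average r (u (s k)) x) \<longlonglongrightarrow> m x" for x
      using s(2)[of j x] unfolding m_def r_def by (simp add: convergent_LIMSEQ_iff)
    have [measurable]: "m \<in> borel_measurable borel" unfolding m_def by (rule borel_measurable_lim_metric) measurable
    have ab: "\<bar>ball_average r (u k) x\<bar> \<le> c" for k x
      unfolding c_def V_def by (rule ball_average_bound[OF u r])
    have mb: "\<bar>m x\<bar> \<le> c" for x
      by (rule LIMSEQ_le_const2[OF tendsto_rabs[OF mlim]]) (use ab in auto)
    have dle: "(norm (gauss x * ball_average r (u k) x - gauss x * m x))\<^sup>2 \<le> (2 * c)\<^sup>2 * gauss x" for k x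
    proof -
      have c0: "c \<ge> 0" using ab[of 0 0] by linarith
      have "\<bar>ball_average r (u k) x - m x\<bar> \<le> 2 * c" using ab[of k x] mb[of x] by linarith
      then have "\<bar>ball_average r (u k) x - m x\<bar>\<^sup>2 \<le> (2 * c)\<^sup>2" by (intro power_mono) auto
      moreover have "gauss x * gauss x \<le> gauss x * 1" by (intro mult_left_mono) auto
      ultimately have "(gauss x * gauss x) * \<bar>ball_average r (u k) x - m x\<bar>\<^sup>2 \<le> (gauss x * 1) * (2 * c)\<^sup>2"
        by (intro mult_mono) auto
      then show ?thesis by (simp add: power_mult_distrib power2_eq_square[of "gauss x"] mult.commute flip: right_diff_distrib)
    qed
    have dsq: "square_integrable (\<lambda>x. gauss x * ball_average r (u k) x - gauss x * m x)" for k
      by (rule square_integrable_bound[where g="\<lambda>x::'a. (2 * c)\<^sup>2 * gauss x"],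
          measurable, intro integrable_mult_right integrable_gauss, intro AE_I2 dle)
    have "(\<lambda>k. LINT x|lborel. (norm (gauss x * ball_average r (u (s k)) x - gauss x * m x))\<^sup>2) \<longlonglongrightarrow> (LINT x::'a|lborel. (0::real))"
    proof (rule integral_dominated_convergence[where w="\<lambda>x. (2 * c)\<^sup>2 * gauss x"])
      show "AE x in lborel. (\<lambda>k. (norm (gauss x * ball_average r (u (s k)) x - gauss x * m x))\<^sup>2) \<longlonglongrightarrow> 0"
      proof (rule AE_I2)
        fix x
        have "(\<lambda>k. (norm (gauss x * ball_average r (u (s k)) x - gauss x * m x))\<^sup>2) \<longlonglongrightarrow> (norm (gauss x * m x - gauss x * m x))\<^sup>2"
          by (intro tendsto_intros mlim)
        then show "(\<lambda>k. (norm (gauss x * ball_average r (u (s k)) x - gauss x * m x))\<^sup>2) \<longlonglongrightarrow> 0" by simp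
      qed
      show "integrable lborel (\<lambda>x::'a. (2 * c)\<^sup>2 * gauss x)" by (rule integrable_mult_right[OF integrable_gauss])
      show "AE x in lborel. norm ((norm (gauss x * ball_average r (u (s k)) x - gauss x * m x))\<^sup>2) \<le> (2 * c)\<^sup>2 * gauss x" for k
        using dle by simp
    qed measurable
    then have "(\<lambda>k. mean_square (\<lambda>x. gauss x * ball_average r (u (s k)) x - gauss x * m x)) \<longlonglongrightarrow> 0"
      by (simp add: mean_square_def)
    from LIMSEQ_D[OF this, of "e / 16"] e obtain N where
      N: "\<And>k. k \<ge> N \<Longrightarrow> mean_square (\<lambda>x. gauss x * ball_average r (u (s k)) x - gauss x * m x) < e / 16"
      by auto
    have near: "square_integrable (\<lambda>x. w k x - gauss x * m x)" "mean_square (\<lambda>x. w k x - gauss x * m x) < e / 4" if k: "k \<ge> N" for k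
    proof -
      let ?d = "\<lambda>x. u (s k) x - ball_average r (u (s k)) x"
      have d: "square_integrable ?d" "mean_square ?d \<le> K * r" using ball_average_close[OF u r] by auto
      have eq: "(\<lambda>x. w k x - gauss x * m x) = (\<lambda>x. gauss x * ?d x + (gauss x * ball_average r (u (s k)) x - gauss x * m x))"
        by (simp add: fun_eq_iff w_def algebra_simps)
      show "square_integrable (\<lambda>x. w k x - gauss x * m x)" unfolding eq by (intro square_integrable_add gmul d dsq)
      have "mean_square (\<lambda>x. w k x - gauss x * m x) \<le> 2 * mean_square (\<lambda>x. gauss x * ?d x)
         + 2 * mean_square (\<lambda>x. gauss x * ball_average r (u (s k)) x - gauss x * m x)"
        unfolding eq by (intro mean_square_add_le gmul d dsq)
      then show "mean_square (\<lambda>x. w k x - gauss x * m x) < e / 4"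
        using gle[OF d(1)] d(2) N[OF k] rK e by linarith
    qed
    show ?thesis
    proof (intro exI[of _ N] allI impI)
      fix k l assume kl: "N \<le> k" "N \<le> l"
      have eq: "(\<lambda>x. w k x - w l x) = (\<lambda>x. (w k x - gauss x * m x) + - (w l x - gauss x * m x))" by (simp add: fun_eq_iff)
      have "mean_square (\<lambda>x. w k x - w l x) \<le> 2 * mean_square (\<lambda>x. w k x - gauss x * m x) + 2 * mean_square (\<lambda>x. - (w l x - gauss x * m x))"
        unfolding eq by (intro mean_square_add_le square_integrable_uminus near kl)
      then show "mean_square (\<lambda>x. w k x - w l x) < e"
        using near(2)[OF kl(1)] near(2)[OF kl(2)] by (simp only: mean_square_uminus)
    qed
  qed
  obtain g t where g: "square_integrable g" "strict_mono (t :: nat \<Rightarrow> nat)" "AE x in lborel. (\<lambda>k. w (t k) x) \<longlonglongrightarrow> g x"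
    using mean_square_complete[of w, OF w cauchy] by blast
  have [measurable]: "g \<in> borel_measurable borel" by (rule square_integrable_borel[OF g(1)])
  define v where "v x = g x / gauss x" for x
  have [measurable]: "v \<in> borel_measurable borel" unfolding v_def by measurable
  have st: "strict_mono (s \<circ> t)" using s(1) g(2) by (rule strict_mono_o)
  have lim: "AE x in lborel. (\<lambda>k. u ((s \<circ> t) k) x) \<longlonglongrightarrow> v x"
    using g(3)
  proof eventually_elim
    case (elim x)
    then have "(\<lambda>k. w (t k) x / gauss x) \<longlonglongrightarrow> g x / gauss x" by (intro tendsto_intros) auto
    then show ?case by (simp add: w_def v_def)
  qed
  have lim2: "AE x in lborel. (\<lambda>k. (norm (u ((s \<circ> t) k) x))\<^sup>2) \<longlonglongrightarrow> (norm (v x))\<^sup>2"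
    using lim by eventually_elim (intro tendsto_intros)
  have i: "integrable lborel (\<lambda>x. (norm (u ((s \<circ> t) k) x))\<^sup>2)" for k by (rule square_integrable_integrable[OF U(1)])
  have bd: "eventually (\<lambda>k. (LINT x|lborel. (norm (u ((s \<circ> t) k) x))\<^sup>2) \<le> K) sequentially"
    using U(2) by (simp add: mean_square_def)
  have "integrable lborel (\<lambda>x. (norm (v x))\<^sup>2)" "(LINT x|lborel. (norm (v x))\<^sup>2) \<le> K"
    using Fatou_bound[OF i _ _ _ lim2 bd K] by auto
  then show ?thesis using that[OF st _ _ lim] by (simp add: square_integrable_def mean_square_def)
qed

text \<open>
  A form of dominated convergence: what exceeds \<open>\<epsilon> * h k\<close> is dominated, and \<open>h k\<close> has a
  bounded integral.
\<close>

lemma integral_tendsto_0_of_split_bound: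
  fixes d h :: "nat \<Rightarrow> 'a \<Rightarrow> real"
  assumes d: "\<And>k. d k \<in> borel_measurable M" "\<And>k x. 0 \<le> d k x" "AE x in M. (\<lambda>k. d k x) \<longlonglongrightarrow> 0"
    and h: "\<And>k. integrable M (h k)" "\<And>k x. 0 \<le> h k x" "\<And>k. (LINT x|M. h k x) \<le> C"
    and split: "\<And>\<epsilon>. \<epsilon> > 0 \<Longrightarrow> \<exists>H. integrable M H \<and> (\<forall>k x. d k x \<le> \<epsilon> * h k x + H x)"
  shows "(\<lambda>k. LINT x|M. d k x) \<longlonglongrightarrow> 0" and "integrable M (d k)"
proof -
  note [measurable] = d(1)
  have hm[measurable]: "h k \<in> borel_measurable M" for k using h(1) by (rule borel_measurable_integrable)
  have di: "integrable M (d k)" for k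
  proof -
    obtain H where H: "integrable M H" "\<And>k x. d k x \<le> 1 * h k x + H x" using split[of 1] by auto
    show ?thesis
      by (rule Bochner_Integration.integrable_bound[OF Bochner_Integration.integrable_add[OF h(1)[of k] H(1)]])
        (use H(2)[of k] d(2)[of k] in \<open>auto intro!: AE_I2 intro: order_trans[OF _ abs_ge_self]\<close>)
  qed
  then show "integrable M (d k)" .
  have C: "0 \<le> C"
    by (rule order_trans[OF _ h(3)[of 0]]) (simp add: Bochner_Integration.integral_nonneg h(2))
  show "(\<lambda>k. LINT x|M. d k x) \<longlonglongrightarrow> 0"
  proof (rule LIMSEQ_I)
    fix e :: real assume e: "e > 0"
    define \<epsilon> where "\<epsilon> = e / (2 * (C + 1))"
    have \<epsilon>: "\<epsilon> > 0" using e C by (simp add: \<epsilon>_def)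
    have eC: "\<epsilon> * C \<le> e / 2"
    proof -
      have "\<epsilon> * C \<le> \<epsilon> * (C + 1)" using \<epsilon> by (intro mult_left_mono) auto
      also have "\<dots> = e / 2"
      proof -
        have gen: "e / (2 * c) * c = e / 2" if "c \<noteq> 0" for c :: real using that by simp
        show ?thesis unfolding \<epsilon>_def by (rule gen) (use C in simp)
      qed
      finally show ?thesis .
    qed
    obtain H where H: "integrable M H" "\<And>k x. d k x \<le> \<epsilon> * h k x + H x" using split[OF \<epsilon>] by auto
    let ?W = "\<lambda>k x. max 0 (d k x - \<epsilon> * h k x)"
    have WH: "norm (?W k x) \<le> \<bar>H x\<bar>" for k x using H(2)[of k x] by auto
    have Wd: "norm (?W k x) \<le> d k x" for k x
      using d(2)[of k x] mult_nonneg_nonneg[OF less_imp_le[OF \<epsilon>] h(2)[of k x]] by auto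
    have Wi: "integrable M (?W k)" for k
      by (rule Bochner_Integration.integrable_bound[OF di[of k]]) (use Wd d(2) in \<open>auto simp: abs_of_nonneg\<close>)
    have "(\<lambda>k. LINT x|M. ?W k x) \<longlonglongrightarrow> (LINT x|M. 0)"
    proof (rule integral_dominated_convergence[where w="\<lambda>x. \<bar>H x\<bar>"])
      show "AE x in M. (\<lambda>k. ?W k x) \<longlonglongrightarrow> 0"
        using d(3)
      proof eventually_elim
        case (elim x)
        show ?case by (rule Lim_null_comparison[OF _ elim]) (intro always_eventually allI Wd)
      qed
    qed (use H WH in auto)
    from LIMSEQ_D[OF this, of "e/2"] e obtain N where N: "\<And>k. k \<ge> N \<Longrightarrow> \<bar>LINT x|M. ?W k x\<bar> < e/2" by auto
    have "(LINT x|M. d k x) < e" if "k \<ge> N" for k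
    proof -
      have "(LINT x|M. d k x) \<le> (LINT x|M. ?W k x + \<epsilon> * h k x)"
        by (intro integral_mono di Bochner_Integration.integrable_add Wi integrable_mult_right h) auto
      also have "\<dots> = (LINT x|M. ?W k x) + (LINT x|M. \<epsilon> * h k x)"
        by (intro Bochner_Integration.integral_add Wi integrable_mult_right h)
      also have "(LINT x|M. \<epsilon> * h k x) = \<epsilon> * (LINT x|M. h k x)" by simp
      also have "\<epsilon> * (LINT x|M. h k x) \<le> \<epsilon> * C" using \<epsilon> by (intro mult_left_mono h) auto
      finally show ?thesis using N[OF that] eC by linarith
    qed
    then show "\<exists>no. \<forall>n\<ge>no. norm ((LINT x|M. d n x) - 0) < e"
      using d(2) by (intro exI[of _ N]) (simp add: abs_of_nonneg integral_nonneg)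
  qed
qed

text \<open>
  With the split \<open>a * b \<le> \<epsilon> * a^2 + b^2 / \<epsilon>\<close>, the bounded mean squares enter as \<open>h k\<close>.
\<close>

lemma mean_square_bounded_weak_limit:
  fixes u :: "nat \<Rightarrow> 'a::euclidean_space \<Rightarrow> real"
  assumes u: "\<And>k. square_integrable (u k)" "\<And>k. mean_square (u k) \<le> K"
    and v: "square_integrable v" and lim: "AE x in lborel. (\<lambda>k. u k x) \<longlonglongrightarrow> v x"
    and f: "square_integrable f"
  shows "(\<lambda>k. LINT x|lborel. u k x * f x) \<longlonglongrightarrow> (LINT x|lborel. v x * f x)"
proof -
  have [measurable]: "u k \<in> borel_measurable borel" "v \<in> borel_measurable borel" "f \<in> borel_measurable borel" for k
    using u v f by (auto intro: square_integrable_borel)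
  have dsq: "square_integrable (\<lambda>x. u k x - v x)" for k by (intro square_integrable_diff u v)
  have "(\<lambda>k. LINT x|lborel. \<bar>(u k x - v x) * f x\<bar>) \<longlonglongrightarrow> 0"
  proof (rule integral_tendsto_0_of_split_bound(1)[where h="\<lambda>k x. (norm (u k x - v x))\<^sup>2" and C="2 * K + 2 * mean_square v"])
    show "AE x in lborel. (\<lambda>k. \<bar>(u k x - v x) * f x\<bar>) \<longlonglongrightarrow> 0"
      using lim
    proof eventually_elim
      case (elim x)
      then have "(\<lambda>k. \<bar>(u k x - v x) * f x\<bar>) \<longlonglongrightarrow> \<bar>(v x - v x) * f x\<bar>" by (intro tendsto_intros)
      then show ?case by simp
    qed
    show "integrable lborel (\<lambda>x. (norm (u k x - v x))\<^sup>2)" for k by (rule square_integrable_integrable[OF dsq])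
    show "(LINT x|lborel. (norm (u k x - v x))\<^sup>2) \<le> 2 * K + 2 * mean_square v" for k
      using mean_square_add_le[OF u(1)[of k] square_integrable_uminus[OF v]] u(2)[of k]
      by (simp add: mean_square_def)
    fix \<epsilon> :: real assume \<epsilon>: "\<epsilon> > 0"
    show "\<exists>H. integrable lborel H \<and> (\<forall>k x. \<bar>(u k x - v x) * f x\<bar> \<le> \<epsilon> * (norm (u k x - v x))\<^sup>2 + H x)"
    proof (intro exI[of _ "\<lambda>x. (1 / \<epsilon>) * (norm (f x))\<^sup>2"] conjI allI)
      show "integrable lborel (\<lambda>x. (1 / \<epsilon>) * (norm (f x))\<^sup>2)" by (intro integrable_mult_right square_integrable_integrable f)
      fix k x
      define a b where "a = \<bar>u k x - v x\<bar>" and "b = \<bar>f x\<bar>"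
      have ab: "a \<ge> 0" "b \<ge> 0" by (auto simp: a_def b_def)
      have "a * b \<le> \<epsilon> * a\<^sup>2 + (1 / \<epsilon>) * b\<^sup>2"
      proof -
        have "0 \<le> (\<epsilon> * a - b)\<^sup>2 / \<epsilon>" using \<epsilon> by simp
        also have "\<dots> = \<epsilon> * a\<^sup>2 - 2 * (a * b) + (1 / \<epsilon>) * b\<^sup>2"
          using \<epsilon> by (simp add: power2_eq_square field_simps)
        finally show ?thesis using mult_nonneg_nonneg[OF ab] by linarith
      qed
      then show "\<bar>(u k x - v x) * f x\<bar> \<le> \<epsilon> * (norm (u k x - v x))\<^sup>2 + (1 / \<epsilon>) * (norm (f x))\<^sup>2"
        by (simp add: a_def b_def abs_mult)
    qed
  qed auto
  then have "(\<lambda>k. LINT x|lborel. (u k x - v x) * f x) \<longlonglongrightarrow> 0"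
    by (rule Lim_null_comparison[rotated]) (auto intro!: always_eventually integral_abs_bound)
  then have "(\<lambda>k. (LINT x|lborel. u k x * f x) - (LINT x|lborel. v x * f x)) \<longlonglongrightarrow> 0"
    using square_integrable_times[OF u(1) f] square_integrable_times[OF v f] by (simp add: left_diff_distrib)
  then show ?thesis by (rule LIM_zero_cancel)
qed

section \<open>Inequalities for powers\<close>

text \<open>
  The derivative of \<open>\<bar>t\<bar> powr p / p\<close>.
\<close>

definition signed_powr :: "real \<Rightarrow> real \<Rightarrow> real"
  where "signed_powr p t = \<bar>t\<bar> powr (p - 2) * t"

lemma signed_powr_measurable [measurable]: "signed_powr p \<in> borel_measurable borel"
  unfolding signed_powr_def by measurable

lemma abs_signed_powr: "\<bar>signed_powr p t\<bar> = \<bar>t\<bar> powr (p - 1)"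
proof (cases "t = 0")
  case False
  have "\<bar>signed_powr p t\<bar> = \<bar>t\<bar> powr (p - 2) * \<bar>t\<bar> powr 1" using False by (simp add: signed_powr_def abs_mult)
  also have "\<dots> = \<bar>t\<bar> powr (p - 1)" by (simp only: powr_add[symmetric]) simp
  finally show ?thesis .
qed (simp add: signed_powr_def)

lemma signed_powr_eq: "signed_powr p t = sgn t * \<bar>t\<bar> powr (p - 1)"
proof (cases "t = 0")
  case False
  have "signed_powr p t = sgn t * \<bar>signed_powr p t\<bar>"
    using False by (simp add: signed_powr_def abs_mult mult.left_commute sgn_mult_abs)
  then show ?thesis by (simp only: abs_signed_powr)
qed (simp add: signed_powr_def)

lemma signed_powr_mult_self: "signed_powr p t * t = \<bar>t\<bar> powr p"
proof (cases "t = 0")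
  case False
  have "signed_powr p t * t = \<bar>t\<bar> powr (p - 2) * \<bar>t\<bar> powr 2"
    using False by (simp add: signed_powr_def powr_numeral power2_eq_square)
  also have "\<dots> = \<bar>t\<bar> powr p" by (simp only: powr_add[symmetric]) simp
  finally show ?thesis .
qed (simp add: signed_powr_def)

lemma signed_powr_mult: "signed_powr p (s * t) = s powr (p - 1) * signed_powr p t" if "s > 0"
  using that by (simp add: signed_powr_eq sgn_mult abs_mult powr_mult)

text \<open>
  Either \<open>\<bar>v\<bar> \<le> \<epsilon> * \<bar>a\<bar>\<close>, and the first term dominates, or \<open>\<bar>a\<bar> < \<bar>v\<bar> / \<epsilon>\<close>, and the second one does.
\<close>

lemma signed_powr_split:
  assumes e: "\<epsilon> > 0" and p: "p > 1"
  shows "\<bar>signed_powr p a * v\<bar> \<le> \<epsilon> * \<bar>a\<bar> powr p + \<epsilon> powr (1 - p) * \<bar>v\<bar> powr p"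
proof -
  have eq: "\<bar>signed_powr p a * v\<bar> = \<bar>a\<bar> powr (p - 1) * \<bar>v\<bar>" by (simp only: abs_mult abs_signed_powr)
  show ?thesis
  proof (cases "\<bar>v\<bar> \<le> \<epsilon> * \<bar>a\<bar>")
    case True
    have "\<bar>a\<bar> powr (p - 1) * \<bar>v\<bar> \<le> \<bar>a\<bar> powr (p - 1) * (\<epsilon> * \<bar>a\<bar>)" using True by (intro mult_left_mono) auto
    also have "\<dots> = \<epsilon> * (\<bar>a\<bar> powr (p - 1) * \<bar>a\<bar>)" by simp
    also have "\<bar>a\<bar> powr (p - 1) * \<bar>a\<bar> = \<bar>a\<bar> powr p"
      by (cases "a = 0") (auto simp: powr_mult_base mult.commute[of "_ powr _"])
    finally show ?thesis unfolding eq by (intro add_increasing2) auto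
  next
    case False
    have "\<bar>a\<bar> powr (p - 1) \<le> (\<bar>v\<bar> / \<epsilon>) powr (p - 1)"
      using False e p by (intro powr_mono2) (auto simp: field_simps)
    then have "\<bar>a\<bar> powr (p - 1) * \<bar>v\<bar> \<le> (\<bar>v\<bar> / \<epsilon>) powr (p - 1) * \<bar>v\<bar>" by (intro mult_right_mono) auto
    also have "\<dots> = \<epsilon> powr (1 - p) * (\<bar>v\<bar> powr (p - 1) * \<bar>v\<bar>)"
    proof -
      have "\<epsilon> powr (1 - p) = 1 / \<epsilon> powr (p - 1)" using powr_minus_divide[of \<epsilon> "p - 1"] by simp
      then show ?thesis using e by (simp add: powr_divide)
    qed
    also have "\<bar>v\<bar> powr (p - 1) * \<bar>v\<bar> = \<bar>v\<bar> powr p"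
      by (cases "v = 0") (auto simp: powr_mult_base mult.commute[of "_ powr _"])
    finally show ?thesis unfolding eq using e by (intro add_increasing) auto
  qed
qed

lemma signed_powr_tendsto:
  assumes p: "p > 2" and u: "(u \<longlongrightarrow> l) F"
  shows "((\<lambda>k. signed_powr p (u k)) \<longlongrightarrow> signed_powr p l) F"
  unfolding signed_powr_def using p by (intro tendsto_intros u) auto

lemma abs_powr_has_derivative:
  assumes r: "r > 1"
  shows "((\<lambda>t. \<bar>t\<bar> powr r) has_real_derivative r * signed_powr r t) (at t)"
proof -
  consider "t > 0" | "t < 0" | "t = 0" by linarith
  then show ?thesis
  proof cases
    case 1
    have "((\<lambda>t. t powr r) has_real_derivative r * signed_powr r t) (at t)"
      using 1 by (auto intro!: derivative_eq_intros simp: signed_powr_eq)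
    then show ?thesis
      by (rule has_field_derivative_transform_within_open[where S="{0<..}"]) (use 1 in auto)
  next
    case 2
    have "((\<lambda>t. (- t) powr r) has_real_derivative r * signed_powr r t) (at t)"
      using 2 by (auto intro!: derivative_eq_intros simp: signed_powr_eq)
    then show ?thesis
      by (rule has_field_derivative_transform_within_open[where S="{..<0}"]) (use 2 in auto)
  next
    case 3
    have z: "((\<lambda>y. \<bar>y\<bar> powr (r - 1)) \<longlongrightarrow> 0) (at (0::real))"
      by (rule tendsto_zero_powrI[where b="r - 1"]) (use r in \<open>auto intro!: tendsto_eq_intros\<close>)
    have "((\<lambda>y. (\<bar>y\<bar> powr r - \<bar>0\<bar> powr r) / (y - 0)) \<longlongrightarrow> 0) (at (0::real))"
    proof (rule Lim_null_comparison[OF _ z], rule always_eventually, rule allI)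
      fix y :: real
      show "norm ((\<bar>y\<bar> powr r - \<bar>0\<bar> powr r) / (y - 0)) \<le> \<bar>y\<bar> powr (r - 1)"
        by (cases "y = 0") (auto simp: powr_diff abs_divide)
    qed
    then show ?thesis using 3 by (simp add: has_field_derivative_iff signed_powr_def)
  qed
qed

lemma signed_powr_has_derivative:
  assumes p: "p > 2"
  shows "(signed_powr p has_real_derivative (p - 1) * \<bar>t\<bar> powr (p - 2)) (at t)"
proof -
  consider "t > 0" | "t < 0" | "t = 0" by linarith
  then show ?thesis
  proof cases
    case 1
    have "((\<lambda>t. t powr (p - 1)) has_real_derivative (p - 1) * \<bar>t\<bar> powr (p - 2)) (at t)"
      using 1 by (auto intro!: derivative_eq_intros)
    then show ?thesis
      by (rule has_field_derivative_transform_within_open[where S="{0<..}"]) (use 1 in \<open>auto simp: signed_powr_eq\<close>)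
  next
    case 2
    have "((\<lambda>t. - ((- t) powr (p - 1))) has_real_derivative (p - 1) * \<bar>t\<bar> powr (p - 2)) (at t)"
      using 2 by (auto intro!: derivative_eq_intros)
    then show ?thesis
      by (rule has_field_derivative_transform_within_open[where S="{..<0}"]) (use 2 in \<open>auto simp: signed_powr_eq\<close>)
  next
    case 3
    have z: "((\<lambda>y. \<bar>y\<bar> powr (p - 2)) \<longlongrightarrow> 0) (at (0::real))"
      by (rule tendsto_zero_powrI[where b="p - 2"]) (use p in \<open>auto intro!: tendsto_eq_intros\<close>)
    have "((\<lambda>y. (signed_powr p y - signed_powr p 0) / (y - 0)) \<longlongrightarrow> 0) (at (0::real))"
      by (rule Lim_null_comparison[OF _ z], rule always_eventually) (auto simp: signed_powr_def)
    then show ?thesis using 3 by (simp add: has_field_derivative_iff)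
  qed
qed

text \<open>Two applications of the mean value theorem, on the ball of radius \<open>\<bar>a\<bar> + \<bar>b\<bar>\<close>.\<close>

lemma abs_powr_Taylor:
  assumes p: "p > 2"
  shows "\<bar>\<bar>a + b\<bar> powr p - \<bar>a\<bar> powr p - p * (signed_powr p a * b)\<bar>
    \<le> p * (p - 1) * 2 powr (p - 2) * (\<bar>a\<bar> powr (p - 2) * b\<^sup>2 + \<bar>b\<bar> powr p)"
proof -
  define R where "R = \<bar>a\<bar> + \<bar>b\<bar>"
  have lip: "\<bar>signed_powr p x - signed_powr p a\<bar> \<le> (p - 1) * R powr (p - 2) * \<bar>x - a\<bar>" if "\<bar>x\<bar> \<le> R" for x
  proof -
    have "norm (signed_powr p x - signed_powr p a) \<le> (p - 1) * R powr (p - 2) * norm (x - a)"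
    proof (rule field_differentiable_bound[where S="{-R..R}"])
      fix z assume "z \<in> {-R..R}"
      show "(signed_powr p has_field_derivative (p - 1) * \<bar>z\<bar> powr (p - 2)) (at z within {-R..R})"
        by (rule has_field_derivative_at_within[OF signed_powr_has_derivative[OF p]])
      have "\<bar>z\<bar> powr (p - 2) \<le> R powr (p - 2)" using \<open>z \<in> {-R..R}\<close> p by (intro powr_mono2) auto
      then show "norm ((p - 1) * \<bar>z\<bar> powr (p - 2)) \<le> (p - 1) * R powr (p - 2)"
        using p by (simp add: abs_mult)
    qed (use that in \<open>auto simp: R_def\<close>)
    then show ?thesis by simp
  qed
  let ?F = "\<lambda>x. \<bar>x\<bar> powr p - p * signed_powr p a * x"
  have "norm (?F (a + b) - ?F a) \<le> p * ((p - 1) * R powr (p - 2) * \<bar>b\<bar>) * norm ((a + b) - a)"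
  proof (rule field_differentiable_bound[where S="closed_segment a (a + b)"])
    fix z assume z: "z \<in> closed_segment a (a + b)"
    then have za: "\<bar>z - a\<bar> \<le> \<bar>b\<bar>" by (auto simp: closed_segment_eq_real_ivl split: if_splits)
    then have zR: "\<bar>z\<bar> \<le> R" by (auto simp: R_def)
    show "(?F has_field_derivative p * signed_powr p z - p * signed_powr p a) (at z within closed_segment a (a + b))"
      using p by (intro DERIV_diff DERIV_cmult_Id has_field_derivative_at_within[OF abs_powr_has_derivative]) auto
    have "norm (p * signed_powr p z - p * signed_powr p a) = p * \<bar>signed_powr p z - signed_powr p a\<bar>"
      using p by (simp add: abs_mult flip: right_diff_distrib)
    also have "\<dots> \<le> p * ((p - 1) * R powr (p - 2) * \<bar>z - a\<bar>)"
      using p by (intro mult_left_mono lip zR) auto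
    also have "\<dots> \<le> p * ((p - 1) * R powr (p - 2) * \<bar>b\<bar>)"
      using p za by (intro mult_left_mono) auto
    finally show "norm (p * signed_powr p z - p * signed_powr p a) \<le> p * ((p - 1) * R powr (p - 2) * \<bar>b\<bar>)" .
  qed auto
  moreover have "?F (a + b) - ?F a = \<bar>a + b\<bar> powr p - \<bar>a\<bar> powr p - p * (signed_powr p a * b)"
    by (simp add: algebra_simps)
  moreover have "p * ((p - 1) * R powr (p - 2) * \<bar>b\<bar>) * norm ((a + b) - a) = p * (p - 1) * (R powr (p - 2) * b\<^sup>2)"
    by (simp add: power2_eq_square mult.assoc)
  ultimately have "\<bar>\<bar>a + b\<bar> powr p - \<bar>a\<bar> powr p - p * (signed_powr p a * b)\<bar> \<le> p * (p - 1) * (R powr (p - 2) * b\<^sup>2)"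
    by (simp only: real_norm_def)
  also have "\<dots> \<le> p * (p - 1) * (2 powr (p - 2) * (\<bar>a\<bar> powr (p - 2) + \<bar>b\<bar> powr (p - 2)) * b\<^sup>2)"
  proof (intro mult_left_mono mult_right_mono)
    have "R powr (p - 2) \<le> (2 * max \<bar>a\<bar> \<bar>b\<bar>) powr (p - 2)" using p by (intro powr_mono2) (auto simp: R_def)
    also have "\<dots> = 2 powr (p - 2) * (max \<bar>a\<bar> \<bar>b\<bar>) powr (p - 2)" by (simp add: powr_mult)
    also have "\<dots> \<le> 2 powr (p - 2) * (\<bar>a\<bar> powr (p - 2) + \<bar>b\<bar> powr (p - 2))"
      by (intro mult_left_mono) (auto simp: max_def)
    finally show "R powr (p - 2) \<le> 2 powr (p - 2) * (\<bar>a\<bar> powr (p - 2) + \<bar>b\<bar> powr (p - 2))" .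
  qed (use p in auto)
  also have "\<dots> = p * (p - 1) * 2 powr (p - 2) * (\<bar>a\<bar> powr (p - 2) * b\<^sup>2 + \<bar>b\<bar> powr (p - 2) * b\<^sup>2)"
    by (simp add: algebra_simps)
  also have "\<bar>b\<bar> powr (p - 2) * b\<^sup>2 = \<bar>b\<bar> powr p"
    using signed_powr_mult_self[of p b] by (simp add: signed_powr_def power2_eq_square mult.assoc)
  finally show ?thesis .
qed

text \<open>
  Scaling \<open>b\<close> by \<open>s\<close>, which will be the norm of \<open>b\<close> as a function, gives a bound that is quadratic in \<open>s\<close>.
\<close>

lemma powr_mult_square_le:
  fixes a b p s :: real
  assumes p: "p > 2" and s: "s > 0"
  shows "\<bar>a\<bar> powr (p - 2) * b\<^sup>2 \<le> s\<^sup>2 * (\<bar>a\<bar> powr p + \<bar>b / s\<bar> powr p)"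
proof -
  have eq: "\<bar>c\<bar> powr (p - 2) * c\<^sup>2 = \<bar>c\<bar> powr p" for c
    using signed_powr_mult_self[of p c] by (simp add: signed_powr_def power2_eq_square mult.assoc)
  define c where "c = b / s"
  have b: "b = s * c" using s by (simp add: c_def)
  have "\<bar>a\<bar> powr (p - 2) * c\<^sup>2 \<le> \<bar>a\<bar> powr p + \<bar>c\<bar> powr p"
  proof (cases "\<bar>a\<bar> \<le> \<bar>c\<bar>")
    case True
    then have "\<bar>a\<bar> powr (p - 2) * c\<^sup>2 \<le> \<bar>c\<bar> powr (p - 2) * c\<^sup>2" using p by (intro mult_right_mono powr_mono2) auto
    then show ?thesis unfolding eq by (intro add_increasing) auto
  next
    case False
    then have "c\<^sup>2 \<le> a\<^sup>2" by (intro iffD1[OF abs_le_square_iff]) auto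
    then have "\<bar>a\<bar> powr (p - 2) * c\<^sup>2 \<le> \<bar>a\<bar> powr (p - 2) * a\<^sup>2" by (intro mult_left_mono) auto
    then show ?thesis unfolding eq by (intro add_increasing2) auto
  qed
  then have "s\<^sup>2 * (\<bar>a\<bar> powr (p - 2) * c\<^sup>2) \<le> s\<^sup>2 * (\<bar>a\<bar> powr p + \<bar>c\<bar> powr p)" by (intro mult_left_mono) auto
  then show ?thesis using s by (simp add: b power_mult_distrib mult.left_commute)
qed

text \<open>
  The discriminant inequality, evaluated at \<open>t = - \<beta> / (\<gamma> + 1)\<close>, which is defined for \<open>\<gamma> = 0\<close> as well.
\<close>

lemma quadratic_nonneg_imp:
  fixes \<alpha> \<beta> \<gamma> :: real
  assumes "\<And>t. 0 \<le> \<alpha> + 2 * t * \<beta> + t\<^sup>2 * \<gamma>" and \<gamma>: "0 \<le> \<gamma>"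
  shows "\<beta>\<^sup>2 \<le> \<alpha> * (\<gamma> + 1)"
proof -
  define g where "g = \<gamma> + 1"
  have g: "g > 0" using \<gamma> by (simp add: g_def)
  have "0 \<le> \<alpha> + 2 * (- \<beta> / g) * \<beta> + (- \<beta> / g)\<^sup>2 * \<gamma>" by (rule assms)
  also have "\<dots> \<le> \<alpha> + 2 * (- \<beta> / g) * \<beta> + (- \<beta> / g)\<^sup>2 * g"
    by (intro add_left_mono mult_left_mono) (auto simp: g_def)
  also have "\<dots> = \<alpha> - \<beta>\<^sup>2 / g" using g by (simp add: power2_eq_square)
  finally have "\<beta>\<^sup>2 / g \<le> \<alpha>" by simp
  then show ?thesis using g unfolding g_def[symmetric] by (simp add: pos_divide_le_eq)
qed

lemma integrable_signed_powr_mult: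
  fixes u v :: "'a::euclidean_space \<Rightarrow> real"
  assumes [measurable]: "u \<in> borel_measurable borel" "v \<in> borel_measurable borel"
    and i: "integrable lborel (\<lambda>x. \<bar>u x\<bar> powr p)" "integrable lborel (\<lambda>x. \<bar>v x\<bar> powr p)" and p: "p > 1"
  shows "integrable lborel (\<lambda>x. signed_powr p (u x) * v x)"
proof (rule Bochner_Integration.integrable_bound)
  show "integrable lborel (\<lambda>x. \<bar>u x\<bar> powr p + \<bar>v x\<bar> powr p)" using i by simp
  show "AE x in lborel. norm (signed_powr p (u x) * v x) \<le> norm (\<bar>u x\<bar> powr p + \<bar>v x\<bar> powr p)"
    using signed_powr_split[of 1 p "u _" "v _"] p by (intro AE_I2) simp
qed measurable

lemma powr_integral_eq_0_iff:
  fixes u :: "'a::euclidean_space \<Rightarrow> real"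
  assumes [measurable]: "u \<in> borel_measurable borel" and i: "integrable lborel (\<lambda>x. \<bar>u x\<bar> powr p)"
  shows "(LINT x|lborel. \<bar>u x\<bar> powr p) = 0 \<longleftrightarrow> (AE x in lborel. u x = 0)"
  using integral_nonneg_eq_0_iff_AE[OF i] by simp

lemma Hoelder_signed_powr:
  fixes u v :: "'a::euclidean_space \<Rightarrow> real"
  assumes [measurable]: "u \<in> borel_measurable borel" "v \<in> borel_measurable borel"
    and i: "integrable lborel (\<lambda>x. \<bar>u x\<bar> powr p)" "integrable lborel (\<lambda>x. \<bar>v x\<bar> powr p)" and p: "p > 1"
    and one: "(LINT x|lborel. \<bar>u x\<bar> powr p) = 1"
  shows "(LINT x|lborel. signed_powr p (u x) * v x) \<le> (LINT x|lborel. \<bar>v x\<bar> powr p) powr (1 / p)"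
proof (cases "(LINT x|lborel. \<bar>v x\<bar> powr p) = 0")
  case True
  then have "AE x in lborel. v x = 0" using powr_integral_eq_0_iff[OF _ i(2)] by simp
  then have "(LINT x|lborel. signed_powr p (u x) * v x) = (LINT x|lborel. 0 * v x)"
    by (intro integral_cong_AE) auto
  then show ?thesis using True by simp
next
  case False
  define N where "N = (LINT x|lborel. \<bar>v x\<bar> powr p)"
  have "N \<ge> 0" unfolding N_def by (intro Bochner_Integration.integral_nonneg) auto
  with False have N: "N > 0" by (auto simp: N_def[symmetric] less_le)
  define \<tau> where "\<tau> = N powr (1 / p)"
  have \<tau>: "\<tau> > 0" using N by (simp add: \<tau>_def)
  have \<tau>p: "\<tau> powr p = N" using N p by (simp add: \<tau>_def powr_powr)
  define q where "q = p / (p - 1)"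
  have q: "q > 1" "1 / q + 1 / p = 1" "(p - 1) * q = p" using p by (auto simp: q_def field_simps)
  have pt: "signed_powr p (u x) * v x \<le> \<tau> * (\<bar>u x\<bar> powr p / q) + \<tau> / N * (\<bar>v x\<bar> powr p / p)" for x
  proof -
    have "\<bar>u x\<bar> powr (p - 1) * (\<bar>v x\<bar> / \<tau>) \<le> (\<bar>u x\<bar> powr (p - 1)) powr q / q + (\<bar>v x\<bar> / \<tau>) powr p / p"
      using p q \<tau> by (intro Youngs_inequality) auto
    also have "(\<bar>u x\<bar> powr (p - 1)) powr q = \<bar>u x\<bar> powr p" by (simp only: powr_powr q(3))
    also have "(\<bar>v x\<bar> / \<tau>) powr p = \<bar>v x\<bar> powr p / N" using \<tau> by (simp add: powr_divide \<tau>p)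
    finally have "\<tau> * (\<bar>u x\<bar> powr (p - 1) * (\<bar>v x\<bar> / \<tau>)) \<le> \<tau> * (\<bar>u x\<bar> powr p / q + \<bar>v x\<bar> powr p / N / p)"
      using \<tau> by (intro mult_left_mono) auto
    then have "\<bar>u x\<bar> powr (p - 1) * \<bar>v x\<bar> \<le> \<tau> * (\<bar>u x\<bar> powr p / q) + \<tau> / N * (\<bar>v x\<bar> powr p / p)"
      using \<tau> by (simp add: distrib_left)
    moreover have "signed_powr p (u x) * v x \<le> \<bar>u x\<bar> powr (p - 1) * \<bar>v x\<bar>"
      using abs_ge_self[of "signed_powr p (u x) * v x"] by (simp only: abs_mult abs_signed_powr)
    ultimately show ?thesis by linarith
  qed
  have "(LINT x|lborel. signed_powr p (u x) * v x) \<le> (LINT x|lborel. \<tau> * (\<bar>u x\<bar> powr p / q) + \<tau> / N * (\<bar>v x\<bar> powr p / p))"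
    by (intro integral_mono integrable_signed_powr_mult i p pt Bochner_Integration.integrable_add integrable_mult_right integrable_divide) measurable
  also have "\<dots> = \<tau> * (1 / q) + \<tau> / N * (N / p)"
    using i by (simp add: one N_def)
  also have "\<dots> = \<tau> * (1 / q + 1 / p)" using N by (simp add: distrib_left)
  also have "\<dots> = \<tau>" by (simp only: q(2) mult_1_right)
  finally show ?thesis by (simp add: \<tau>_def N_def)
qed

section \<open>Minimisation under a constraint\<close>

text \<open>
  The properties of the Sobolev space of order \<open>1/2\<close> and of an equivalent translation invariant form that the
  minimisation uses. They make no reference to the Fourier transform.
\<close>

locale translation_invariant_form =
  fixes H :: "('a::euclidean_space \<Rightarrow> real) set" and Q :: "('a \<Rightarrow> real) \<Rightarrow> ('a \<Rightarrow> real) \<Rightarrow> real" and c :: real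
  assumes c_pos: "0 < c"
    and H_square_integrable: "u \<in> H \<Longrightarrow> square_integrable u"
    and H_add: "u \<in> H \<Longrightarrow> v \<in> H \<Longrightarrow> (\<lambda>x. u x + v x) \<in> H"
    and H_mult: "u \<in> H \<Longrightarrow> (\<lambda>x. t * u x) \<in> H"
    and H_translate: "u \<in> H \<Longrightarrow> (\<lambda>x. u (x + y)) \<in> H"
    and Q_commute: "Q u v = Q v u"
    and Q_add: "u \<in> H \<Longrightarrow> v \<in> H \<Longrightarrow> w \<in> H \<Longrightarrow> Q (\<lambda>x. u x + v x) w = Q u w + Q v w"
    and Q_mult: "u \<in> H \<Longrightarrow> w \<in> H \<Longrightarrow> Q (\<lambda>x. t * u x) w = t * Q u w"
    and Q_translate: "u \<in> H \<Longrightarrow> Q (\<lambda>x. u (x + y)) (\<lambda>x. u (x + y)) = Q u u"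
    and Q_coercive: "u \<in> H \<Longrightarrow> mean_square u \<le> c * Q u u"
    and Q_modulus: "u \<in> H \<Longrightarrow> mean_square (\<lambda>x. u (x + y) - u x) \<le> c * Q u u * norm y"
    and Q_weak_limit: "(\<And>k. us k \<in> H) \<Longrightarrow> (\<And>k. Q (us k) (us k) \<le> K) \<Longrightarrow> square_integrable u' \<Longrightarrow>
      (\<And>f. square_integrable f \<Longrightarrow> (\<lambda>k. LINT x|lborel. us k x * f x) \<longlonglongrightarrow> (LINT x|lborel. u' x * f x)) \<Longrightarrow>
      u' \<in> H \<and> (\<forall>v\<in>H. (\<lambda>k. Q (us k) v) \<longlonglongrightarrow> Q u' v)"
    and H_nontrivial: "\<exists>u\<in>H. \<not> (AE x in lborel. u x = 0)"

locale subcritical_problem = translation_invariant_form H Q c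
  for H :: "('a::euclidean_space \<Rightarrow> real) set" and Q c +
  fixes p :: real
  assumes dim: "DIM('a) \<ge> 2" and p_gt_2: "2 < p" and p_subcritical: "p < 2 * real DIM('a) / (real DIM('a) - 1)"
begin

definition power_integral :: "('a \<Rightarrow> real) \<Rightarrow> real"
  where "power_integral u = (LINT x|lborel. \<bar>u x\<bar> powr p)"

lemma H_borel: "u \<in> H \<Longrightarrow> u \<in> borel_measurable borel"
  by (intro square_integrable_borel H_square_integrable)

lemma Q_nonneg:
  assumes u: "u \<in> H"
  shows "0 \<le> Q u u"
proof -
  have "0 \<le> c * Q u u" by (rule order_trans[OF mean_square_nonneg Q_coercive[OF u]])
  then show ?thesis using c_pos by (simp add: zero_le_mult_iff)
qed

lemma Q_add_right: "u \<in> H \<Longrightarrow> v \<in> H \<Longrightarrow> w \<in> H \<Longrightarrow> Q w (\<lambda>x. u x + v x) = Q w u + Q w v"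
  using Q_add[of u v w] by (simp add: Q_commute[of w])

lemma Q_mult_right: "u \<in> H \<Longrightarrow> w \<in> H \<Longrightarrow> Q w (\<lambda>x. t * u x) = t * Q w u"
  using Q_mult[of u w t] by (simp add: Q_commute[of w])

lemma Q_square_mult: "u \<in> H \<Longrightarrow> Q (\<lambda>x. t * u x) (\<lambda>x. t * u x) = t\<^sup>2 * Q u u"
  by (simp add: Q_mult Q_mult_right H_mult power2_eq_square)

lemma Q_square_add:
  "u \<in> H \<Longrightarrow> v \<in> H \<Longrightarrow> Q (\<lambda>x. u x + v x) (\<lambda>x. u x + v x) = Q u u + 2 * Q u v + Q v v"
  by (simp add: Q_add Q_add_right H_add Q_commute[of v u])

lemma subcritical: "p < 2 + p / real DIM('a)"
  using p_subcritical dim by (simp add: field_simps)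

lemma H_half_modulus: "u \<in> H \<Longrightarrow> Q u u \<le> M \<Longrightarrow> u \<in> half_modulus (c * M)"
proof -
  assume u: "u \<in> H" and M: "Q u u \<le> M"
  have le: "c * Q u u \<le> c * M" using M c_pos by simp
  have "mean_square (\<lambda>x. u (x + y) - u x) \<le> c * M * norm y" for y
    by (rule order_trans[OF Q_modulus[OF u] mult_right_mono[OF le]]) simp
  then show ?thesis
    using H_square_integrable[OF u] order_trans[OF Q_coercive[OF u] le] by (simp add: half_modulus_def)
qed

lemma power_integrable: "u \<in> H \<Longrightarrow> integrable lborel (\<lambda>x. \<bar>u x\<bar> powr p)"
  using half_modulus_embedding[where 'a='a and p=p and K="c * Q u u"] H_half_modulus[of u "Q u u"]
    dim p_gt_2 subcritical by (metis less_imp_le order_refl)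

lemma power_integral_nonneg: "0 \<le> power_integral u"
  unfolding power_integral_def by (intro Bochner_Integration.integral_nonneg) auto

lemma power_integral_mult: "power_integral (\<lambda>x. t * u x) = \<bar>t\<bar> powr p * power_integral u"
  by (simp add: power_integral_def abs_mult powr_mult)

lemma power_integral_eq_0: "u \<in> H \<Longrightarrow> power_integral u = 0 \<longleftrightarrow> (AE x in lborel. u x = 0)"
  unfolding power_integral_def by (intro powr_integral_eq_0_iff H_borel power_integrable)

lemma Q_eq_0_imp: "u \<in> H \<Longrightarrow> Q u u = 0 \<Longrightarrow> AE x in lborel. u x = 0"
  using Q_coercive[of u] mean_square_nonneg[of u] by (intro mean_square_eq_0_AE H_square_integrable) auto

text \<open>
  The embedding of a fixed class gives the bound for \<open>Q u u = 1\<close>; the rest is homogeneity.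
\<close>

lemma power_integral_le:
  "\<exists>B>0. \<forall>u\<in>H. power_integral u \<le> B * Q u u powr (p / 2)"
proof -
  obtain B where B: "B \<ge> 0" "\<And>u. u \<in> half_modulus c \<Longrightarrow> (LINT x|lborel. \<bar>u (x::'a)\<bar> powr p) \<le> B"
    using half_modulus_embedding[where 'a='a and p=p and K=c] dim p_gt_2 subcritical by (metis less_imp_le)
  have "power_integral u \<le> (B + 1) * Q u u powr (p / 2)" if u: "u \<in> H" for u
  proof (cases "Q u u = 0")
    case True
    then have "power_integral u = 0" using Q_eq_0_imp[OF u] power_integral_eq_0[OF u] by simp
    then show ?thesis using B(1) by simp
  next
    case False
    then have q: "Q u u > 0" using Q_nonneg[OF u] by simp
    define s where "s = 1 / sqrt (Q u u)"
    have s: "s > 0" using q by (simp add: s_def)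
    have "Q (\<lambda>x. s * u x) (\<lambda>x. s * u x) = s\<^sup>2 * Q u u" by (rule Q_square_mult[OF u])
    also have "\<dots> = 1" using q by (simp add: s_def power_divide)
    finally have "Q (\<lambda>x. s * u x) (\<lambda>x. s * u x) = 1" .
    then have "(\<lambda>x. s * u x) \<in> half_modulus c"
      using H_half_modulus[OF H_mult[OF u], of s 1] by simp
    then have "power_integral (\<lambda>x. s * u x) \<le> B" using B(2) unfolding power_integral_def by blast
    then have le: "s powr p * power_integral u \<le> B + 1" using s by (simp add: power_integral_mult)
    have sp: "s powr p = 1 / Q u u powr (p / 2)"
      using q by (simp add: s_def powr_divide powr_half_sqrt[symmetric] powr_powr)
    have "power_integral u = Q u u powr (p / 2) * (s powr p * power_integral u)" using q by (simp add: sp)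
    also have "\<dots> \<le> Q u u powr (p / 2) * (B + 1)" using le by (intro mult_left_mono) auto
    finally show ?thesis by (simp add: mult.commute)
  qed
  then show ?thesis using B(1) by (intro exI[of _ "B + 1"]) auto
qed

definition S :: real
  where "S = Inf {Q u u | u. u \<in> H \<and> power_integral u = 1}"

lemma unit_power_integral:
  assumes u: "u \<in> H" and nz: "power_integral u \<noteq> 0"
  defines "t \<equiv> power_integral u powr (- 1 / p)"
  shows "power_integral (\<lambda>x. t * u x) = 1" "t > 0"
proof -
  have pos: "power_integral u > 0" using nz power_integral_nonneg[of u] by simp
  then show "t > 0" by (simp add: t_def)
  have "t powr p = power_integral u powr (- 1)" using p_gt_2 by (simp add: t_def powr_powr)
  then show "power_integral (\<lambda>x. t * u x) = 1"
    using \<open>t > 0\<close> pos by (simp add: power_integral_mult powr_minus)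
qed

lemma S_set_nonempty: "{Q u u | u. u \<in> H \<and> power_integral u = 1} \<noteq> {}"
proof -
  obtain u where u: "u \<in> H" "\<not> (AE x in lborel. u x = 0)" using H_nontrivial by auto
  then have "power_integral u \<noteq> 0" using power_integral_eq_0 by simp
  from unit_power_integral(1)[OF u(1) this] show ?thesis using H_mult[OF u(1)] by blast
qed

lemma S_bdd: "bdd_below {Q u u | u. u \<in> H \<and> power_integral u = 1}"
  by (rule bdd_belowI[of _ 0]) (auto intro: Q_nonneg)

lemma S_pos: "S > 0"
proof -
  obtain B where B: "B > 0" "\<And>u. u \<in> H \<Longrightarrow> power_integral u \<le> B * Q u u powr (p / 2)"
    using power_integral_le by auto
  have "(1 / B) powr (2 / p) \<le> S"
    unfolding S_def
  proof (rule cInf_greatest[OF S_set_nonempty])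
    fix x assume "x \<in> {Q u u | u. u \<in> H \<and> power_integral u = 1}"
    then obtain u where u: "u \<in> H" "power_integral u = 1" "x = Q u u" by auto
    have "1 / B \<le> x powr (p / 2)" using B(2)[OF u(1)] B(1) u by (simp add: field_simps)
    then have "(1 / B) powr (2 / p) \<le> (x powr (p / 2)) powr (2 / p)"
      using B(1) p_gt_2 by (intro powr_mono2) auto
    also have "\<dots> = x" using Q_nonneg[OF u(1)] u(3) p_gt_2 by (simp add: powr_powr)
    finally show "(1 / B) powr (2 / p) \<le> x" .
  qed
  moreover have "0 < (1 / B) powr (2 / p)" using B(1) by simp
  ultimately show ?thesis by linarith
qed

lemma S_le:
  assumes u: "u \<in> H"
  shows "S * power_integral u powr (2 / p) \<le> Q u u"
proof (cases "power_integral u = 0")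
  case True then show ?thesis using Q_nonneg[OF u] by simp
next
  case False
  let ?t = "power_integral u powr (- 1 / p)"
  have pos: "power_integral u > 0" using False power_integral_nonneg[of u] by simp
  have "S \<le> Q (\<lambda>x. ?t * u x) (\<lambda>x. ?t * u x)"
    unfolding S_def using unit_power_integral[OF u False] H_mult[OF u] by (intro cInf_lower S_bdd) blast
  also have "\<dots> = ?t\<^sup>2 * Q u u" by (rule Q_square_mult[OF u])
  also have "?t\<^sup>2 = power_integral u powr (- (2 / p))"
    by (simp add: power2_eq_square flip: powr_add)
  finally have "S * power_integral u powr (2 / p) \<le> power_integral u powr (- (2 / p)) * Q u u * power_integral u powr (2 / p)"
    by (rule mult_right_mono) simp
  also have "\<dots> = Q u u" using pos by (simp add: powr_minus)
  finally show ?thesis .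
qed

text \<open>
  By the Hoelder inequality \<open>power_integral (u + t * v) powr (1 / p) \<ge> 1 + t * a\<close>, where \<open>a\<close> is the integral of
  \<open>signed_powr p u * v\<close>. So
  \<open>Q u u - S + 2 * t * (Q u v - S * a) + t^2 * Q v v\<close> is nonnegative for all \<open>t\<close>; its
  discriminant bounds the defect of \<open>u\<close> in the Euler-Lagrange equation.
\<close>

lemma almost_minimiser_almost_critical:
  assumes u: "u \<in> H" and one: "power_integral u = 1" and v: "v \<in> H"
  shows "(Q u v - S * (LINT x|lborel. signed_powr p (u x) * v x))\<^sup>2 \<le> (Q u u - S) * (Q v v + 1)"
proof (rule quadratic_nonneg_imp[OF _ Q_nonneg[OF v]])
  fix t
  let ?a = "LINT x|lborel. signed_powr p (u x) * v x"
  let ?w = "\<lambda>x. u x + t * v x"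
  have tv: "(\<lambda>x. t * v x) \<in> H" by (rule H_mult[OF v])
  have w: "?w \<in> H" by (rule H_add[OF u tv])
  have p1: "p > 1" using p_gt_2 by simp
  have i: "integrable lborel (\<lambda>x. signed_powr p (u x) * v x)" "integrable lborel (\<lambda>x. signed_powr p (u x) * u x)"
    by (intro integrable_signed_powr_mult H_borel power_integrable u v p1)+
  have "(LINT x|lborel. signed_powr p (u x) * ?w x) = (LINT x|lborel. signed_powr p (u x) * u x + t * (signed_powr p (u x) * v x))"
    by (simp add: distrib_left mult.left_commute)
  also have "\<dots> = (LINT x|lborel. signed_powr p (u x) * u x) + t * ?a" using i by simp
  also have "(LINT x|lborel. signed_powr p (u x) * u x) = 1"
    unfolding signed_powr_mult_self using one by (simp add: power_integral_def)
  finally have a: "1 + t * ?a = (LINT x|lborel. signed_powr p (u x) * ?w x)" ..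
  define \<tau> where "\<tau> = power_integral ?w powr (1 / p)"
  have "1 + t * ?a \<le> \<tau>"
    unfolding a \<tau>_def power_integral_def
    using one by (intro Hoelder_signed_powr H_borel power_integrable u w p1) (simp add: power_integral_def)
  moreover have "0 \<le> (\<tau> - 1)\<^sup>2" by simp
  ultimately have "1 + 2 * t * ?a \<le> \<tau>\<^sup>2" by (simp add: power2_eq_square algebra_simps)
  also have "\<tau>\<^sup>2 = power_integral ?w powr (2 / p)" by (simp add: \<tau>_def power2_eq_square flip: powr_add)
  finally have "S * (1 + 2 * t * ?a) \<le> S * power_integral ?w powr (2 / p)" using S_pos by simp
  also have "\<dots> \<le> Q ?w ?w" by (rule S_le[OF w])
  also have "\<dots> = Q u u + 2 * (t * Q u v) + t\<^sup>2 * Q v v"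
    using Q_square_add[OF u tv] by (simp add: Q_mult_right u v Q_square_mult)
  finally show "0 \<le> (Q u u - S) + 2 * t * (Q u v - S * ?a) + t\<^sup>2 * Q v v" by (simp add: algebra_simps)
qed

lemma minimising_sequence:
  obtains u where "\<And>k. u k \<in> H" "\<And>k. power_integral (u k) = 1" "\<And>k. Q (u k) (u k) < S + 1 / real (Suc k)"
proof -
  have "\<exists>u. u \<in> H \<and> power_integral u = 1 \<and> Q u u < S + 1 / real (Suc k)" for k
  proof -
    have "S < S + 1 / real (Suc k)" by simp
    from cInf_lessD[OF S_set_nonempty this[unfolded S_def]]
    show ?thesis unfolding S_def by blast
  qed
  then show ?thesis using that by metis
qed

lemma S_lower: "u \<in> H \<Longrightarrow> power_integral u = 1 \<Longrightarrow> S \<le> Q u u"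
  using S_le[of u] by simp

lemma power_integral_translate: "u \<in> H \<Longrightarrow> power_integral (\<lambda>x. u (x + y)) = power_integral u"
  unfolding power_integral_def
  using integral_translate[of "\<lambda>x. \<bar>u x\<bar> powr p" y] H_borel[of u] by simp

lemma nonlinearity_converges:
  assumes u: "\<And>k. u k \<in> H" "\<And>k. power_integral (u k) = 1" and w: "w \<in> H" and v: "v \<in> H"
    and lim: "AE x in lborel. (\<lambda>k. u k x) \<longlonglongrightarrow> w x"
  shows "(\<lambda>k. LINT x|lborel. signed_powr p (u k x) * v x) \<longlonglongrightarrow> (LINT x|lborel. signed_powr p (w x) * v x)"
proof -
  have p1: "p > 1" using p_gt_2 by simp
  have [measurable]: "u k \<in> borel_measurable borel" "w \<in> borel_measurable borel" "v \<in> borel_measurable borel" for k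
    using u w v by (auto intro: H_borel)
  have i: "integrable lborel (\<lambda>x. signed_powr p (u k x) * v x)" "integrable lborel (\<lambda>x. signed_powr p (w x) * v x)" for k
    by (intro integrable_signed_powr_mult H_borel power_integrable u v w p1)+
  have "(\<lambda>k. LINT x|lborel. \<bar>signed_powr p (u k x) * v x - signed_powr p (w x) * v x\<bar>) \<longlonglongrightarrow> 0"
  proof (rule integral_tendsto_0_of_split_bound(1)[where h="\<lambda>k x. \<bar>u k x\<bar> powr p" and C=1])
    show "AE x in lborel. (\<lambda>k. \<bar>signed_powr p (u k x) * v x - signed_powr p (w x) * v x\<bar>) \<longlonglongrightarrow> 0"
      using lim
    proof eventually_elim
      case (elim x)
      have "(\<lambda>k. \<bar>signed_powr p (u k x) * v x - signed_powr p (w x) * v x\<bar>) \<longlonglongrightarrow> \<bar>signed_powr p (w x) * v x - signed_powr p (w x) * v x\<bar>"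
        by (intro tendsto_intros signed_powr_tendsto p_gt_2 elim)
      then show ?case by simp
    qed
    show "integrable lborel (\<lambda>x. \<bar>u k x\<bar> powr p)" for k by (rule power_integrable[OF u(1)])
    show "(LINT x|lborel. \<bar>u k x\<bar> powr p) \<le> 1" for k using u(2)[of k] by (simp add: power_integral_def)
    fix \<epsilon> :: real assume \<epsilon>: "\<epsilon> > 0"
    show "\<exists>h. integrable lborel h \<and> (\<forall>k x. \<bar>signed_powr p (u k x) * v x - signed_powr p (w x) * v x\<bar> \<le> \<epsilon> * \<bar>u k x\<bar> powr p + h x)"
    proof (intro exI[of _ "\<lambda>x. \<epsilon> powr (1 - p) * \<bar>v x\<bar> powr p + \<bar>signed_powr p (w x) * v x\<bar>"] conjI allI)
      show "integrable lborel (\<lambda>x. \<epsilon> powr (1 - p) * \<bar>v x\<bar> powr p + \<bar>signed_powr p (w x) * v x\<bar>)"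
        by (intro Bochner_Integration.integrable_add integrable_mult_right integrable_abs i power_integrable v)
      fix k x
      show "\<bar>signed_powr p (u k x) * v x - signed_powr p (w x) * v x\<bar>
        \<le> \<epsilon> * \<bar>u k x\<bar> powr p + (\<epsilon> powr (1 - p) * \<bar>v x\<bar> powr p + \<bar>signed_powr p (w x) * v x\<bar>)"
        using signed_powr_split[OF \<epsilon> p1, of "u k x" "v x"] abs_triangle_ineq4[of "signed_powr p (u k x) * v x" "signed_powr p (w x) * v x"]
        by linarith
    qed
  qed auto
  then have "(\<lambda>k. LINT x|lborel. signed_powr p (u k x) * v x - signed_powr p (w x) * v x) \<longlonglongrightarrow> 0"
    by (rule Lim_null_comparison[rotated]) (auto intro!: always_eventually integral_abs_bound)
  then have "(\<lambda>k. (LINT x|lborel. signed_powr p (u k x) * v x) - (LINT x|lborel. signed_powr p (w x) * v x)) \<longlonglongrightarrow> 0"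
    using i by simp
  then show ?thesis by (rule LIM_zero_cancel)
qed

text \<open>
  The minimising sequence is translated such that the averages at the origin stay away from 0. Its weak
  limit is then nonzero, and the defect of the Euler-Lagrange equation tends to 0 along the sequence. The
  bound \<open>Q w w \<le> S\<close> is the limit of \<open>2 * Q u w \<le> Q u u + Q w w\<close>.
\<close>

lemma minimiser_equation:
  "\<exists>w\<in>H. \<not> (AE x in lborel. w x = 0) \<and> Q w w \<le> S \<and>
    (\<forall>v\<in>H. Q w v = S * (LINT x|lborel. signed_powr p (w x) * v x))"
proof -
  obtain u where u: "\<And>k. u k \<in> H" "\<And>k. power_integral (u k) = 1" "\<And>k. Q (u k) (u k) < S + 1 / real (Suc k)"
    using minimising_sequence by blast
  define K where "K = c * (S + 1)"
  have K: "K \<ge> 0" using c_pos S_pos by (simp add: K_def)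
  have S1: "Q f f \<le> S + 1" if "Q f f < S + 1 / real (Suc k)" for f k
  proof -
    have "1 / real (Suc k) \<le> 1" by simp
    with that show ?thesis by linarith
  qed
  obtain r \<delta> where r: "r > 0" and \<delta>: "\<delta> > 0"
    and nv: "\<And>f. f \<in> half_modulus K \<Longrightarrow> power_integral f = 1 \<Longrightarrow> \<exists>x. \<delta> \<le> \<bar>ball_average r f x\<bar>"
    using half_modulus_nonvanishing[where 'a='a, OF dim p_gt_2 p_subcritical K] unfolding power_integral_def by metis
  have "\<exists>x. \<delta> \<le> \<bar>ball_average r (u k) x\<bar>" for k
    using H_half_modulus[OF u(1) S1[OF u(3)]] by (intro nv u(2)) (simp add: K_def)
  then obtain y where y: "\<And>k. \<delta> \<le> \<bar>ball_average r (u k) (y k)\<bar>" by metis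
  define f where "f k x = u k (x + y k)" for k x
  have f: "f k \<in> H" "power_integral (f k) = 1" "Q (f k) (f k) < S + 1 / real (Suc k)" for k
    unfolding f_def using u[of k] by (auto simp: H_translate power_integral_translate Q_translate)
  have avg: "\<delta> \<le> \<bar>ball_average r (f k) 0\<bar>" for k
    using y[of k] by (simp add: ball_average_def f_def add.commute)
  have fK: "f k \<in> half_modulus K" for k
    using H_half_modulus[OF f(1) S1[OF f(3)]] by (simp add: K_def)
  obtain s w where s: "strict_mono (s :: nat \<Rightarrow> nat)" and wsq: "square_integrable w" "mean_square w \<le> K"
    and lim: "AE x in lborel. (\<lambda>k. f (s k) x) \<longlonglongrightarrow> w x"
    using half_modulus_compact[of f K, OF fK] by blast
  have weak: "(\<lambda>k. LINT x|lborel. f (s k) x * g x) \<longlonglongrightarrow> (LINT x|lborel. w x * g x)" if "square_integrable g" for g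
    using half_modulusD(1,2)[OF fK] by (intro mean_square_bounded_weak_limit[where K=K] wsq lim that)
  have Qlim: "w \<in> H \<and> (\<forall>v\<in>H. (\<lambda>k. Q (f (s k)) v) \<longlonglongrightarrow> Q w v)"
    by (rule Q_weak_limit[where us="\<lambda>k. f (s k)" and K="S + 1"]) (use f(1) S1[OF f(3)] wsq(1) weak in auto)
  then have w: "w \<in> H" by simp
  have QS: "(\<lambda>k. Q (f (s k)) (f (s k))) \<longlonglongrightarrow> S"
  proof (rule tendsto_sandwich)
    show "eventually (\<lambda>k. S \<le> Q (f (s k)) (f (s k))) sequentially"
      using S_lower[OF f(1,2)] by simp
    show "eventually (\<lambda>k. Q (f (s k)) (f (s k)) \<le> S + 1 / real (Suc (s k))) sequentially"
      using f(3) by (simp add: less_imp_le)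
    have "(\<lambda>k. 1 / real (Suc k)) \<longlonglongrightarrow> 0" using LIMSEQ_inverse_real_of_nat by (simp add: inverse_eq_divide)
    then have "(\<lambda>k. 1 / real (Suc (s k))) \<longlonglongrightarrow> 0" using LIMSEQ_subseq_LIMSEQ[OF _ s] by (simp add: o_def)
    then have "(\<lambda>k. S + 1 / real (Suc (s k))) \<longlonglongrightarrow> S + 0" by (intro tendsto_intros)
    then show "(\<lambda>k. S + 1 / real (Suc (s k))) \<longlonglongrightarrow> S" by simp
  qed simp
  have nz: "\<not> (AE x in lborel. w x = 0)"
  proof
    assume 0: "AE x in lborel. w x = 0"
    have [measurable]: "w \<in> borel_measurable borel" by (rule H_borel[OF w])
    have "(LINT x|lborel. w x * indicator (ball 0 r) x) = (LINT x|lborel. 0 * indicator (ball (0::'a) r) x)"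
      using 0 by (intro integral_cong_AE) auto
    with weak[OF square_integrable_ball[of r]]
    have "(\<lambda>k. LINT x|lborel. f (s k) x * indicator (ball 0 r) x) \<longlonglongrightarrow> 0" by simp
    then have "(\<lambda>k. \<bar>(LINT x|lborel. f (s k) x * indicator (ball 0 r) x) / measure lborel (ball (0::'a) r)\<bar>) \<longlonglongrightarrow> \<bar>0 / measure lborel (ball (0::'a) r)\<bar>"
      using measure_ball_pos[OF r, where 'a='a] by (intro tendsto_intros) auto
    then have "(\<lambda>k. \<bar>ball_average r (f (s k)) 0\<bar>) \<longlonglongrightarrow> 0" by (simp add: ball_average_def mult.commute)
    then have "\<delta> \<le> 0" using avg by (intro LIMSEQ_le_const) auto
    then show False using \<delta> by simp
  qed
  have "Q w w \<le> S"
  proof -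
    have nn: "2 * Q (f (s k)) w \<le> Q (f (s k)) (f (s k)) + Q w w" for k
    proof -
      have mw: "(\<lambda>x. (-1) * w x) \<in> H" by (rule H_mult[OF w])
      have "0 \<le> Q (\<lambda>x. f (s k) x + (-1) * w x) (\<lambda>x. f (s k) x + (-1) * w x)"
        by (rule Q_nonneg[OF H_add[OF f(1) mw]])
      also have "\<dots> = Q (f (s k)) (f (s k)) + 2 * ((-1) * Q (f (s k)) w) + (-1)\<^sup>2 * Q w w"
        unfolding Q_square_add[OF f(1) mw] Q_mult_right[OF w f(1)] Q_square_mult[OF w] ..
      finally show ?thesis by simp
    qed
    have "2 * Q w w \<le> S + Q w w"
    proof (rule LIMSEQ_le)
      show "(\<lambda>k. 2 * Q (f (s k)) w) \<longlonglongrightarrow> 2 * Q w w" using Qlim w by (intro tendsto_intros) auto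
      show "(\<lambda>k. Q (f (s k)) (f (s k)) + Q w w) \<longlonglongrightarrow> S + Q w w" by (intro tendsto_intros QS)
    qed (use nn in auto)
    then show ?thesis by simp
  qed
  moreover have "Q w v = S * (LINT x|lborel. signed_powr p (w x) * v x)" if v: "v \<in> H" for v
  proof -
    let ?b = "\<lambda>g. LINT x|lborel. signed_powr p (g x) * v x"
    have "(\<lambda>k. (Q (f (s k)) v - S * ?b (f (s k)))\<^sup>2) \<longlonglongrightarrow> (Q w v - S * ?b w)\<^sup>2"
      using Qlim v by (intro tendsto_intros nonlinearity_converges f w lim) auto
    moreover have "(\<lambda>k. (Q (f (s k)) (f (s k)) - S) * (Q v v + 1)) \<longlonglongrightarrow> (S - S) * (Q v v + 1)"
      by (intro tendsto_intros QS)
    ultimately have "(Q w v - S * ?b w)\<^sup>2 \<le> (S - S) * (Q v v + 1)"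
      by (rule LIMSEQ_le) (use almost_minimiser_almost_critical[OF f(1,2) v] in auto)
    then show ?thesis by simp
  qed
  ultimately show ?thesis using w nz by blast
qed

text \<open>
  Rescaling by \<open>t\<close> with \<open>t powr (p - 2) = S\<close> absorbs the Lagrange multiplier. The form of the rescaled function is at most
  \<open>t^2 * S = S powr (p / (p - 2))\<close>, and \<open>S_le\<close> bounds the form of every competitor below by the same number.
\<close>

lemma least_form_solution:
  "\<exists>g\<in>H. \<not> (AE x in lborel. g x = 0) \<and> (\<forall>v\<in>H. Q g v = (LINT x|lborel. signed_powr p (g x) * v x)) \<and>
    (\<forall>v\<in>H. \<not> (AE x in lborel. v x = 0) \<longrightarrow> Q v v = power_integral v \<longrightarrow> Q g g \<le> Q v v)"
proof -
  obtain w where w: "w \<in> H" "\<not> (AE x in lborel. w x = 0)" "Q w w \<le> S"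
    "\<And>v. v \<in> H \<Longrightarrow> Q w v = S * (LINT x|lborel. signed_powr p (w x) * v x)"
    using minimiser_equation by blast
  define t where "t = S powr (1 / (p - 2))"
  have t: "t > 0" using S_pos by (simp add: t_def)
  have tp: "t powr (p - 2) = S" using S_pos p_gt_2 by (simp add: t_def powr_powr)
  let ?g = "\<lambda>x. t * w x"
  have "Q ?g v = (LINT x|lborel. signed_powr p (?g x) * v x)" if v: "v \<in> H" for v
  proof -
    have "t powr (p - 1) = t powr (p - 2) * t powr 1" by (simp only: powr_add[symmetric]) simp
    then have tp1: "t powr (p - 1) = S * t" using t by (simp add: tp)
    have "(LINT x|lborel. signed_powr p (?g x) * v x) = (LINT x|lborel. (S * t) * (signed_powr p (w x) * v x))"
      by (simp add: signed_powr_mult[OF t] tp1 mult.assoc)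
    also have "\<dots> = (S * t) * (LINT x|lborel. signed_powr p (w x) * v x)" by (rule integral_mult_right_zero)
    finally show ?thesis using w(4)[OF v] by (simp add: Q_mult[OF w(1) v])
  qed
  moreover have "\<not> (AE x in lborel. ?g x = 0)" using w(2) t by simp
  moreover have "Q ?g ?g \<le> Q v v" if v: "v \<in> H" "\<not> (AE x in lborel. v x = 0)" "Q v v = power_integral v" for v
  proof -
    have N: "power_integral v > 0" using power_integral_eq_0[OF v(1)] v(2) power_integral_nonneg[of v] by simp
    have "S * power_integral v powr (2 / p) \<le> power_integral v" using S_le[OF v(1)] v(3) by simp
    also have "\<dots> = power_integral v powr ((p - 2) / p) * power_integral v powr (2 / p)"
      using N p_gt_2 by (simp add: powr_add[symmetric] add_divide_distrib[symmetric])
    finally have "S \<le> power_integral v powr ((p - 2) / p)" using N by simp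
    then have "S powr (p / (p - 2)) \<le> (power_integral v powr ((p - 2) / p)) powr (p / (p - 2))"
      using S_pos p_gt_2 by (intro powr_mono2) auto
    also have "\<dots> = power_integral v" using N p_gt_2 by (simp add: powr_powr)
    finally have le: "S powr (p / (p - 2)) \<le> power_integral v" .
    have "Q ?g ?g = t\<^sup>2 * Q w w" by (rule Q_square_mult[OF w(1)])
    also have "\<dots> \<le> t\<^sup>2 * S" using w(3) by (intro mult_left_mono) auto
    also have "\<dots> = S powr (2 / (p - 2)) * S powr 1" using S_pos by (simp add: t_def power2_eq_square flip: powr_add)
    also have "\<dots> = S powr (p / (p - 2))"
    proof -
      have "2 / (p - 2) + 1 = p / (p - 2)" using p_gt_2 by (simp add: field_simps)
      then show ?thesis by (simp only: powr_add[symmetric])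
    qed
    also have "\<dots> \<le> power_integral v" by (rule le)
    finally show ?thesis by (simp only: v(3))
  qed
  ultimately show ?thesis by (intro bexI[of _ ?g] conjI ballI impI H_mult[OF w(1)])
qed

text \<open>
  The energy functional of the equation, in terms of the form.
\<close>

definition action :: "('a \<Rightarrow> real) \<Rightarrow> real"
  where "action u = 1 / 2 * Q u u - 1 / p * power_integral u"

text \<open>
  The terms of first order cancel by the equation; the form is quadratic, and the remainder of the power
  integral is quadratic by Taylor's formula and the embedding.
\<close>

lemma solution_imp_quadratic_bound:
  assumes g: "g \<in> H" and eq: "\<And>v. v \<in> H \<Longrightarrow> Q g v = (LINT x|lborel. signed_powr p (g x) * v x)"
  shows "\<exists>M>0. \<forall>h\<in>H. Q h h \<le> 1 \<longrightarrow> \<bar>action (\<lambda>x. g x + h x) - action g\<bar> \<le> M * Q h h"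
proof -
  obtain B where B: "B > 0" "\<And>u. u \<in> H \<Longrightarrow> power_integral u \<le> B * Q u u powr (p / 2)"
    using power_integral_le by auto
  define C where "C = p * (p - 1) * 2 powr (p - 2)"
  have C: "C > 0" using p_gt_2 by (simp add: C_def)
  define M where "M = 1 / 2 + C / p * (power_integral g + 2 * B)"
  have M: "M > 0" using C p_gt_2 B(1) power_integral_nonneg[of g] by (simp add: M_def add_pos_nonneg)
  have "\<bar>action (\<lambda>x. g x + h x) - action g\<bar> \<le> M * Q h h" if h: "h \<in> H" "Q h h \<le> 1" for h
  proof (cases "Q h h = 0")
    case True
    have 0: "AE x in lborel. h x = 0" by (rule Q_eq_0_imp[OF h(1) True])
    have [measurable]: "g \<in> borel_measurable borel" "h \<in> borel_measurable borel" by (intro H_borel g h)+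
    have "power_integral (\<lambda>x. g x + h x) = power_integral g"
      unfolding power_integral_def using 0 by (intro integral_cong_AE) auto
    moreover have "Q g h = (LINT x|lborel. signed_powr p (g x) * 0)"
      unfolding eq[OF h(1)] using 0 by (intro integral_cong_AE) auto
    ultimately show ?thesis using True by (simp add: action_def Q_square_add[OF g h(1)])
  next
    case False
    define s where "s = sqrt (Q h h)"
    have s: "s > 0" "s\<^sup>2 = Q h h" "s \<le> 1" using False Q_nonneg[OF h(1)] h(2) by (auto simp: s_def)
    have gh: "(\<lambda>x. g x + h x) \<in> H" by (rule H_add[OF g h(1)])
    have hs: "(\<lambda>x. h x / s) \<in> H" using H_mult[OF h(1), of "1 / s"] by simp
    have p1: "p > 1" using p_gt_2 by simp
    have i: "integrable lborel (\<lambda>x. \<bar>g x + h x\<bar> powr p)" "integrable lborel (\<lambda>x. \<bar>g x\<bar> powr p)"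
      "integrable lborel (\<lambda>x. \<bar>h x\<bar> powr p)" "integrable lborel (\<lambda>x. \<bar>h x / s\<bar> powr p)"
      by (intro power_integrable gh g h hs)+
    have ig: "integrable lborel (\<lambda>x. signed_powr p (g x) * h x)"
      by (intro integrable_signed_powr_mult H_borel g h i p1)
    have "Q (\<lambda>x. h x / s) (\<lambda>x. h x / s) = 1"
      using Q_square_mult[OF h(1), of "1 / s"] s False by (simp add: power_divide)
    then have Bs: "power_integral (\<lambda>x. h x / s) \<le> B" using B(2)[OF hs] by simp
    have Bh: "power_integral h \<le> B * s\<^sup>2"
    proof -
      have "power_integral h \<le> B * (s\<^sup>2) powr (p / 2)" using B(2)[OF h(1)] s(2) by simp
      also have "(s\<^sup>2) powr (p / 2) \<le> (s\<^sup>2) powr 1"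
        using s(1,3) p_gt_2 by (intro powr_mono') (auto simp: power_le_one)
      finally show ?thesis using B(1) Q_nonneg[OF h(1)] s(2) by simp
    qed
    let ?R = "\<lambda>x. \<bar>g x + h x\<bar> powr p - \<bar>g x\<bar> powr p - p * (signed_powr p (g x) * h x)"
    have Ri: "integrable lborel ?R" by (intro Bochner_Integration.integrable_diff i integrable_mult_right ig)
    have "\<bar>LINT x|lborel. ?R x\<bar> \<le> (LINT x|lborel. \<bar>?R x\<bar>)" by (rule integral_abs_bound)
    also have "\<dots> \<le> (LINT x|lborel. C * (s\<^sup>2 * (\<bar>g x\<bar> powr p + \<bar>h x / s\<bar> powr p) + \<bar>h x\<bar> powr p))"
    proof (rule integral_mono)
      show "integrable lborel (\<lambda>x. \<bar>?R x\<bar>)" by (rule integrable_abs[OF Ri])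
      show "integrable lborel (\<lambda>x. C * (s\<^sup>2 * (\<bar>g x\<bar> powr p + \<bar>h x / s\<bar> powr p) + \<bar>h x\<bar> powr p))"
        by (intro integrable_mult_right Bochner_Integration.integrable_add i)
      fix x
      have "\<bar>?R x\<bar> \<le> C * (\<bar>g x\<bar> powr (p - 2) * (h x)\<^sup>2 + \<bar>h x\<bar> powr p)"
        unfolding C_def by (rule abs_powr_Taylor[OF p_gt_2])
      also have "\<dots> \<le> C * (s\<^sup>2 * (\<bar>g x\<bar> powr p + \<bar>h x / s\<bar> powr p) + \<bar>h x\<bar> powr p)"
        using C by (intro mult_left_mono add_right_mono powr_mult_square_le p_gt_2 s) auto
      finally show "\<bar>?R x\<bar> \<le> C * (s\<^sup>2 * (\<bar>g x\<bar> powr p + \<bar>h x / s\<bar> powr p) + \<bar>h x\<bar> powr p)" .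
    qed
    also have "\<dots> = C * (s\<^sup>2 * (power_integral g + power_integral (\<lambda>x. h x / s)) + power_integral h)"
      using i by (simp add: power_integral_def)
    also have "\<dots> \<le> C * (s\<^sup>2 * (power_integral g + B) + B * s\<^sup>2)"
      using C Bs Bh by (intro mult_left_mono add_mono) auto
    also have "\<dots> = C * (power_integral g + 2 * B) * s\<^sup>2" by (simp add: algebra_simps)
    finally have R: "\<bar>LINT x|lborel. ?R x\<bar> \<le> C * (power_integral g + 2 * B) * s\<^sup>2" .
    have Req: "(LINT x|lborel. ?R x) = power_integral (\<lambda>x. g x + h x) - power_integral g - p * Q g h"
      using i ig by (simp add: power_integral_def eq[OF h(1)])
    have diff: "action (\<lambda>x. g x + h x) - action g = 1 / 2 * s\<^sup>2 - 1 / p * (LINT x|lborel. ?R x)"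
      unfolding Req action_def Q_square_add[OF g h(1)] s(2) using p_gt_2 by (simp add: field_simps)
    have "\<bar>1 / 2 * s\<^sup>2 - 1 / p * (LINT x|lborel. ?R x)\<bar> \<le> 1 / 2 * s\<^sup>2 + 1 / p * \<bar>LINT x|lborel. ?R x\<bar>"
      using p_gt_2 by (intro order_trans[OF abs_triangle_ineq4]) (simp add: abs_mult)
    also have "\<dots> \<le> 1 / 2 * s\<^sup>2 + 1 / p * (C * (power_integral g + 2 * B) * s\<^sup>2)"
      using p_gt_2 R by (intro add_left_mono mult_left_mono) auto
    also have "\<dots> = M * s\<^sup>2" by (simp add: M_def algebra_simps)
    finally show ?thesis by (simp only: diff s(2))
  qed
  with M show ?thesis by blast
qed

text \<open>
  Along the ray through \<open>v\<close> the derivative of the action at \<open>v\<close> is \<open>Q v v - power_integral v\<close>.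
\<close>

lemma critical_imp_Nehari:
  assumes v: "v \<in> H" and crit: "\<And>\<epsilon>. \<epsilon> > 0 \<Longrightarrow> \<exists>\<delta>>0. \<forall>t. \<bar>t\<bar> < \<delta> \<longrightarrow> \<bar>action (\<lambda>x. v x + t * v x) - action v\<bar> \<le> \<epsilon> * \<bar>t\<bar>"
  shows "Q v v = power_integral v"
proof -
  define G where "G t = 1 / 2 * (1 + t)\<^sup>2 * Q v v - 1 / p * (\<bar>1 + t\<bar> powr p * power_integral v)" for t
  have G: "action (\<lambda>x. v x + t * v x) = G t" for t
  proof -
    have "(\<lambda>x. v x + t * v x) = (\<lambda>x. (1 + t) * v x)" by (simp add: distrib_right)
    then show ?thesis by (simp add: action_def G_def Q_square_mult[OF v] power_integral_mult)
  qed
  have G0: "action v = G 0" using G[of 0] by simp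
  have d: "((\<lambda>t. \<bar>1 + t\<bar> powr p) has_real_derivative p) (at 0)"
  proof -
    have "((\<lambda>t. \<bar>1 + t\<bar> powr p) has_real_derivative (p * signed_powr p (1 + 0)) * 1) (at 0)"
    proof (rule DERIV_chain2[where f="\<lambda>x. \<bar>x\<bar> powr p" and g="\<lambda>t. 1 + t"])
      show "((\<lambda>x. \<bar>x\<bar> powr p) has_real_derivative p * signed_powr p (1 + 0)) (at (1 + 0))"
        using p_gt_2 by (intro abs_powr_has_derivative) simp
    qed (auto intro!: derivative_eq_intros)
    then show ?thesis by (simp add: signed_powr_def)
  qed
  have "(G has_real_derivative (Q v v - power_integral v)) (at 0)"
  proof -
    have "((\<lambda>t. 1 / 2 * (1 + t)\<^sup>2 * Q v v) has_real_derivative Q v v) (at 0)"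
      by (auto intro!: derivative_eq_intros)
    moreover have "((\<lambda>t. 1 / p * (\<bar>1 + t\<bar> powr p * power_integral v)) has_real_derivative 1 / p * (p * power_integral v)) (at 0)"
      by (intro DERIV_cmult DERIV_cmult_right d)
    ultimately have "(G has_real_derivative (Q v v - 1 / p * (p * power_integral v))) (at 0)"
      unfolding G_def by (rule DERIV_diff)
    then show ?thesis using p_gt_2 by simp
  qed
  then have "((\<lambda>t. (G t - G 0) / t) \<longlongrightarrow> Q v v - power_integral v) (at 0)"
    by (simp add: has_field_derivative_iff)
  moreover have "((\<lambda>t. (G t - G 0) / t) \<longlongrightarrow> 0) (at 0)"
  proof (rule LIM_I)
    fix e :: real assume e: "e > 0"
    obtain \<delta> where \<delta>: "\<delta> > 0" "\<And>t. \<bar>t\<bar> < \<delta> \<Longrightarrow> \<bar>G t - G 0\<bar> \<le> e / 2 * \<bar>t\<bar>"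
      using crit[of "e / 2"] e unfolding G G0 by auto
    show "\<exists>s>0. \<forall>t. t \<noteq> 0 \<and> norm (t - 0) < s \<longrightarrow> norm ((G t - G 0) / t - 0) < e"
    proof (intro exI[of _ \<delta>] conjI allI impI \<delta>(1))
      fix t :: real assume t: "t \<noteq> 0 \<and> norm (t - 0) < \<delta>"
      then have "\<bar>G t - G 0\<bar> / \<bar>t\<bar> \<le> e / 2" using \<delta>(2)[of t] by (simp add: pos_divide_le_eq)
      moreover have "norm ((G t - G 0) / t - 0) = \<bar>G t - G 0\<bar> / \<bar>t\<bar>" by (simp add: abs_divide)
      ultimately show "norm ((G t - G 0) / t - 0) < e" using e by linarith
    qed
  qed
  ultimately show ?thesis using LIM_unique by force
qed

end

section \<open>Ground states\<close>

context elliptic_symbol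
begin

lemma translation_invariant_form: "translation_invariant_form (sobolev (1 / 2)) form (2 / a)"
proof
  show "0 < 2 / a" using a_pos by simp
  show "\<exists>u\<in>sobolev (1 / 2). \<not> (AE x::'a in lborel. u x = 0)"
  proof (intro bexI[of _ gauss] notI gauss_sobolev)
    assume "AE x::'a in lborel. gauss x = 0"
    then have "(LINT x::'a|lborel. gauss x) = (LINT x::'a|lborel. 0)" by (intro integral_cong_AE) auto
    then show False by (simp add: integral_gauss)
  qed
next
  fix us :: "nat \<Rightarrow> 'a \<Rightarrow> real" and K u'
  assume "\<And>k. us k \<in> sobolev (1 / 2)" "\<And>k. form (us k) (us k) \<le> K" "square_integrable u'"
    "\<And>f. square_integrable f \<Longrightarrow> (\<lambda>k. LINT x|lborel. us k x * f x) \<longlonglongrightarrow> (LINT x|lborel. u' x * f x)"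
  then show "u' \<in> sobolev (1 / 2) \<and> (\<forall>v\<in>sobolev (1 / 2). (\<lambda>k. form (us k) v) \<longlonglongrightarrow> form u' v)"
    using form_weak_limit[of us K u'] by blast
qed (rule sobolev_square_integrable sobolev_add sobolev_mult sobolev_translate form_add_left form_mult_left
  form_translate mean_square_le_form mean_square_translate_diff_le form_commute; assumption)+

lemma sobolev_norm_nonneg: "0 \<le> sobolev_norm (1 / 2) (u :: 'a \<Rightarrow> real)"
  unfolding sobolev_norm_def by (intro real_sqrt_ge_zero Bochner_Integration.integral_nonneg) simp

lemma sobolev_norm_square: "(sobolev_norm (1 / 2) (u :: 'a \<Rightarrow> real))\<^sup>2 = (LINT \<xi>|lborel. (1 + (norm \<xi>)\<^sup>2) powr (1 / 2) * (cmod (fourier u \<xi>))\<^sup>2)"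
  unfolding sobolev_norm_def by (intro real_sqrt_pow2 Bochner_Integration.integral_nonneg) simp

lemma form_le_sobolev_norm:
  assumes u: "u \<in> sobolev (1 / 2)"
  shows "form u u \<le> b * (sobolev_norm (1 / 2) u)\<^sup>2"
proof -
  have i: "integrable lborel (\<lambda>\<xi>. (1 + (norm \<xi>)\<^sup>2) powr (1 / 2) * (cmod (fourier u \<xi>))\<^sup>2)"
    using u by (simp add: sobolev_def)
  have "form u u \<le> (LINT \<xi>|lborel. b * ((1 + (norm \<xi>)\<^sup>2) powr (1 / 2) * (cmod (fourier u \<xi>))\<^sup>2))"
    unfolding form_self mean_square_def norm_weighted_square
  proof (rule integral_mono)
    show "integrable lborel (\<lambda>\<xi>. A \<xi> * (cmod (fourier u \<xi>))\<^sup>2)"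
      using square_integrable_integrable[OF weighted_square_integrable[OF u]] by (simp add: norm_weighted_square)
    show "integrable lborel (\<lambda>\<xi>. b * ((1 + (norm \<xi>)\<^sup>2) powr (1 / 2) * (cmod (fourier u \<xi>))\<^sup>2))"
      using i by (rule integrable_mult_right)
    show "A \<xi> * (cmod (fourier u \<xi>))\<^sup>2 \<le> b * ((1 + (norm \<xi>)\<^sup>2) powr (1 / 2) * (cmod (fourier u \<xi>))\<^sup>2)" for \<xi>
      unfolding mult.assoc[symmetric] by (intro mult_right_mono A_upper) simp
  qed
  then show ?thesis by (simp add: sobolev_norm_square)
qed

lemma sobolev_norm_mult:
  assumes u: "(u :: 'a \<Rightarrow> real) \<in> sobolev (1 / 2)"
  shows "sobolev_norm (1 / 2) (\<lambda>x. t * u x) = \<bar>t\<bar> * sobolev_norm (1 / 2) u"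
proof -
  note sq = sobolev_square_integrable[OF u]
  have [measurable]: "fourier u \<in> borel_measurable borel" "fourier (\<lambda>x. t * u x) \<in> borel_measurable borel"
    by (intro fourier_borel sq square_integrable_cmult)+
  have "(LINT \<xi>|lborel. (1 + (norm \<xi>)\<^sup>2) powr (1 / 2) * (cmod (fourier (\<lambda>x. t * u x) \<xi>))\<^sup>2)
    = (LINT \<xi>|lborel. t\<^sup>2 * ((1 + (norm \<xi>)\<^sup>2) powr (1 / 2) * (cmod (fourier u \<xi>))\<^sup>2))"
  proof (rule integral_cong_AE)
    show "AE \<xi> in lborel. (1 + (norm \<xi>)\<^sup>2) powr (1 / 2) * (cmod (fourier (\<lambda>x. t * u x) \<xi>))\<^sup>2
      = t\<^sup>2 * ((1 + (norm \<xi>)\<^sup>2) powr (1 / 2) * (cmod (fourier u \<xi>))\<^sup>2)"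
      using fourier_mult[OF sq, of t] by eventually_elim (simp add: norm_mult power_mult_distrib)
  qed measurable
  then show ?thesis by (simp add: sobolev_norm_def real_sqrt_mult)
qed

text \<open>
  The symbol of the equation differs from the symbol of the operator by a constant; by Parseval's
  formula the constant contributes an integral in real space.
\<close>

lemma form_eq_operator:
  assumes u: "u \<in> sobolev (1 / 2)" and v: "v \<in> sobolev (1 / 2)"
  shows "Re (LINT \<xi>|lborel. complex_of_real (A \<xi> + k) * fourier u \<xi> * cnj (fourier v \<xi>))
    = form u v + k * (LINT x|lborel. u x * v x)"
proof -
  note sq = sobolev_square_integrable
  have i1: "integrable lborel (\<lambda>\<xi>. fourier u \<xi> * cnj (fourier v \<xi>))"
    by (intro square_integrable_times square_integrable_cnj square_integrable_fourier sq u v)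
  have i2: "integrable lborel (\<lambda>\<xi>. complex_of_real (A \<xi>) * fourier u \<xi> * cnj (fourier v \<xi>))"
    unfolding symbol_product_eq by (rule weighted_product_integrable[OF u v])
  have "(LINT \<xi>|lborel. complex_of_real (A \<xi> + k) * fourier u \<xi> * cnj (fourier v \<xi>))
    = (LINT \<xi>|lborel. complex_of_real (A \<xi>) * fourier u \<xi> * cnj (fourier v \<xi>) + complex_of_real k * (fourier u \<xi> * cnj (fourier v \<xi>)))"
    by (intro Bochner_Integration.integral_cong refl) (simp add: distrib_right mult.assoc)
  also have "\<dots> = (LINT \<xi>|lborel. complex_of_real (A \<xi>) * fourier u \<xi> * cnj (fourier v \<xi>))
      + complex_of_real k * (LINT \<xi>|lborel. fourier u \<xi> * cnj (fourier v \<xi>))"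
    using i1 i2 by simp
  finally show ?thesis using Parseval[OF sq[OF u] sq[OF v]] by (simp add: form_def)
qed

end

locale elliptic_problem = elliptic_symbol A a b +
  subcritical_problem "sobolev (1 / 2)" "elliptic_symbol.form A" "2 / a" p
  for A :: "'a::euclidean_space \<Rightarrow> real" and a b p :: real
begin

lemma solution_imp_critical_point:
  assumes g: "g \<in> sobolev (1 / 2)"
    and eq: "\<And>v. v \<in> sobolev (1 / 2) \<Longrightarrow> form g v = (LINT x|lborel. signed_powr p (g x) * v x)"
  shows "critical_point (1 / 2) action g"
proof -
  obtain M where M: "M > 0" "\<And>h. h \<in> sobolev (1 / 2) \<Longrightarrow> form h h \<le> 1 \<Longrightarrow> \<bar>action (\<lambda>x. g x + h x) - action g\<bar> \<le> M * form h h"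
    using solution_imp_quadratic_bound[OF g eq] by blast
  define B where "B = \<bar>b\<bar> + 1"
  have B: "B > 0" by (simp add: B_def)
  have fB: "form h h \<le> B * (sobolev_norm (1 / 2) h)\<^sup>2" if "h \<in> sobolev (1 / 2)" for h
    by (rule order_trans[OF form_le_sobolev_norm[OF that] mult_right_mono]) (auto simp: B_def)
  have "\<exists>\<delta>>0. \<forall>h\<in>sobolev (1 / 2). sobolev_norm (1 / 2) h < \<delta> \<longrightarrow>
      \<bar>action (\<lambda>x. g x + h x) - action g - 0\<bar> \<le> e * sobolev_norm (1 / 2) h" if e: "e > 0" for e
  proof (intro exI[of _ "min (1 / B) (min 1 (e / (M * B)))"] conjI ballI impI)
    show "0 < min (1 / B) (min 1 (e / (M * B)))" using B M(1) e by simp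
    fix h :: "'a \<Rightarrow> real" assume h: "h \<in> sobolev (1 / 2)" and lt: "sobolev_norm (1 / 2) h < min (1 / B) (min 1 (e / (M * B)))"
    define n where "n = sobolev_norm (1 / 2) h"
    have n: "0 \<le> n" "n < 1 / B" "n < 1" "n < e / (M * B)" using lt sobolev_norm_nonneg[of h] by (auto simp: n_def)
    have "n\<^sup>2 \<le> n" using n by (simp add: power2_eq_square mult_left_le)
    then have "B * n\<^sup>2 \<le> B * n" using B by simp
    also have "\<dots> \<le> 1" using n(2) B by (simp add: field_simps)
    finally have "form h h \<le> 1" using fB[OF h] by (simp add: n_def)
    then have "\<bar>action (\<lambda>x. g x + h x) - action g\<bar> \<le> M * form h h" by (rule M(2)[OF h])
    also have "\<dots> \<le> M * (B * n\<^sup>2)" using fB[OF h] M(1) by (simp add: n_def)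
    also have "\<dots> = (M * B * n) * n" by (simp add: power2_eq_square)
    also have "\<dots> \<le> e * n" using n M(1) B by (intro mult_right_mono) (auto simp: field_simps)
    finally show "\<bar>action (\<lambda>x. g x + h x) - action g - 0\<bar> \<le> e * sobolev_norm (1 / 2) h" by (simp add: n_def)
  qed
  then show ?thesis
    using g by (auto simp: critical_point_def has_frechet_derivative_def intro: exI[of _ 0])
qed

lemma critical_point_imp_Nehari:
  assumes "critical_point (1 / 2) action v"
  shows "form v v = power_integral v"
proof (rule critical_imp_Nehari)
  show v: "v \<in> sobolev (1 / 2)" using assms by (simp add: critical_point_def)
  fix e :: real assume e: "e > 0"
  define n where "n = sobolev_norm (1 / 2) v"
  have n: "n \<ge> 0" unfolding n_def by (rule sobolev_norm_nonneg)
  have "e / (n + 1) > 0" using e n by simp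
  then obtain d where d: "d > 0" "\<And>h. h \<in> sobolev (1 / 2) \<Longrightarrow> sobolev_norm (1 / 2) h < d \<Longrightarrow>
      \<bar>action (\<lambda>x. v x + h x) - action v - 0\<bar> \<le> e / (n + 1) * sobolev_norm (1 / 2) h"
    using assms unfolding critical_point_def has_frechet_derivative_def by blast
  show "\<exists>\<delta>>0. \<forall>t. \<bar>t\<bar> < \<delta> \<longrightarrow> \<bar>action (\<lambda>x. v x + t * v x) - action v\<bar> \<le> e * \<bar>t\<bar>"
  proof (intro exI[of _ "d / (n + 1)"] conjI allI impI)
    show "0 < d / (n + 1)" using d(1) n by simp
    fix t :: real assume t: "\<bar>t\<bar> < d / (n + 1)"
    have nt: "sobolev_norm (1 / 2) (\<lambda>x. t * v x) = \<bar>t\<bar> * n" unfolding n_def by (rule sobolev_norm_mult[OF v])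
    have "\<bar>t\<bar> * n \<le> \<bar>t\<bar> * (n + 1)" by (intro mult_left_mono) auto
    also have "\<dots> < d" using t n by (simp add: pos_less_divide_eq)
    finally have "\<bar>action (\<lambda>x. v x + t * v x) - action v - 0\<bar> \<le> e / (n + 1) * (\<bar>t\<bar> * n)"
      using d(2)[OF sobolev_mult[OF v, of t]] unfolding nt by blast
    also have "\<dots> = e * \<bar>t\<bar> * (n / (n + 1))" by simp
    also have "\<dots> \<le> e * \<bar>t\<bar> * 1" using e n by (intro mult_left_mono) auto
    finally show "\<bar>action (\<lambda>x. v x + t * v x) - action v\<bar> \<le> e * \<bar>t\<bar>" by simp
  qed
qed

lemma least_action_solution:
  "\<exists>g\<in>sobolev (1 / 2). \<not> (AE x in lborel. g x = 0) \<and>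
    (\<forall>v\<in>sobolev (1 / 2). form g v = (LINT x|lborel. signed_powr p (g x) * v x)) \<and>
    critical_point (1 / 2) action g \<and>
    (\<forall>v. \<not> (AE x in lborel. v x = 0) \<longrightarrow> critical_point (1 / 2) action v \<longrightarrow> action g \<le> action v)"
proof -
  obtain g where g: "g \<in> sobolev (1 / 2)" "\<not> (AE x in lborel. g x = 0)"
    "\<And>v. v \<in> sobolev (1 / 2) \<Longrightarrow> form g v = (LINT x|lborel. signed_powr p (g x) * v x)"
    "\<And>v. v \<in> sobolev (1 / 2) \<Longrightarrow> \<not> (AE x in lborel. v x = 0) \<Longrightarrow> form v v = power_integral v \<Longrightarrow> form g g \<le> form v v"
    using least_form_solution by blast
  have crit: "critical_point (1 / 2) action g" by (rule solution_imp_critical_point[OF g(1,3)])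
  have act: "action v = (1 / 2 - 1 / p) * form v v" if "critical_point (1 / 2) action v" for v
    using critical_point_imp_Nehari[OF that] by (simp add: action_def algebra_simps)
  have "action g \<le> action v" if v: "\<not> (AE x in lborel. v x = 0)" "critical_point (1 / 2) action v" for v
    unfolding act[OF crit] act[OF v(2)]
  proof (rule mult_left_mono)
    show "form g g \<le> form v v"
      using v by (intro g(4) critical_point_imp_Nehari) (auto simp: critical_point_def)
    show "0 \<le> 1 / 2 - 1 / p" using p_gt_2 by (simp add: field_simps)
  qed
  with g crit show ?thesis by (intro bexI[of _ g]) auto
qed

end

text \<open>
  The difference \<open>sqrt (c^2 * k^2 + m^2 * c^4) - m * c^2\<close> is at least \<open>c * k / 2\<close> for \<open>k \<ge> 2 * m * c\<close>; for smaller
  frequencies the constant \<open>\<mu>\<close> dominates a multiple of \<open>1 + k\<close>. This gives the three candidates for the lower constant.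
\<close>

lemma relativistic_symbol_elliptic:
  fixes m \<mu> c :: real
  assumes m: "m > 0" and \<mu>: "\<mu> > 0" and c: "c > 0"
  shows "elliptic_symbol (\<lambda>\<xi>::'a::euclidean_space. relativistic_symbol m c \<xi> - m * c\<^sup>2 + \<mu>)
    (min (\<mu> / 2) (min (c / 2) (\<mu> / (4 * m * c)))) (c + \<mu>)"
proof
  let ?a = "min (\<mu> / 2) (min (c / 2) (\<mu> / (4 * m * c)))"
  show "(\<lambda>\<xi>::'a. relativistic_symbol m c \<xi> - m * c\<^sup>2 + \<mu>) \<in> borel_measurable borel"
    unfolding relativistic_symbol_def by measurable
  show a: "0 < ?a" using assms by simp
  fix \<xi> :: 'a
  define k where "k = norm \<xi>"
  define X where "X = relativistic_symbol m c \<xi>"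
  have k: "k \<ge> 0" by (simp add: k_def)
  have X: "X = sqrt ((c * k)\<^sup>2 + (m * c\<^sup>2)\<^sup>2)"
    by (simp add: X_def relativistic_symbol_def k_def power_mult_distrib flip: power_mult)
  have X1: "X \<ge> c * k" unfolding X using c k by (intro real_le_rsqrt) auto
  have X2: "X \<ge> m * c\<^sup>2" unfolding X using c m by (intro real_le_rsqrt) auto
  have X3: "X \<le> c * k + m * c\<^sup>2" unfolding X using c k m by (intro sqrt_sum_squares_le_sum) auto
  show "?a * (1 + norm \<xi>) \<le> relativistic_symbol m c \<xi> - m * c\<^sup>2 + \<mu>"
    unfolding k_def[symmetric] X_def[symmetric]
  proof (cases "k \<ge> 2 * m * c")
    case True
    have "?a * k \<le> c / 2 * k" using k by (intro mult_right_mono) auto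
    then have "?a * k \<le> c * k / 2" by simp
    moreover have "2 * m * c * c \<le> k * c" using True c by (intro mult_right_mono) auto
    then have "2 * (m * c\<^sup>2) \<le> c * k" by (simp add: power2_eq_square ac_simps)
    moreover have "?a \<le> \<mu> / 2" by simp
    ultimately show "?a * (1 + k) \<le> X - m * c\<^sup>2 + \<mu>"
      using X1 \<mu> unfolding distrib_left mult_1_right by linarith
  next
    case False
    have "?a * k \<le> \<mu> / (4 * m * c) * k" using k by (intro mult_right_mono) auto
    also have "\<dots> \<le> \<mu> / (4 * m * c) * (2 * m * c)" using False assms by (intro mult_left_mono) auto
    also have "\<dots> = \<mu> / 2" using assms by simp
    finally have "?a * k \<le> \<mu> / 2" .
    moreover have "?a \<le> \<mu> / 2" by simp
    ultimately show "?a * (1 + k) \<le> X - m * c\<^sup>2 + \<mu>"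
      using X2 unfolding distrib_left mult_1_right by linarith
  qed
  define W where "W = (1 + k\<^sup>2) powr (1 / 2)"
  have W: "W = sqrt (1 + k\<^sup>2)" by (simp add: W_def powr_half_sqrt)
  have "k \<le> W" "1 \<le> W" unfolding W using k by (auto intro: real_le_rsqrt)
  then have "c * k \<le> c * W" "\<mu> * 1 \<le> \<mu> * W" using c \<mu> by (auto intro: mult_left_mono)
  then show "relativistic_symbol m c \<xi> - m * c\<^sup>2 + \<mu> \<le> (c + \<mu>) * (1 + (norm \<xi>)\<^sup>2) powr (1 / 2)"
    unfolding k_def[symmetric] X_def[symmetric] W_def[symmetric] using X3 by (simp add: distrib_right)
qed

theorem theorem1p1:
  fixes m \<mu> c p :: real
  assumes "CARD('n::finite) \<ge> 2"
    and "m > 0" and "\<mu> > 0" and "c \<ge> 1"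
    and "2 < p" and "p < 2 * real CARD('n) / (real CARD('n) - 1)"
  shows "\<exists>u :: real ^ 'n \<Rightarrow> real. is_solution m \<mu> c p u \<and> ground_state m \<mu> c p u"
proof -
  let ?A = "\<lambda>\<xi>::real ^ 'n. relativistic_symbol m c \<xi> - m * c\<^sup>2 + \<mu>"
  let ?a = "min (\<mu> / 2) (min (c / 2) (\<mu> / (4 * m * c)))"
  interpret elliptic_symbol ?A ?a "c + \<mu>"
    using assms by (intro relativistic_symbol_elliptic) auto
  interpret translation_invariant_form "sobolev (1 / 2)" form "2 / ?a"
    by (rule translation_invariant_form)
  interpret elliptic_problem ?A ?a "c + \<mu>" p
    by unfold_locales (use assms in simp_all)
  have energy: "energy m \<mu> c p = action"
    by (simp add: fun_eq_iff energy_def action_def form_self_integral power_integral_def)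
  obtain g where g: "g \<in> sobolev (1 / 2)" "\<not> (AE x in lborel. g x = 0)"
    "\<And>v. v \<in> sobolev (1 / 2) \<Longrightarrow> form g v = (LINT x|lborel. signed_powr p (g x) * v x)"
    "critical_point (1 / 2) action g"
    "\<And>v. \<not> (AE x in lborel. v x = 0) \<Longrightarrow> critical_point (1 / 2) action v \<Longrightarrow> action g \<le> action v"
    using least_action_solution by blast
  have "is_solution m \<mu> c p g"
    unfolding is_solution_def
  proof (intro conjI ballI g(1))
    fix v :: "real ^ 'n \<Rightarrow> real" assume v: "v \<in> sobolev (1 / 2)"
    have "relativistic_operator m c g v = form g v + (m * c\<^sup>2 - \<mu>) * (LINT x|lborel. g x * v x)"
      using form_eq_operator[OF g(1) v, of "m * c\<^sup>2 - \<mu>"] by (simp add: relativistic_operator_def)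
    then show "relativistic_operator m c g v - m * c\<^sup>2 * (LINT x|lborel. g x * v x) + \<mu> * (LINT x|lborel. g x * v x)
      = (LINT x|lborel. \<bar>g x\<bar> powr (p - 2) * g x * v x)"
      using g(3)[OF v] by (simp add: signed_powr_def algebra_simps)
  qed
  moreover have "ground_state m \<mu> c p g"
    unfolding ground_state_def nonzero_critical_values_def energy using g by blast
  ultimately show ?thesis by blast
qed

end
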